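(* Let $G$ be a solvable group with a purely positive length function. Suppose that $G$ is virtually torsion-free and every abelian subgroup of $G$ is finitely generated. Then $G$ is virtually either $\mathbb{Z}^{n}$ for some $n\geq 0$, or a non-nilpotent group $B$ fitting into a short exact sequence $1\to\mathbb{Z}^{m}\to B\to\mathbb{Z}^{k}\to 1$ for some integers $m,k$, in which the conjugation action of $\mathbb{Z}^{k}$ on $\mathbb{Z}^{m}$ is effective and every non-identity element of $\mathbb{Z}^k$ acts by a non-unipotent matrix.
   Context: A length function on a group $G$ is a function $l:G\to[0,\infty)$ such that $l(g^{n})=|n|\,l(g)$ for all $g\in G,n\in\mathbb{Z}$; $l(hgh^{-1})=l(g)$ for all $g,h$; and $l(ab)\leq l(a)+l(b)$ whenever $a,b$ commute. It is purely positive if $l(g)>0$ for every element of infinite order. A matrix is unipotent if all its eigenvalues equal $1$. *)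

theory Defs
  imports "HOL-Algebra.Solvable_Groups" "HOL-Algebra.Coset" "Jordan_Normal_Form.Char_Poly"
begin

definition length_function :: "('a, 'b) monoid_scheme \<Rightarrow> ('a \<Rightarrow> real) \<Rightarrow> bool" where
  "length_function G l \<longleftrightarrow>
     (\<forall>g\<in>carrier G. l g \<ge> 0) \<and>
     (\<forall>g\<in>carrier G. \<forall>n::int. l (g [^]\<^bsub>G\<^esub> n) = \<bar>real_of_int n\<bar> * l g) \<and>
     (\<forall>g\<in>carrier G. \<forall>h\<in>carrier G. l (h \<otimes>\<^bsub>G\<^esub> g \<otimes>\<^bsub>G\<^esub> inv\<^bsub>G\<^esub> h) = l g) \<and>
     (\<forall>a\<in>carrier G. \<forall>b\<in>carrier G. a \<otimes>\<^bsub>G\<^esub> b = b \<otimes>\<^bsub>G\<^esub> a \<longrightarrow> l (a \<otimes>\<^bsub>G\<^esub> b) \<le> l a + l b)"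

definition infinite_order :: "('a, 'b) monoid_scheme \<Rightarrow> 'a \<Rightarrow> bool" where
  "infinite_order G g \<longleftrightarrow> (\<forall>n::nat. n > 0 \<longrightarrow> g [^]\<^bsub>G\<^esub> n \<noteq> \<one>\<^bsub>G\<^esub>)"

definition purely_positive :: "('a, 'b) monoid_scheme \<Rightarrow> ('a \<Rightarrow> real) \<Rightarrow> bool" where
  "purely_positive G l \<longleftrightarrow> (\<forall>g\<in>carrier G. infinite_order G g \<longrightarrow> l g > 0)"

definition finite_index_subgroup :: "'a set \<Rightarrow> ('a, 'b) monoid_scheme \<Rightarrow> bool" where
  "finite_index_subgroup H G \<longleftrightarrow> subgroup H G \<and> finite (rcosets\<^bsub>G\<^esub> H)"

definition torsion_free_set :: "('a, 'b) monoid_scheme \<Rightarrow> 'a set \<Rightarrow> bool" where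
  "torsion_free_set G H \<longleftrightarrow> (\<forall>g\<in>H. g \<noteq> \<one>\<^bsub>G\<^esub> \<longrightarrow> infinite_order G g)"

definition virtually_torsion_free :: "('a, 'b) monoid_scheme \<Rightarrow> bool" where
  "virtually_torsion_free G \<longleftrightarrow> (\<exists>H. finite_index_subgroup H G \<and> torsion_free_set G H)"

definition abelian_subgroups_fg :: "('a, 'b) monoid_scheme \<Rightarrow> bool" where
  "abelian_subgroups_fg G \<longleftrightarrow>
     (\<forall>A. subgroup A G \<and> (\<forall>x\<in>A. \<forall>y\<in>A. x \<otimes>\<^bsub>G\<^esub> y = y \<otimes>\<^bsub>G\<^esub> x)
          \<longrightarrow> (\<exists>S. finite S \<and> S \<subseteq> A \<and> generate G S = A))"

definition Zn :: "nat \<Rightarrow> (nat \<Rightarrow> int) monoid" where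
  "Zn n = \<lparr>carrier = {f. \<forall>i\<ge>n. f i = 0}, monoid.mult = (\<lambda>f g i. f i + g i), monoid.one = (\<lambda>i. 0)\<rparr>"

definition unit_vec_Z :: "nat \<Rightarrow> nat \<Rightarrow> int" where
  "unit_vec_Z j = (\<lambda>i. if i = j then 1 else 0)"

definition lcs_step :: "('a, 'b) monoid_scheme \<Rightarrow> 'a set \<Rightarrow> 'a set" where
  "lcs_step G H = generate G {x \<otimes>\<^bsub>G\<^esub> y \<otimes>\<^bsub>G\<^esub> inv\<^bsub>G\<^esub> x \<otimes>\<^bsub>G\<^esub> inv\<^bsub>G\<^esub> y | x y. x \<in> H \<and> y \<in> carrier G}"

definition nilpotent_group :: "('a, 'b) monoid_scheme \<Rightarrow> bool" where
  "nilpotent_group G \<longleftrightarrow> (\<exists>n. (lcs_step G ^^ n) (carrier G) = {\<one>\<^bsub>G\<^esub>})"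

definition unipotent :: "int mat \<Rightarrow> bool" where
  "unipotent A \<longleftrightarrow> (\<forall>ev. eigenvalue (map_mat complex_of_int A) ev \<longrightarrow> ev = 1)"

text \<open>Matrix (w.r.t. the standard basis, transported along psi : N \<cong> Z^m) of the
  conjugation action of h on the normal abelian subgroup N.\<close>
definition conj_matrix :: "('a, 'b) monoid_scheme \<Rightarrow> 'a set \<Rightarrow> ('a \<Rightarrow> nat \<Rightarrow> int) \<Rightarrow> nat \<Rightarrow> 'a \<Rightarrow> int mat" where
  "conj_matrix G N psi m h =
     mat m m (\<lambda>(i, j). psi (h \<otimes>\<^bsub>G\<^esub> inv_into N psi (unit_vec_Z j) \<otimes>\<^bsub>G\<^esub> inv\<^bsub>G\<^esub> h) i)"

definition special_extension :: "('a, 'b) monoid_scheme \<Rightarrow> 'a set \<Rightarrow> bool" where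
  "special_extension G B \<longleftrightarrow>
     \<not> nilpotent_group (G\<lparr>carrier := B\<rparr>) \<and>
     (\<exists>N m k psi.
        N \<lhd> G\<lparr>carrier := B\<rparr> \<and>
        psi \<in> iso (G\<lparr>carrier := N\<rparr>) (Zn m) \<and>
        (G\<lparr>carrier := B\<rparr>) Mod N \<cong> Zn k \<and>
        (\<forall>h\<in>B. (\<forall>x\<in>N. h \<otimes>\<^bsub>G\<^esub> x \<otimes>\<^bsub>G\<^esub> inv\<^bsub>G\<^esub> h = x) \<longrightarrow> h \<in> N) \<and>
        (\<forall>h\<in>B - N. \<not> unipotent (conj_matrix G N psi m h)))"

end

theory Submission
  imports Defs "HOL-Computational_Algebra.Fundamental_Theorem_Algebra"
    "HOL-Library.Z2" "HOL-Library.Function_Algebras"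
begin

text \<open>
  Pass to a torsion-free subgroup of finite index. If \<open>x y x\<inverse> = z y\<close> with \<open>z\<close> commuting with \<open>x\<close> and
  \<open>y\<close>, then \<open>z\<^sup>n y\<close> is conjugate to \<open>y\<close>, so \<open>n l(z) \<le> 2 l(y)\<close> for all \<open>n\<close> and \<open>z = 1\<close>. Hence
  nilpotent subgroups are abelian, the Fitting subgroup \<open>F \<cong> \<int>\<^sup>m\<close> is abelian and equal to its own
  centraliser, and an element acting on \<open>F\<close> with only the eigenvalue 1 lies in \<open>F\<close>.

  Let \<open>\<Gamma>\<close> consist of the elements acting on \<open>F\<close> trivially modulo 4. A subset \<open>A\<close> that is abelian
  modulo \<open>F\<close> has finitely many weights on \<open>\<complex>\<^sup>m\<close>. An element \<open>x \<in> \<Gamma>\<close> normalising \<open>A\<close> permutes them, so a power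
  \<open>x\<^sup>n\<close> commutes with \<open>A\<close> modulo \<open>F\<close>, and then so does \<open>x\<close>, because conjugation by \<open>x\<close> is congruent
  to the identity modulo 4. Going up the derived series, \<open>\<Gamma> / F\<close> is abelian. It is torsion-free,
  because a root of unity occurring as an eigenvalue of an element of \<open>\<Gamma>\<close> is 1.

  For \<open>g \<in> \<Gamma>\<close> at which as few weights as possible are trivial, the centraliser of \<open>g\<close> in \<open>F\<close> is
  central in \<open>\<Gamma>\<close>. So the centraliser \<open>C\<close> of \<open>g\<close> in \<open>\<Gamma>\<close> is nilpotent, hence abelian and finitely
  generated; as finitely many cosets of \<open>F C\<close> cover \<open>\<Gamma>\<close>, the quotient \<open>\<Gamma> / F\<close> is finitely generated.
\<close>

section \<open>Weights of commuting operators\<close>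

text \<open>The length function is used only in \<open>commuting_commutator_trivial\<close>, which
  rules out a nontrivial Heisenberg relation. For the action of x on the Fitting subgroup F, written
  additively, it says that 1 - x and its square have the same kernel: the eigenvalue 1 never carries
  a nontrivial Jordan block. Level 4 is chosen because -1 is congruent to 1 modulo 2, so level 2
  would let roots of unity survive. If P is congruent to 1 modulo 4, then (P + 1)/2 is still
  integral and congruent to 1 modulo 2, so its determinant is odd and -1 is not an eigenvalue of P.
  Permuting finitely many weights takes the place of a triangularisation theorem for solvable linear
  groups; the congruence condition then turns commuting of a power into commuting. The obstacle to
  finite generation of the quotient is that the hypothesis concerns abelian subgroups, not
  quotients. One needs an abelian subgroup of the congruence subgroup that covers a subgroup of
  finite index of the quotient. The centraliser of g is a candidate because 1 - g is invertible over
  the rationals away from its kernel; genericity makes that kernel central, so that it does no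
  harm.\<close>

locale complex_vector_space = vector_space scale
  for scale :: "complex \<Rightarrow> 'v::ab_group_add \<Rightarrow> 'v" (infixr \<open>*s\<close> 75)
begin

abbreviation lin :: "('v \<Rightarrow> 'v) \<Rightarrow> bool" where
  "lin f \<equiv> Vector_Spaces.linear scale scale f"

lemma lin_add: "lin f \<Longrightarrow> f (x + y) = f x + f y"
  and lin_scale: "lin f \<Longrightarrow> f (c *s x) = c *s f x"
  by (simp_all add: Vector_Spaces.linear_iff)

lemma lin_zero: "lin f \<Longrightarrow> f 0 = 0"
  using lin_add[of f 0 0] by simp

lemma lin_minus: "lin f \<Longrightarrow> f (x - y) = f x - f y"
  using lin_add[of f "x - y" y] by (simp add: algebra_simps)

lemma lin_sum: "lin f \<Longrightarrow> f (sum g A) = (\<Sum>i\<in>A. f (g i))"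
  by (induction A rule: infinite_finite_induct) (auto simp: lin_zero lin_add)

lemma linI: "(\<And>x y. f (x + y) = f x + f y) \<Longrightarrow> (\<And>c x. f (c *s x) = c *s f x) \<Longrightarrow> lin f"
  by (simp add: Vector_Spaces.linear_iff vector_space_axioms)

lemma lin_funpow: "lin f \<Longrightarrow> lin (f ^^ n)"
  by (induction n) (auto simp: Vector_Spaces.linear_iff vector_space_axioms)

text \<open>The whole space may be infinite-dimensional (later it is \<open>nat => complex\<close>).
  Finite dimension enters this section as \<open>S \<subseteq> span B\<close> with \<open>B\<close>
  finite; here \<open>card B + 1\<close> iterates of \<open>w\<close> are too many to be
  independent.\<close>

lemma exists_annihilating_combination:
  assumes S: "S \<subseteq> span B" "finite B" and T: "T ` S \<subseteq> S" and w: "w \<in> S"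
  shows "\<exists>n c. (\<exists>i\<le>n. c i \<noteq> 0) \<and> (\<Sum>i\<le>n. c i *s (T ^^ i) w) = 0"
proof -
  define u where "u i = (T ^^ i) w" for i
  have uS: "u i \<in> S" for i
    unfolding u_def using T w by (induction i) auto
  define n where "n = card B"
  show ?thesis
  \<comment> \<open>\<open>dependent\<close> speaks of a set of vectors, so a repetition among the
    iterates is treated separately and gives the relation \<open>u i - u j = 0\<close>.\<close>
  proof (cases "inj_on u {..n}")
    case True
    have "dependent (u ` {..n})"
    proof (rule ccontr)
      assume "\<not> dependent (u ` {..n})"
      then have "card (u ` {..n}) \<le> card B"
        using independent_span_bound[OF S(2)] S(1) uS by (metis image_subset_iff subset_trans)
      then show False using True by (simp add: card_image n_def)
    qed
    then obtain d where d: "(\<Sum>v\<in>u ` {..n}. d v *s v) = 0" "\<exists>v\<in>u ` {..n}. d v \<noteq> 0"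
      using dependent_finite[of "u ` {..n}"] by auto
    have "(\<Sum>i\<le>n. d (u i) *s u i) = 0"
      using d(1) by (simp add: sum.reindex[OF True])
    moreover obtain i where "i \<le> n" "d (u i) \<noteq> 0" using d(2) by blast
    ultimately show ?thesis unfolding u_def by (intro exI[of _ n] exI[of _ "\<lambda>i. d ((T ^^ i) w)"]) blast
  next
    case False
    then obtain i j where ij: "i \<le> n" "j \<le> n" "i \<noteq> j" "u i = u j"
      by (auto simp: inj_on_def)
    define c where "c k = (if k = i then 1 else if k = j then -1 else 0 :: complex)" for k
    have "(\<Sum>k\<le>n. c k *s u k) = (\<Sum>k\<in>{i,j}. c k *s u k)"
      by (rule sum.mono_neutral_right) (use ij in \<open>auto simp: c_def\<close>)
    also have "\<dots> = 0" using ij by (simp add: c_def)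
    finally show ?thesis unfolding u_def using ij by (intro exI[of _ n] exI[of _ c]) (auto simp: c_def)
  qed
qed

definition eval_at :: "('v \<Rightarrow> 'v) \<Rightarrow> complex poly \<Rightarrow> 'v \<Rightarrow> 'v" where
  "eval_at T p w = (\<Sum>i\<le>degree p. coeff p i *s (T ^^ i) w)"

lemma eval_at_bound:
  assumes "degree p \<le> n" shows "eval_at T p w = (\<Sum>i\<le>n. coeff p i *s (T ^^ i) w)"
  unfolding eval_at_def
  by (rule sum.mono_neutral_left) (use assms in \<open>auto simp: coeff_eq_0\<close>)

text \<open>A root is moved from the polynomial to the vector: this drives the induction on the
  degree in \<open>unipotent_on_vector\<close>.\<close>

lemma eval_at_linear_factor:
  assumes "lin T"
  shows "eval_at T ([:-r, 1:] * q) w = eval_at T q (T w - r *s w)"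
proof -
  let ?n = "degree q"
  have Tc: "(T ^^ i) (T w - r *s w) = (T ^^ Suc i) w - r *s (T ^^ i) w" for i
    by (simp add: lin_minus[OF lin_funpow[OF assms]] lin_scale[OF lin_funpow[OF assms]] funpow_swap1)
  have eq: "[:-r, 1:] * q = pCons 0 q - Polynomial.smult r q"
    by (simp add: algebra_simps)
  have "degree ([:-r, 1:] * q) \<le> Suc ?n"
    using degree_mult_le[of "[:-r, 1:]" q] by simp
  then have "eval_at T ([:-r, 1:] * q) w = (\<Sum>i\<le>Suc ?n. coeff (pCons 0 q - Polynomial.smult r q) i *s (T ^^ i) w)"
    using eval_at_bound eq by metis
  also have "\<dots> = (\<Sum>i\<le>Suc ?n. coeff (pCons 0 q) i *s (T ^^ i) w) - (\<Sum>i\<le>Suc ?n. (r * coeff q i) *s (T ^^ i) w)"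
    by (simp add: sum_subtractf scale_left_diff_distrib del: sum.atMost_Suc)
  also have "(\<Sum>i\<le>Suc ?n. coeff (pCons 0 q) i *s (T ^^ i) w) = (\<Sum>i\<le>?n. coeff q i *s (T ^^ Suc i) w)"
    by (subst sum.atMost_Suc_shift) (simp del: funpow.simps)
  also have "(\<Sum>i\<le>Suc ?n. (r * coeff q i) *s (T ^^ i) w) = (\<Sum>i\<le>?n. coeff q i *s (r *s (T ^^ i) w))"
    by (simp add: coeff_eq_0 mult.commute)
  finally show ?thesis
    unfolding eval_at_def Tc by (simp add: sum_subtractf scale_right_diff_distrib del: funpow.simps)
qed

text \<open>Some nonzero polynomial in \<open>T\<close> kills \<open>w\<close>; its roots are split
  off one at a time. A root 1 costs one more power of \<open>1 - T\<close>. For another root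
  \<open>r\<close>, the vector \<open>?u\<close> obtained from the induction hypothesis satisfies
  \<open>T ?u = r *s ?u\<close>, so it must vanish.\<close>

lemma unipotent_on_vector:
  assumes S: "subspace S" "S \<subseteq> span B" "finite B" and T: "lin T" "T ` S \<subseteq> S" and w: "w \<in> S"
    and ev: "\<And>u c. u \<in> S \<Longrightarrow> u \<noteq> 0 \<Longrightarrow> T u = c *s u \<Longrightarrow> c = 1"
  shows "\<exists>k. ((\<lambda>v. v - T v) ^^ k) w = 0"
proof -
  let ?D = "\<lambda>v. v - T v"
  have linD: "lin ?D"
    by (rule linI) (simp_all add: lin_add[OF T(1)] lin_scale[OF T(1)] algebra_simps scale_right_diff_distrib)
  have DS: "?D u \<in> S" if "u \<in> S" for u
    using that T(2) S(1) by (auto intro: subspace_diff)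
  have DSn: "(?D ^^ k) u \<in> S" if "u \<in> S" for u k
    using that DS by (induction k) auto
  have comm: "(?D ^^ k) (T u) = T ((?D ^^ k) u)" for k u
    by (induction k) (simp_all add: lin_minus[OF T(1)])
  have main: "\<exists>k. (?D ^^ k) w = 0" if "p \<noteq> 0" "w \<in> S" "eval_at T p w = 0" for p w
    using that
  proof (induction "degree p" arbitrary: p w)
    case 0
    then obtain a where "p = [:a:]" "a \<noteq> 0" by (metis degree_eq_zeroE pCons_eq_0_iff)
    then have "w = 0" using "0.prems" by (simp add: eval_at_def)
    then show ?case by (metis funpow_0)
  next
    case (Suc n)
    then obtain r where r: "poly p r = 0"
      by (metis Fundamental_Theorem_Algebra.fundamental_theorem_of_algebra constant_degree nat.distinct(1))
    then obtain q where q: "p = [:-r, 1:] * q" using poly_eq_0_iff_dvd by (metis dvdE)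
    have q0: "q \<noteq> 0" using Suc.prems q by auto
    have dq: "n = degree q" using Suc.hyps(2) q q0 by (subst (asm) q, subst (asm) degree_mult_eq) auto
    have w'S: "T w - r *s w \<in> S"
      using Suc.prems(2) T(2) S(1) by (auto intro!: subspace_diff subspace_scale)
    have "eval_at T q (T w - r *s w) = 0"
      using Suc.prems(3) q eval_at_linear_factor[OF T(1)] by simp
    from Suc.hyps(1)[OF dq q0 w'S this] obtain k where k: "(?D ^^ k) (T w - r *s w) = 0" by blast
    show ?case
    proof (cases "r = 1")
      case True
      have "(?D ^^ Suc k) w = (?D ^^ k) (?D w)" by (simp only: funpow_Suc_right comp_apply)
      also have "\<dots> = (?D ^^ k) (- (T w - r *s w))" using True by simp
      also have "\<dots> = 0" using k lin_minus[OF lin_funpow[OF linD, of k], of 0 "T w - r *s w"]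
        by (simp add: lin_zero[OF lin_funpow[OF linD]])
      finally show ?thesis by blast
    next
      case False
      let ?u = "(?D ^^ k) w"
      have "T ?u - r *s ?u = 0"
        using k by (simp add: lin_minus[OF lin_funpow[OF linD]] lin_scale[OF lin_funpow[OF linD]] comm)
      then have "T ?u = r *s ?u" by simp
      then have "?u = 0" using ev[of ?u r] DSn[OF Suc.prems(2)] False by blast
      then show ?thesis by blast
    qed
  qed
  obtain n c where nc: "\<exists>i\<le>n. c i \<noteq> 0" "(\<Sum>i\<le>n. c i *s (T ^^ i) w) = 0"
    using exists_annihilating_combination[OF S(2,3) T(2) w] by blast
  define p where "p = (\<Sum>i\<le>n. monom (c i) i)"
  have cp: "coeff p i = (if i \<le> n then c i else 0)" for i
    unfolding p_def by (simp add: coeff_sum)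
  have p0: "p \<noteq> 0" using nc(1) cp by (metis coeff_0)
  have "degree p \<le> n" by (rule degree_le) (simp add: cp)
  then have "eval_at T p w = 0" using nc(2) eval_at_bound by (simp add: cp)
  then show ?thesis using main p0 w by blast
qed

text \<open>Without eigenvectors the eigenvalue hypothesis of \<open>unipotent_on_vector\<close>
  holds vacuously, so \<open>1 - T\<close> is nilpotent on \<open>w\<close>; but then its last
  nonzero iterate is fixed by \<open>T\<close>.\<close>

lemma exists_eigenvector:
  assumes S: "subspace S" "S \<subseteq> span B" "finite B" "S \<noteq> {0}" and T: "lin T" "T ` S \<subseteq> S"
  shows "\<exists>u\<in>S. u \<noteq> 0 \<and> (\<exists>c. T u = c *s u)"
proof (rule ccontr)
  assume no: "\<not> ?thesis"
  obtain w where w: "w \<in> S" "w \<noteq> 0" using S subspace_0 by blast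
  let ?D = "\<lambda>v. v - T v"
  have "\<exists>k. (?D ^^ k) w = 0"
    by (rule unipotent_on_vector[OF S(1-3) T w(1)]) (use no in blast)
  then obtain k where k: "(?D ^^ k) w = 0" "\<And>j. j < k \<Longrightarrow> (?D ^^ j) w \<noteq> 0"
    using exists_least_iff[of "\<lambda>k. (?D ^^ k) w = 0"] by blast
  have "k \<noteq> 0" using k(1) w(2) by (metis funpow_0)
  then obtain j where j: "k = Suc j" by (cases k) auto
  let ?u = "(?D ^^ j) w"
  have "?u \<in> S" using w(1) T(2) S(1) by (induction j) (auto intro: subspace_diff)
  moreover have "?u \<noteq> 0" using k(2) j by blast
  moreover have "T ?u = 1 *s ?u" using k(1) j by simp
  ultimately show False using no by blast
qed

lemma dim_psubset_subspace:
  assumes "subspace S" "S \<subset> U" "U \<subseteq> span B" "finite B"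
  shows "dim S < dim U"
proof -
  obtain C where C: "C \<subseteq> S" "independent C" "S \<subseteq> span C" "card C = dim S" using basis_exists by blast
  obtain D where D: "D \<subseteq> U" "independent D" "U \<subseteq> span D" "card D = dim U" using basis_exists by blast
  have fD: "finite D" using independent_span_bound[OF assms(4) D(2)] D(1) assms(3) by auto
  obtain v where v: "v \<in> U" "v \<notin> S" using assms by blast
  have "span C \<subseteq> S" using C(1) assms(1) by (rule span_minimal)
  then have "v \<notin> span C" using v by blast
  then have ind: "independent (insert v C)" and vC: "v \<notin> C"
    using independent_insertI C(2) span_base by auto
  have "insert v C \<subseteq> span D" using v C(1) D(3) assms(2) by auto
  from independent_span_bound[OF fD ind this] have "finite (insert v C)" "card (insert v C) \<le> card D" by auto
  then show ?thesis using vC C(4) D(4) by simp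
qed

text \<open>In a nonzero invariant subspace of least dimension, an eigenspace of one
  \<open>T a\<close> is invariant under all others and hence is everything. So all operators are
  scalar there, and \<open>A\<close> may be infinite.\<close>

lemma exists_joint_eigenvector:
  fixes T :: "'g \<Rightarrow> 'v \<Rightarrow> 'v"
  assumes S: "subspace S" "S \<subseteq> span B" "finite B" "S \<noteq> {0}"
    and T: "\<And>a. a \<in> A \<Longrightarrow> lin (T a)" "\<And>a. a \<in> A \<Longrightarrow> T a ` S \<subseteq> S"
    and comm: "\<And>a b v. a \<in> A \<Longrightarrow> b \<in> A \<Longrightarrow> T a (T b v) = T b (T a v)"
  shows "\<exists>u\<in>S. u \<noteq> 0 \<and> (\<forall>a\<in>A. \<exists>c. T a u = c *s u)"
proof -
  define P where "P U \<longleftrightarrow> subspace U \<and> U \<subseteq> S \<and> U \<noteq> {0} \<and> (\<forall>a\<in>A. T a ` U \<subseteq> U)" for U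
  have "P S" using S T by (auto simp: P_def)
  then obtain U where U: "P U" and min: "\<And>U'. P U' \<Longrightarrow> dim U \<le> dim U'"
    using ex_has_least_nat[of P S dim] by blast
  have US: "U \<subseteq> span B" using U S by (auto simp: P_def)
  have sc: "\<exists>c. \<forall>u\<in>U. T a u = c *s u" if a: "a \<in> A" for a
  proof -
    have "subspace U" "U \<noteq> {0}" "T a ` U \<subseteq> U" using U a by (auto simp: P_def)
    from exists_eigenvector[OF this(1) US S(3) this(2) T(1)[OF a] this(3)]
    obtain u c where u: "u \<in> U" "u \<noteq> 0" "T a u = c *s u" by blast
    define U' where "U' = {u\<in>U. T a u = c *s u}"
    have "subspace U'"
      using \<open>subspace U\<close> unfolding subspace_def U'_def
      by (auto simp: lin_zero[OF T(1)[OF a]] lin_add[OF T(1)[OF a]] lin_scale[OF T(1)[OF a]]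
          scale_right_distrib scale_left_commute)
    moreover have "T b ` U' \<subseteq> U'" if b: "b \<in> A" for b
    proof -
      have "T a (T b u) = c *s T b u" if "T a u = c *s u" for u
        using comm[OF a b, of u] that by (simp add: lin_scale[OF T(1)[OF b]])
      moreover have "T b u \<in> U" if "u \<in> U" for u using U b that by (auto simp: P_def)
      ultimately show ?thesis by (auto simp: U'_def)
    qed
    ultimately have "P U'" using U u by (auto simp: P_def U'_def)
    then have "U' = U"
      using min[of U'] dim_psubset_subspace[OF \<open>subspace U'\<close> _ US S(3)] by (force simp: U'_def)
    then show ?thesis by (auto simp: U'_def)
  qed
  have U': "subspace U" "U \<subseteq> S" "U \<noteq> {0}" using U by (auto simp: P_def)
  then obtain u where u: "u \<in> U" "u \<noteq> 0" using subspace_0 by blast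
  have "\<forall>a\<in>A. \<exists>c. T a u = c *s u" using sc u(1) by meson
  then show ?thesis using u U'(2) by blast
qed

text \<open>\<open>A\<close> is any set, so a weight need not be multiplicative. Extensionality
  makes a weight determined by its values on \<open>A\<close>, without which the set could not be
  finite.\<close>

definition weights :: "'v set \<Rightarrow> 'g set \<Rightarrow> ('g \<Rightarrow> 'v \<Rightarrow> 'v) \<Rightarrow> ('g \<Rightarrow> complex) set" where
  "weights S A T = {\<chi> \<in> A \<rightarrow>\<^sub>E UNIV. \<exists>u\<in>S. u \<noteq> 0 \<and> (\<forall>a\<in>A. T a u = \<chi> a *s u)}"

lemma exists_weight:
  fixes T :: "'g \<Rightarrow> 'v \<Rightarrow> 'v"
  assumes "subspace U" "U \<subseteq> span B" "finite B" "U \<noteq> {0}" "U \<subseteq> S"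
    and "\<And>a. a \<in> A \<Longrightarrow> lin (T a)" "\<And>a. a \<in> A \<Longrightarrow> T a ` U \<subseteq> U"
    and "\<And>a b v. a \<in> A \<Longrightarrow> b \<in> A \<Longrightarrow> T a (T b v) = T b (T a v)"
  shows "\<exists>\<chi>\<in>weights S A T. \<exists>u\<in>U. u \<noteq> 0 \<and> (\<forall>a\<in>A. T a u = \<chi> a *s u)"
proof -
  have "\<exists>u\<in>U. u \<noteq> 0 \<and> (\<forall>a\<in>A. \<exists>c. T a u = c *s u)"
    by (rule exists_joint_eigenvector[OF assms(1-4,6,7,8)])
  then obtain u where u: "u \<in> U" "u \<noteq> 0" "\<forall>a\<in>A. \<exists>c. T a u = c *s u"
    by (elim bexE conjE)
  from bchoice[OF u(3)] obtain c where c: "\<forall>a\<in>A. T a u = c a *s u" by (elim exE)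
  then have c': "\<forall>a\<in>A. T a u = restrict c A a *s u" by simp
  have "u \<in> S" using u(1) assms(5) by blast
  then have "restrict c A \<in> weights S A T"
    unfolding weights_def using u(2) c' by (intro CollectI conjI bexI[of _ u]) auto
  then show ?thesis using u(1,2) c' by blast
qed

text \<open>Joint eigenvectors belonging to different weights are linearly independent.\<close>

lemma finite_weights:
  fixes T :: "'g \<Rightarrow> 'v \<Rightarrow> 'v"
  assumes S: "S \<subseteq> span B" "finite B" and T: "\<And>a. a \<in> A \<Longrightarrow> lin (T a)"
  shows "finite (weights S A T)"
proof -
  let ?X = "weights S A T"
  obtain u where u: "\<And>\<chi>. \<chi> \<in> ?X \<Longrightarrow> u \<chi> \<in> S \<and> u \<chi> \<noteq> 0 \<and> (\<forall>a\<in>A. T a (u \<chi>) = \<chi> a *s u \<chi>)"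
  proof -
    have "\<forall>\<chi>\<in>?X. \<exists>v. v \<in> S \<and> v \<noteq> 0 \<and> (\<forall>a\<in>A. T a v = \<chi> a *s v)"
      unfolding weights_def by blast
    from bchoice[OF this] show thesis using that by blast
  qed
  have ind: "\<forall>\<chi>\<in>Y. c \<chi> = 0" if "finite Y" "Y \<subseteq> ?X" "(\<Sum>\<chi>\<in>Y. c \<chi> *s u \<chi>) = 0" for Y c
    using that
  proof (induction Y arbitrary: c)
    case empty
    then show ?case by simp
  next
    case (insert \<eta> Y)
    have \<eta>: "\<eta> \<in> ?X" using insert.prems by auto
    have Y0: "c \<chi> = 0" if \<chi>: "\<chi> \<in> Y" for \<chi>
    proof -
      have \<chi>X: "\<chi> \<in> ?X" and "\<chi> \<noteq> \<eta>" using \<chi> insert by auto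
      then obtain a where a: "a \<in> A" "\<chi> a \<noteq> \<eta> a"
        using \<eta> unfolding weights_def by (metis (no_types, lifting) PiE_ext mem_Collect_eq)
      \<comment> \<open>Applying \<open>T a - \<eta> a\<close> to the relation removes the term of
        \<open>\<eta>\<close> and multiplies the term of \<open>\<chi>\<close> by the nonzero number
        \<open>\<chi> a - \<eta> a\<close>.\<close>
      have "0 = T a (\<Sum>\<chi>\<in>insert \<eta> Y. c \<chi> *s u \<chi>) - \<eta> a *s (\<Sum>\<chi>\<in>insert \<eta> Y. c \<chi> *s u \<chi>)"
        using insert.prems(2) by (simp add: lin_zero[OF T[OF a(1)]])
      also have "\<dots> = (\<Sum>\<chi>\<in>insert \<eta> Y. (c \<chi> * \<chi> a) *s u \<chi>) - (\<Sum>\<chi>\<in>insert \<eta> Y. (c \<chi> * \<eta> a) *s u \<chi>)"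
        using u insert.prems(1) a(1)
        by (auto simp: lin_sum[OF T[OF a(1)]] lin_scale[OF T[OF a(1)]] scale_sum_right mult.commute
            simp del: sum.insert intro!: arg_cong2[of _ _ _ _ "(-)"] sum.cong)
      also have "\<dots> = (\<Sum>\<chi>\<in>insert \<eta> Y. (c \<chi> * (\<chi> a - \<eta> a)) *s u \<chi>)"
        by (simp add: sum_subtractf[symmetric] scale_left_diff_distrib[symmetric] right_diff_distrib
            del: sum.insert)
      also have "\<dots> = (\<Sum>\<chi>\<in>Y. (c \<chi> * (\<chi> a - \<eta> a)) *s u \<chi>)"
        using insert.hyps by simp
      finally have "(\<Sum>\<chi>\<in>Y. (c \<chi> * (\<chi> a - \<eta> a)) *s u \<chi>) = 0" by simp
      then have "c \<chi> * (\<chi> a - \<eta> a) = 0"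
        using insert.IH[of "\<lambda>\<chi>. c \<chi> * (\<chi> a - \<eta> a)"] insert.prems(1) \<chi> by simp
      then show ?thesis using a(2) by simp
    qed
    then have "c \<eta> *s u \<eta> = 0" using insert by simp
    then show ?case using Y0 u[OF \<eta>] by simp
  qed
  have inj: "inj_on u ?X"
  proof (rule inj_onI, rule ccontr)
    fix \<chi> \<eta> assume *: "\<chi> \<in> ?X" "\<eta> \<in> ?X" "u \<chi> = u \<eta>" "\<chi> \<noteq> \<eta>"
    have "(\<Sum>\<theta>\<in>{\<chi>,\<eta>}. (if \<theta> = \<chi> then 1 else -1 :: complex) *s u \<theta>) = 0"
      using *(3,4) by simp
    from ind[OF _ _ this] *(1,2) show False by auto
  qed
  have "independent (u ` ?X)"
    unfolding independent_explicit_finite_subsets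
  proof (intro allI impI ballI)
    fix V c v assume V: "V \<subseteq> u ` ?X" "finite V" "(\<Sum>v\<in>V. c v *s v) = 0" "v \<in> V"
    then obtain Y where Y: "Y \<subseteq> ?X" "V = u ` Y" by (meson subset_image_iff)
    have injY: "inj_on u Y" using inj Y(1) inj_on_subset by blast
    have fin: "finite Y" using V(2) Y(2) injY finite_imageD by blast
    have "(\<Sum>\<chi>\<in>Y. c (u \<chi>) *s u \<chi>) = 0" using V(3) Y(2) by (simp add: sum.reindex[OF injY])
    then have "\<forall>\<chi>\<in>Y. c (u \<chi>) = 0" using ind[OF fin Y(1), of "\<lambda>\<chi>. c (u \<chi>)"] by blast
    then show "c v = 0" using V(4) Y(2) by auto
  qed
  then have "finite (u ` ?X)" using independent_span_bound[OF S(2)] u S(1) by (metis image_subsetI subsetD)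
  then show ?thesis using inj finite_imageD by blast
qed

end

section \<open>Finitely generated torsion-free abelian groups\<close>

lemma comm_group_Zn: "comm_group (Zn n)"
proof (rule comm_groupI)
  fix x assume "x \<in> carrier (Zn n)"
  then show "\<exists>y\<in>carrier (Zn n). y \<otimes>\<^bsub>Zn n\<^esub> x = \<one>\<^bsub>Zn n\<^esub>"
    by (intro bexI[of _ "\<lambda>i. - x i"]) (auto simp: Zn_def)
qed (auto simp: Zn_def algebra_simps)

context comm_group
begin

definition int_comb :: "('i \<Rightarrow> 'a) \<Rightarrow> 'i set \<Rightarrow> ('i \<Rightarrow> int) \<Rightarrow> 'a" where
  "int_comb g I c = (\<Otimes>i\<in>I. g i [^] c i)"

lemma int_comb_closed: "g \<in> I \<rightarrow> carrier G \<Longrightarrow> int_comb g I c \<in> carrier G"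
  unfolding int_comb_def by (rule finprod_closed) (auto simp: Pi_iff)

lemma int_comb_add:
  assumes "g \<in> I \<rightarrow> carrier G"
  shows "int_comb g I (\<lambda>i. c i + d i) = int_comb g I c \<otimes> int_comb g I d"
proof -
  have "int_comb g I (\<lambda>i. c i + d i) = (\<Otimes>i\<in>I. g i [^] c i \<otimes> g i [^] d i)"
    unfolding int_comb_def by (rule finprod_cong') (use assms in \<open>auto simp: int_pow_mult Pi_iff\<close>)
  also have "\<dots> = int_comb g I c \<otimes> int_comb g I d"
    unfolding int_comb_def by (rule finprod_multf) (use assms in \<open>auto simp: Pi_iff\<close>)
  finally show ?thesis .
qed

lemma int_comb_zero: "int_comb g I (\<lambda>i. 0) = \<one>"
  unfolding int_comb_def by (rule finprod_one_eqI) simp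

lemma int_comb_uminus:
  assumes "g \<in> I \<rightarrow> carrier G"
  shows "int_comb g I (\<lambda>i. - c i) = inv (int_comb g I c)"
proof -
  have "int_comb g I (\<lambda>i. - c i) \<otimes> int_comb g I c = \<one>"
    using int_comb_add[OF assms, of "\<lambda>i. - c i" c] by (simp add: int_comb_zero)
  then show ?thesis using int_comb_closed[OF assms] inv_equality by metis
qed

lemma int_comb_remove:
  assumes "finite I" "i \<in> I" "g \<in> I \<rightarrow> carrier G"
  shows "int_comb g I c = g i [^] c i \<otimes> int_comb g (I - {i}) c"
proof -
  have "int_comb g (insert i (I - {i})) c = g i [^] c i \<otimes> int_comb g (I - {i}) c"
    unfolding int_comb_def by (rule finprod_insert) (use assms in \<open>auto simp: Pi_iff\<close>)
  then show ?thesis using assms(2) by (simp add: insert_absorb)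
qed

lemma int_comb_cong:
  assumes "g \<in> I \<rightarrow> carrier G" "\<And>i. i \<in> I \<Longrightarrow> g i [^] c i = h i [^] d i" 
  shows "int_comb g I c = int_comb h I d"
proof -
  have "h i [^] d i \<in> carrier G" if "i \<in> I" for i
    using assms(1) assms(2)[OF that] that by (metis PiE int_pow_closed)
  then show ?thesis
    unfolding int_comb_def by (intro finprod_cong') (use assms in \<open>auto simp: Pi_iff\<close>)
qed

text \<open>A family rather than a set of generators: a Euclidean step may turn one generator into
  another one already present, and the number of indices has to stay the same.\<close>

definition int_spanning :: "('i \<Rightarrow> 'a) \<Rightarrow> 'i set \<Rightarrow> bool" where
  "int_spanning g I \<longleftrightarrow> finite I \<and> g \<in> I \<rightarrow> carrier G \<and> (\<forall>x\<in>carrier G. \<exists>c. x = int_comb g I c)"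

lemma int_spanningD: "int_spanning g I \<Longrightarrow> x \<in> carrier G \<Longrightarrow> \<exists>c. x = int_comb g I c"
  by (simp add: int_spanning_def)

lemma int_spanning_finite_generators:
  assumes "finite S" "S \<subseteq> carrier G" "generate G S = carrier G"
  shows "int_spanning (\<lambda>x. x) S"
proof -
  have g: "(\<lambda>x. x) \<in> S \<rightarrow> carrier G" using assms by auto
  have ind: "x = int_comb (\<lambda>x. x) S (\<lambda>y. if y = x then 1 else 0)" if x: "x \<in> S" for x
  proof -
    have "int_comb (\<lambda>x. x) (S - {x}) (\<lambda>y. if y = x then 1 else 0) = \<one>"
      unfolding int_comb_def by (rule finprod_one_eqI) auto
    then show ?thesis
      using int_comb_remove[OF assms(1) x g] x assms(2) by auto
  qed
  have "\<exists>c. x = int_comb (\<lambda>x. x) S c" if "x \<in> generate G S" for x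
    using that
  proof (induction rule: generate.induct)
    case one
    show ?case using int_comb_zero by metis
  next
    case (incl h)
    show ?case by (rule exI) (rule ind[OF incl])
  next
    case (inv h)
    show ?case using ind[OF inv] int_comb_uminus[OF g] by metis
  next
    case (eng h1 h2)
    then show ?case using int_comb_add[OF g] by metis
  qed
  then show ?thesis using assms g by (simp add: int_spanning_def)
qed

text \<open>The new generator \<open>g j \<otimes> g i [^] s\<close>, raised to \<open>c j\<close>,
  brings in the extra factor \<open>g i [^] (s * c j)\<close>, which the smaller coefficient at
  \<open>i\<close> takes away again.\<close>

lemma int_comb_transvection:
  assumes "finite I" "g \<in> I \<rightarrow> carrier G" "i \<in> I" "j \<in> I" "i \<noteq> j"
  shows "int_comb (g(j := g j \<otimes> g i [^] s)) I (c(i := c i - s * c j)) = int_comb g I c"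
proof -
  let ?g = "g(j := g j \<otimes> g i [^] s)" and ?c = "c(i := c i - s * c j)"
  have gi: "g i \<in> carrier G" "g j \<in> carrier G" using assms by auto
  have g': "?g \<in> I \<rightarrow> carrier G" using assms gi by auto
  have rest: "int_comb ?g (I - {i} - {j}) ?c = int_comb g (I - {i} - {j}) c"
    by (rule int_comb_cong) (use g' in \<open>auto simp: Pi_iff\<close>)
  have R: "int_comb g (I - {i} - {j}) c \<in> carrier G"
    by (rule int_comb_closed) (use assms in auto)
  have "int_comb ?g I ?c = ?g i [^] ?c i \<otimes> (?g j [^] ?c j \<otimes> int_comb ?g (I - {i} - {j}) ?c)"
    using assms g' by (subst int_comb_remove[of _ i], simp_all, subst int_comb_remove[of _ j]) auto
  also have "\<dots> = g i [^] (c i - s * c j) \<otimes> ((g j [^] c j \<otimes> g i [^] (s * c j)) \<otimes> int_comb g (I - {i} - {j}) c)"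
    using rest assms(5) gi by (simp add: int_pow_distrib int_pow_pow)
  also have "\<dots> = (g i [^] (c i - s * c j) \<otimes> g i [^] (s * c j)) \<otimes> (g j [^] c j \<otimes> int_comb g (I - {i} - {j}) c)"
    using gi R by (simp add: m_ac)
  also have "g i [^] (c i - s * c j) \<otimes> g i [^] (s * c j) = g i [^] c i"
    using gi by (simp flip: int_pow_mult)
  also have "g i [^] c i \<otimes> (g j [^] c j \<otimes> int_comb g (I - {i} - {j}) c) = int_comb g I c"
    using assms by (subst (2) int_comb_remove[of _ i], simp_all, subst (2) int_comb_remove[of _ j]) auto
  finally show ?thesis .
qed

text \<open>A Euclidean step shortens any relation with two nonzero coefficients, and a relation with only
  one makes a generator superfluous.\<close>

lemma int_spanning_minimal_independent:
  fixes I :: "'i set"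
  assumes tf: "\<And>x n. x \<in> carrier G \<Longrightarrow> n > (0::nat) \<Longrightarrow> x [^] n = \<one> \<Longrightarrow> x = \<one>"
    and sp: "int_spanning g I"
    and min: "\<And>J h. int_spanning h (J :: 'i set) \<Longrightarrow> card I \<le> card J"
    and c: "int_comb g I c = \<one>" "i \<in> I"
  shows "c i = 0"
  using sp c
proof (induction "nat (\<Sum>i\<in>I. \<bar>c i\<bar>)" arbitrary: g c i rule: less_induct)
  case (less c g i)
  have fin: "finite I" and g: "g \<in> I \<rightarrow> carrier G" using less.prems by (auto simp: int_spanning_def)
  show ?case
  proof (rule ccontr)
    assume ci: "c i \<noteq> 0"
    show False
    proof (cases "\<exists>j\<in>I. j \<noteq> i \<and> c j \<noteq> 0")
      case False
      then have "int_comb g (I - {i}) c = \<one>"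
        unfolding int_comb_def by (intro finprod_one_eqI) auto
      then have gi: "g i [^] c i = \<one>" using less.prems int_comb_remove[OF fin _ g, of i c] g
        by (metis PiE int_pow_closed r_one)
      have gic: "g i \<in> carrier G" using g less.prems(3) by (rule funcset_mem)
      have "g i [^] int (nat \<bar>c i\<bar>) = \<one>"
      proof (cases "c i \<ge> 0")
        case True
        then have "int (nat \<bar>c i\<bar>) = c i" by simp
        then show ?thesis using gi by (rule ssubst)
      next
        case False
        then have "int (nat \<bar>c i\<bar>) = - c i" by simp
        moreover have "g i [^] (- c i) = \<one>" using int_pow_neg[OF gic, of "c i"] gi by (metis inv_one)
        ultimately show ?thesis by (rule ssubst)
      qed
      then have "g i [^] nat \<bar>c i\<bar> = \<one>" unfolding int_pow_int .
      then have g1: "g i = \<one>" by (intro tf[OF gic, of "nat \<bar>c i\<bar>"]) (use ci in simp)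
      have "int_comb g I d = int_comb g (I - {i}) d" for d
      proof -
        have "int_comb g (I - {i}) d \<in> carrier G"
          by (rule int_comb_closed) (use g in auto)
        then show ?thesis using int_comb_remove[OF fin less.prems(3) g, of d] g1 by simp
      qed
      moreover have "g \<in> I - {i} \<rightarrow> carrier G" using g by auto
      ultimately have "int_spanning g (I - {i})"
        using less.prems(1) unfolding int_spanning_def by simp
      then have "card I \<le> card (I - {i})" by (rule min)
      then show False using less.prems(3) fin by (metis card_Diff1_less not_less)
    next
      case True
      then obtain j where j: "j \<in> I" "j \<noteq> i" "c j \<noteq> 0" by blast
      have step: False if ij: "i \<in> I" "j \<in> I" "i \<noteq> j" "c i \<noteq> 0" "c j \<noteq> 0" "\<bar>c j\<bar> \<le> \<bar>c i\<bar>" for i j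
      proof -
        \<comment> \<open>The sign for which \<open>\<bar>c i - s * c j\<bar> = \<bar>c i\<bar> -
          \<bar>c j\<bar>\<close>.\<close>
        define s where "s = sgn (c i) * sgn (c j)"
        let ?g = "g(j := g j \<otimes> g i [^] s)" and ?c = "c(i := c i - s * c j)"
        note tv = int_comb_transvection[OF fin g ij(1-3)]
        have ineq: "\<bar>c i - s * c j\<bar> < \<bar>c i\<bar>"
          using ij(4-6) unfolding s_def by (cases "c i" "0::int" rule: linorder_cases;
              cases "c j" "0::int" rule: linorder_cases) auto
        have "(\<Sum>k\<in>I. \<bar>?c k\<bar>) < (\<Sum>k\<in>I. \<bar>c k\<bar>)"
          by (rule sum_strict_mono_ex1[OF fin]) (use ineq ij in auto)
        moreover have "0 \<le> (\<Sum>k\<in>I. \<bar>?c k\<bar>)" by (rule sum_nonneg) auto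
        ultimately have lt: "nat (\<Sum>k\<in>I. \<bar>?c k\<bar>) < nat (\<Sum>k\<in>I. \<bar>c k\<bar>)" by linarith
        have "g i \<in> carrier G" "g j \<in> carrier G" using g ij(1,2) by (auto simp: Pi_iff)
        then have "?g \<in> I \<rightarrow> carrier G" using g by (simp add: Pi_iff)
        moreover have "\<exists>d. x = int_comb ?g I d" if x: "x \<in> carrier G" for x
        proof -
          obtain d where "x = int_comb g I d"
            using int_spanningD[OF less.prems(1) \<open>x \<in> carrier G\<close>] by (elim exE)
          then show ?thesis using tv[of s d] by metis
        qed
        ultimately have "int_spanning ?g I" using fin unfolding int_spanning_def by blast
        moreover have "int_comb ?g I ?c = \<one>" using tv less.prems(2) by simp
        \<comment> \<open>The induction hypothesis is applied at \<open>j\<close>, whose coefficient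
          is unchanged; the one at \<open>i\<close> may have become 0.\<close>
        ultimately have "?c j = 0" using less.hyps[OF lt _ _ ij(2)] by blast
        then show False using ij by simp
      qed
      show False
      proof (cases "\<bar>c j\<bar> \<le> \<bar>c i\<bar>")
        case True
        show ?thesis by (rule step[OF less.prems(3) j(1) j(2)[symmetric] ci j(3) True])
      next
        case False
        then have "\<bar>c i\<bar> \<le> \<bar>c j\<bar>" by simp
        then show ?thesis by (rule step[OF j(1) less.prems(3) j(2,3) ci])
      qed
    qed
  qed
qed

lemma int_spanning_lessThan_card:
  assumes "int_spanning h J"
  shows "\<exists>g. int_spanning g {..<card J}"
proof -
  have h: "h \<in> J \<rightarrow> carrier G" and fin: "finite J" using assms by (auto simp: int_spanning_def)
  obtain b where b: "bij_betw b {..<card J} J"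
    using ex_bij_betw_nat_finite[OF fin] by (auto simp: atLeast0LessThan)
  then have bJ: "b ` {..<card J} = J" and inj: "inj_on b {..<card J}" by (auto simp: bij_betw_def)
  have eq: "int_comb (\<lambda>i. h (b i)) {..<card J} (\<lambda>i. c (b i)) = int_comb h J c" for c
    unfolding int_comb_def using finprod_reindex[of "\<lambda>i. h i [^] c i" b "{..<card J}"] h inj bJ
    by (simp add: Pi_iff)
  have "\<exists>c. x = int_comb (\<lambda>i. h (b i)) {..<card J} c" if x: "x \<in> carrier G" for x
  proof -
    obtain c where c: "x = int_comb h J c" using int_spanningD[OF assms x] by (elim exE)
    show ?thesis by (rule exI) (rule trans[OF c eq[symmetric]])
  qed
  moreover have "(\<lambda>i. h (b i)) \<in> {..<card J} \<rightarrow> carrier G" using h bJ by auto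
  ultimately have "int_spanning (\<lambda>i. h (b i)) {..<card J}" by (simp add: int_spanning_def)
  then show ?thesis by blast
qed

text \<open>A generating family with the least number of members satisfies no relation, so
  coordinates with respect to it are unique.\<close>

theorem fg_torsion_free_iso_Zn:
  assumes fg: "finite S" "S \<subseteq> carrier G" "generate G S = carrier G"
    and tf: "\<And>x n. x \<in> carrier G \<Longrightarrow> n > (0::nat) \<Longrightarrow> x [^] n = \<one> \<Longrightarrow> x = \<one>"
  shows "\<exists>n. G \<cong> Zn n"
proof -
  define P where "P k \<longleftrightarrow> (\<exists>g. int_spanning g {..<k::nat})" for k
  have "\<exists>k. P k" using int_spanning_lessThan_card[OF int_spanning_finite_generators[OF fg]] unfolding P_def by blast
  then obtain k where k: "P k" "\<And>j. P j \<Longrightarrow> k \<le> j"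
    using LeastI_ex[of P] Least_le[of P] by blast
  then obtain g where g: "int_spanning g {..<k}" unfolding P_def by (elim exE)
  have gc: "g \<in> {..<k} \<rightarrow> carrier G" using g by (simp add: int_spanning_def)
  have kmin: "card {..<k} \<le> card J" if "int_spanning h J" for h and J :: "nat set"
    using k(2)[of "card J"] int_spanning_lessThan_card[OF that] by (simp add: P_def)
  have indep: "c i = 0" if "int_comb g {..<k} c = \<one>" "i < k" for c i
    by (rule int_spanning_minimal_independent[OF tf g kmin that(1)]) (use that(2) in simp_all)
  have "int_comb g {..<k} \<in> iso (Zn k) G"
  proof (rule isoI)
    show "int_comb g {..<k} \<in> hom (Zn k) G"
      by (rule homI) (auto simp: Zn_def int_comb_closed[OF gc] int_comb_add[OF gc])
    show "bij_betw (int_comb g {..<k}) (carrier (Zn k)) (carrier G)"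
      unfolding bij_betw_def
    proof
      show "inj_on (int_comb g {..<k}) (carrier (Zn k))"
      proof (rule inj_onI)
        fix c d assume cd: "c \<in> carrier (Zn k)" "d \<in> carrier (Zn k)" "int_comb g {..<k} c = int_comb g {..<k} d"
        have "int_comb g {..<k} (\<lambda>i. c i + - d i) = \<one>"
          using cd(3) int_comb_closed[OF gc]
          by (simp only: int_comb_add[OF gc] int_comb_uminus[OF gc]) simp
        then have "c i = d i" if "i < k" for i using indep[OF _ that] by fastforce
        then show "c = d" using cd by (auto simp: Zn_def fun_eq_iff) (metis not_less)
      qed
      show "int_comb g {..<k} ` carrier (Zn k) = carrier G"
      proof
        show "carrier G \<subseteq> int_comb g {..<k} ` carrier (Zn k)"
        proof
          fix x assume "x \<in> carrier G"
          then obtain c where c: "x = int_comb g {..<k} c" using int_spanningD[OF g] by blast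
          define d where "d i = (if i < k then c i else 0)" for i
          have "x = int_comb g {..<k} d" unfolding c by (rule int_comb_cong[OF gc]) (simp add: d_def)
          then show "x \<in> int_comb g {..<k} ` carrier (Zn k)" by (auto simp: Zn_def d_def)
        qed
      qed (use int_comb_closed[OF gc] in auto)
    qed
  qed
  then have "Zn k \<cong> G" by (rule is_isoI)
  then show ?thesis
    using group.iso_sym[of "Zn k" G] comm_group_Zn[of k] by (auto simp: comm_group_def)
qed

end

section \<open>Integer matrices congruent to the identity modulo 4\<close>

definition int_lattice :: "'i set \<Rightarrow> ('i \<Rightarrow> int) set" where
  "int_lattice I = {v. \<forall>i. i \<notin> I \<longrightarrow> v i = 0}"

text \<open>The index type is general because the lattice of interest consists of integer matrices,
  indexed by pairs, with \<open>s\<close> the conjugation by an element of the congruence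
  subgroup.\<close>

definition congruent_id_mod4 :: "'i set \<Rightarrow> (('i \<Rightarrow> int) \<Rightarrow> 'i \<Rightarrow> int) \<Rightarrow> bool" where
  "congruent_id_mod4 I s \<longleftrightarrow>
     (\<forall>u\<in>int_lattice I. s u \<in> int_lattice I \<and> (\<forall>i. 4 dvd s u i - u i) \<and>
       (\<forall>v\<in>int_lattice I. s (u + v) = s u + s v))"

lemma congruent_id_mod4_funpow:
  assumes "congruent_id_mod4 I s"
  shows "congruent_id_mod4 I (s ^^ n)"
proof (induction n)
  case 0
  then show ?case by (simp add: congruent_id_mod4_def)
next
  case (Suc n)
  show ?case unfolding congruent_id_mod4_def
  proof (intro ballI conjI allI)
    fix u v i assume u: "u \<in> int_lattice I" and v: "v \<in> int_lattice I"
    have U: "(s ^^ n) u \<in> int_lattice I" "(s ^^ n) v \<in> int_lattice I"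
      using Suc u v by (auto simp: congruent_id_mod4_def)
    then show "(s ^^ Suc n) u \<in> int_lattice I" using assms by (simp add: congruent_id_mod4_def)
    have "4 dvd (s ((s ^^ n) u) i - (s ^^ n) u i) + ((s ^^ n) u i - u i)"
      by (rule dvd_add) (use Suc assms U u in \<open>auto simp: congruent_id_mod4_def\<close>)
    then show "4 dvd (s ^^ Suc n) u i - u i" by simp
    show "(s ^^ Suc n) (u + v) = (s ^^ Suc n) u + (s ^^ Suc n) v"
      using Suc u v U assms by (simp add: congruent_id_mod4_def)
  qed
qed

text \<open>Minkowski's argument: if \<open>n\<close> is odd or 2 and \<open>u + s u + \<dots> + s\<^bsup>n-1\<^esup> u = 0\<close>, then \<open>u\<close> is even and
  \<open>u / 2\<close> satisfies the same equation; so \<open>s v - v\<close> is divisible by every power of 2.\<close>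

lemma congruent_id_mod4_fixed_step:
  assumes s: "congruent_id_mod4 I s" and v: "v \<in> int_lattice I"
    and n: "odd n \<or> n = 2" and fixed: "(s ^^ n) v = v"
  shows "s v = v"
proof -
  define Q where "Q u \<longleftrightarrow> u \<in> int_lattice I \<and> (\<forall>i. (\<Sum>k<n. (s ^^ k) u i) = 0)" for u
  note sn = congruent_id_mod4_funpow[OF s]
  have add: "(s ^^ k) (a + b) = (s ^^ k) a + (s ^^ k) b"
    if "a \<in> int_lattice I" "b \<in> int_lattice I" for a b k
    using sn[of k] that by (simp add: congruent_id_mod4_def)
  have half: "\<exists>u'. Q u' \<and> u = u' + u'" if Q: "Q u" for u
  proof -
    have u: "u \<in> int_lattice I" using Q by (simp add: Q_def)
    have even: "even (u i)" for i
    proof -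
      have "4 dvd (\<Sum>k<n. (s ^^ k) u i - u i)"
        by (rule dvd_sum) (use sn u in \<open>auto simp: congruent_id_mod4_def\<close>)
      also have "(\<Sum>k<n. (s ^^ k) u i - u i) = - (int n * u i)"
        using Q by (simp add: Q_def sum_subtractf)
      \<comment> \<open>For odd \<open>n\<close> this makes \<open>u i\<close> divisible by 4, for
        \<open>n = 2\<close> only by 2; starting from modulus 2 nothing would be left in the second
        case.\<close>
      finally have *: "4 dvd int n * u i" by simp
      then have "even (int n * u i)" by (meson dvd_trans even_numeral)
      then show ?thesis using n * by auto
    qed
    define u' where "u' i = u i div 2" for i
    have uu: "u = u' + u'" using even by (auto simp: u'_def fun_eq_iff)
    have u'L: "u' \<in> int_lattice I" using u by (auto simp: u'_def int_lattice_def)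
    have "(\<Sum>k<n. (s ^^ k) u' i) = 0" for i
    proof -
      have "(s ^^ k) u i = 2 * (s ^^ k) u' i" for k
        by (subst uu, subst add[OF u'L u'L]) simp
      then have "(\<Sum>k<n. (s ^^ k) u i) = 2 * (\<Sum>k<n. (s ^^ k) u' i)"
        by (simp add: sum_distrib_left)
      then show ?thesis using Q by (simp add: Q_def)
    qed
    then show ?thesis using uu u'L by (auto simp: Q_def)
  qed
  have pow: "\<exists>u'. Q u' \<and> (\<forall>i. u i = 2 ^ k * u' i)" if "Q u" for u k
  proof (induction k)
    case 0
    then show ?case using that by auto
  next
    case (Suc k)
    then obtain u' where u': "Q u'" "\<forall>i. u i = 2 ^ k * u' i" by blast
    then obtain u'' where "Q u''" "u' = u'' + u''" using half by blast
    then show ?case using u'(2) by (intro exI[of _ u'']) auto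
  qed
  \<comment> \<open>The iterates of \<open>s\<close> on \<open>w\<close> telescope to
    \<open>(s ^^ n) v - v = 0\<close>, so \<open>Q w\<close> holds.\<close>
  define w where "w = s v - v"
  have sv: "s v \<in> int_lattice I" using s v by (simp add: congruent_id_mod4_def)
  have wL: "w \<in> int_lattice I" using sv v by (auto simp: w_def int_lattice_def)
  have "(s ^^ k) w = (s ^^ Suc k) v - (s ^^ k) v" for k
  proof -
    have "s v = w + v" by (simp add: w_def)
    then have "(s ^^ k) (s v) = (s ^^ k) w + (s ^^ k) v" using add[OF wL v] by simp
    then show ?thesis by (simp add: funpow_swap1)
  qed
  then have "(\<Sum>k<n. (s ^^ k) w i) = (s ^^ n) v i - v i" for i
    using sum_lessThan_telescope[of "\<lambda>k. (s ^^ k) v i" n] by simp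
  then have "Q w" using wL fixed by (simp add: Q_def)
  have "w i = 0" for i
  proof (rule ccontr)
    assume "w i \<noteq> 0"
    \<comment> \<open>The exponent is chosen so that the power of 2 exceeds the nonzero number that
      it divides.\<close>
    obtain u' where "w i = 2 ^ nat \<bar>w i\<bar> * u' i" using pow[OF \<open>Q w\<close>, of "nat \<bar>w i\<bar>"] by blast
    then have "2 ^ nat \<bar>w i\<bar> dvd w i" by (metis dvd_triv_left)
    from dvd_imp_le_int[OF \<open>w i \<noteq> 0\<close> this] have "2 ^ nat \<bar>w i\<bar> \<le> \<bar>w i\<bar>" by (simp add: power_abs)
    moreover have "int (nat \<bar>w i\<bar>) < 2 ^ nat \<bar>w i\<bar>" by (metis of_nat_less_two_power)
    ultimately show False by simp
  qed
  then show ?thesis unfolding w_def by (auto simp: fun_eq_iff)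
qed

text \<open>Factors 2 of \<open>n\<close> are stripped off by the case of exponent 2, applied to
  \<open>s ^^ k\<close>, which is again congruent to the identity; an odd exponent is settled at
  once.\<close>

lemma congruent_id_mod4_fixed:
  assumes s: "congruent_id_mod4 I s" and v: "v \<in> int_lattice I"
    and n: "n > 0" and fixed: "(s ^^ n) v = v"
  shows "s v = v"
  using n fixed
proof (induction n rule: less_induct)
  case (less n)
  show ?case
  proof (cases "odd n")
    case True
    then show ?thesis using congruent_id_mod4_fixed_step[OF s v _ less.prems(2)] by blast
  next
    case False
    then obtain k where k: "n = k * 2" by (metis dvd_def mult.commute)
    have "((s ^^ k) ^^ 2) v = v" using less.prems(2) by (simp add: funpow_mult k)
    then have "(s ^^ k) v = v"
      using congruent_id_mod4_fixed_step[OF congruent_id_mod4_funpow[OF s] v] by blast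
    then show ?thesis using less.IH[of k] less.prems(1) k by simp
  qed
qed

text \<open>Vectors are plain functions, so that operators of every size act on one type; the value
  0 from \<open>m\<close> onwards keeps the image finite-dimensional.\<close>

definition mat_apply :: "nat \<Rightarrow> (nat \<Rightarrow> nat \<Rightarrow> int) \<Rightarrow> (nat \<Rightarrow> complex) \<Rightarrow> nat \<Rightarrow> complex" where
  "mat_apply m M v = (\<lambda>i. if i < m then \<Sum>j<m. of_int (M i j) * v j else 0)"

definition congruent_one :: "nat \<Rightarrow> int \<Rightarrow> (nat \<Rightarrow> nat \<Rightarrow> int) \<Rightarrow> bool" where
  "congruent_one m q M \<longleftrightarrow> (\<forall>i<m. \<forall>j<m. q dvd M i j - (if i = j then 1 else 0))"

text \<open>The determinant commutes with reduction to the field \<open>bit\<close>, where the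
  matrix becomes the identity.\<close>

lemma odd_det_congruent_one:
  assumes "congruent_one m 2 D"
  shows "det (mat m m (\<lambda>(i, j). D i j)) \<noteq> 0"
proof -
  let ?A = "mat m m (\<lambda>(i, j). D i j)"
  have h: "comm_ring_hom (of_int :: int \<Rightarrow> bit)"
    by unfold_locales auto
  have ev: "of_int z = (0 :: bit)" if "even z" for z
    using that by (auto elim!: evenE)
  have "map_mat (of_int :: int \<Rightarrow> bit) ?A = 1\<^sub>m m"
  proof (rule eq_matI)
    fix i j assume "i < dim_row (1\<^sub>m m)" "j < dim_col (1\<^sub>m m)"
    then have ij: "i < m" "j < m" by auto
    then have "of_int (D i j - (if i = j then 1 else 0)) = (0 :: bit)"
      using assms by (intro ev) (auto simp: congruent_one_def)
    then have "of_int (D i j) = (if i = j then 1 else (0 :: bit))"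
      using ij by (auto simp: algebra_simps split: if_splits)
    then show "map_mat of_int ?A $$ (i, j) = (1\<^sub>m m :: bit mat) $$ (i, j)"
      using ij by simp
  qed auto
  then have "of_int (det ?A) = (1 :: bit)" using comm_ring_hom.hom_det[OF h, of ?A] by (metis det_one)
  then show ?thesis by auto
qed

lemma congruent_one_mod2_kernel:
  assumes D: "congruent_one m 2 D" and z: "mat_apply m D v = 0"
  shows "\<forall>j<m. v j = 0"
proof (rule ccontr)
  assume nz: "\<not> ?thesis"
  let ?A = "mat m m (\<lambda>(i, j). D i j)"
  let ?C = "map_mat complex_of_int ?A"
  have "det ?C \<noteq> 0"
    using odd_det_congruent_one[OF D] of_int_hom.hom_det[of ?A, where 'a = complex] by simp
  moreover have "?C *\<^sub>v vec m v = 0\<^sub>v m"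
  proof (rule eq_vecI)
    fix i assume i: "i < dim_vec (0\<^sub>v m)"
    then have "(?C *\<^sub>v vec m v) $ i = (\<Sum>j<m. of_int (D i j) * v j)"
      by (auto simp: scalar_prod_def atLeast0LessThan)
    also have "\<dots> = mat_apply m D v i" using i by (simp add: mat_apply_def)
    finally show "(?C *\<^sub>v vec m v) $ i = 0\<^sub>v m $ i" using z i by simp
  qed auto
  moreover have "vec m v \<noteq> 0\<^sub>v m" using nz by (auto simp: vec_eq_iff)
  ultimately show False
    using det_0_iff_vec_prod_zero_field[of ?C m] by (metis mat_carrier map_carrier_mat vec_carrier)
qed

text \<open>For odd \<open>n\<close> and \<open>c \<noteq> 1\<close> the vector \<open>v\<close> would be in the kernel of \<open>P 0 + \<dots> + P (n - 1)\<close>, which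
  is congruent to the identity modulo 2 and thus has odd determinant; the case \<open>c\<^sup>k = -1\<close> is
  excluded by \<open>(P k + 1) / 2\<close> in the same way.\<close>

lemma root_of_unity_eigenvalue:
  assumes P: "\<And>k. congruent_one m 4 (P k)" and v: "\<And>k. mat_apply m (P k) v = (\<lambda>i. c ^ k * v i)"
    and v0: "j < m" "v j \<noteq> 0" and n: "n > 0" "c ^ n = 1"
  shows "c = 1"
  using n
proof (induction n rule: less_induct)
  case (less n)
  show ?case
  proof (cases "odd n")
    case True
    show ?thesis
    proof (rule ccontr)
      assume "c \<noteq> 1"
      then have geo: "(\<Sum>k<n. c ^ k) = 0" using less.prems by (simp add: geometric_sum)
      define D where "D i j = (\<Sum>k<n. P k i j)" for i j
      have "congruent_one m 2 D"
        unfolding congruent_one_def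
      proof (intro allI impI)
        fix i j assume ij: "i < m" "j < m"
        let ?d = "if i = j then 1 else 0 :: int"
        have "4 dvd (\<Sum>k<n. P k i j - ?d)"
          by (rule dvd_sum) (use P ij in \<open>simp add: congruent_one_def\<close>)
        then have "4 dvd D i j - int n * ?d" by (simp add: D_def sum_subtractf)
        then have "2 dvd D i j - int n * ?d" by (meson dvd_trans even_numeral)
        then show "2 dvd D i j - ?d" using True by (auto split: if_splits)
      qed
      moreover have "mat_apply m D v = 0"
      proof
        fix i
        have "mat_apply m D v i = (\<Sum>k<n. mat_apply m (P k) v i)"
          unfolding mat_apply_def D_def
          by (cases "i < m") (auto simp: sum_distrib_right intro: sum.swap)
        also have "\<dots> = 0" using v geo by (simp flip: sum_distrib_right)
        finally show "mat_apply m D v i = 0 i" by simp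
      qed
      ultimately show False using congruent_one_mod2_kernel v0 by blast
    qed
  next
    case False
    then obtain k where k: "n = k * 2" by (metis dvd_def mult.commute)
    then have "(c ^ k)\<^sup>2 = 1" using less.prems by (simp add: power_mult)
    then have "c ^ k = 1 \<or> c ^ k = -1" by (simp add: power2_eq_1_iff)
    then show ?thesis
    proof
      assume "c ^ k = 1"
      then show ?thesis using less.IH[of k] less.prems k by simp
    next
      assume neg: "c ^ k = -1"
      \<comment> \<open>The division is exact: \<open>P k\<close> is \<open>4 * t\<close> plus the
        identity, so \<open>D\<close> is \<open>2 * t\<close> plus the identity, and it kills
        \<open>v\<close> because \<open>P k\<close> acts on \<open>v\<close> as -1.\<close>
      define D where "D i j = (P k i j + (if i = j then 1 else 0)) div 2" for i j
      have ex: "\<exists>t. P k i j = 4 * t + (if i = j then 1 else 0)" if "i < m" "j < m" for i j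
        using P[of k] that unfolding congruent_one_def by (metis dvdE diff_add_cancel)
      have two: "2 * D i j = P k i j + (if i = j then 1 else 0)" if "i < m" "j < m" for i j
        using ex[OF that] by (auto simp: D_def)
      have "congruent_one m 2 D"
        unfolding congruent_one_def
      proof (intro allI impI)
        fix i j assume ij: "i < m" "j < m"
        show "2 dvd D i j - (if i = j then 1 else 0)"
          using ex[OF ij] by (auto simp: D_def)
      qed
      moreover have "mat_apply m D v = 0"
      proof
        fix i
        show "mat_apply m D v i = 0 i"
        proof (cases "i < m")
          case True
          have "2 * (\<Sum>j<m. of_int (D i j) * v j) = (\<Sum>j<m. of_int (2 * D i j) * v j)"
            by (simp add: sum_distrib_left mult.assoc)
          also have "\<dots> = (\<Sum>j<m. of_int (P k i j) * v j + (if i = j then v j else 0))"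
            using two[OF True] by (intro sum.cong) (auto simp: algebra_simps)
          also have "\<dots> = mat_apply m (P k) v i + v i"
            using True by (simp add: sum.distrib mat_apply_def)
          also have "\<dots> = 0" using v neg by simp
          finally show ?thesis using True by (simp add: mat_apply_def)
        qed (simp add: mat_apply_def)
      qed
      ultimately show ?thesis using congruent_one_mod2_kernel v0 by blast
    qed
  qed
qed

section \<open>The Fitting subgroup\<close>

context group
begin

lemma inv_cancel_left [simp]:
  "x \<in> carrier G \<Longrightarrow> y \<in> carrier G \<Longrightarrow> inv x \<otimes> (x \<otimes> y) = y"
  "x \<in> carrier G \<Longrightarrow> y \<in> carrier G \<Longrightarrow> x \<otimes> (inv x \<otimes> y) = y"
  by (simp_all flip: m_assoc)

definition conjg :: "'a \<Rightarrow> 'a \<Rightarrow> 'a" where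
  "conjg x y = x \<otimes> y \<otimes> inv x"

abbreviation commute :: "'a \<Rightarrow> 'a \<Rightarrow> bool" where
  "commute x y \<equiv> x \<otimes> y = y \<otimes> x"

lemma conjg_closed [simp]: "x \<in> carrier G \<Longrightarrow> y \<in> carrier G \<Longrightarrow> conjg x y \<in> carrier G"
  by (simp add: conjg_def)

lemma conjg_mult:
  "\<lbrakk>x \<in> carrier G; y \<in> carrier G; z \<in> carrier G\<rbrakk> \<Longrightarrow> conjg x (y \<otimes> z) = conjg x y \<otimes> conjg x z"
  by (simp add: conjg_def m_assoc)

lemma conjg_conj:
  "\<lbrakk>x \<in> carrier G; y \<in> carrier G; z \<in> carrier G\<rbrakk> \<Longrightarrow> conjg x (conjg y z) = conjg (x \<otimes> y) z"
  by (simp add: conjg_def m_assoc inv_mult_group)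

lemma conjg_one [simp]: "y \<in> carrier G \<Longrightarrow> conjg \<one> y = y" "x \<in> carrier G \<Longrightarrow> conjg x \<one> = \<one>"
  by (simp_all add: conjg_def)

lemma conjg_inv:
  "\<lbrakk>x \<in> carrier G; y \<in> carrier G\<rbrakk> \<Longrightarrow> conjg x (inv y) = inv (conjg x y)"
  by (simp add: conjg_def m_assoc inv_mult_group)

lemma conjg_eq_self_iff:
  "\<lbrakk>x \<in> carrier G; y \<in> carrier G\<rbrakk> \<Longrightarrow> conjg x y = y \<longleftrightarrow> commute x y"
  by (metis conjg_def inv_solve_right m_closed)

lemma commute_conjg:
  "\<lbrakk>x \<in> carrier G; y \<in> carrier G; z \<in> carrier G; commute y z\<rbrakk> \<Longrightarrow> commute (conjg x y) (conjg x z)"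
  by (simp flip: conjg_mult)

lemma commute_mult:
  assumes "x \<in> carrier G" "y \<in> carrier G" "z \<in> carrier G" "commute x y" "commute x z"
  shows "commute x (y \<otimes> z)"
  using assms by (metis m_assoc)

lemma commute_inv:
  assumes "x \<in> carrier G" "y \<in> carrier G" "commute x y"
  shows "commute x (inv y)"
  using assms by (metis inv_closed inv_solve_left inv_solve_right m_assoc m_closed)

end

locale positive_length_group = group G for G :: "('a, 'b) monoid_scheme" (structure) +
  fixes l :: "'a \<Rightarrow> real"
  assumes length_function: "length_function G l"
    and purely_positive: "purely_positive G l"
    and torsion_free: "\<And>x. x \<in> carrier G \<Longrightarrow> x \<noteq> \<one> \<Longrightarrow> infinite_order G x"
begin

lemma length_int_pow: "x \<in> carrier G \<Longrightarrow> l (x [^] (n :: int)) = \<bar>real_of_int n\<bar> * l x"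
  and length_conjg: "x \<in> carrier G \<Longrightarrow> y \<in> carrier G \<Longrightarrow> l (conjg x y) = l y"
  and length_commute: "x \<in> carrier G \<Longrightarrow> y \<in> carrier G \<Longrightarrow> commute x y \<Longrightarrow> l (x \<otimes> y) \<le> l x + l y"
  using length_function by (auto simp: length_function_def conjg_def)

lemma length_inv: "x \<in> carrier G \<Longrightarrow> l (inv x) = l x"
  using length_int_pow[of x "-1"] by (simp add: int_pow_neg)

lemma length_zero_imp_one:
  assumes "x \<in> carrier G" "l x \<le> 0" shows "x = \<one>"
  using assms torsion_free purely_positive unfolding purely_positive_def by fastforce

text \<open>Conjugating by powers of \<open>x\<close> shows that \<open>z\<^sup>n \<otimes> y\<close> has the length of \<open>y\<close> for all \<open>n\<close>, so
  \<open>n * l z\<close> stays bounded.\<close>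

lemma commuting_commutator_trivial:
  assumes x: "x \<in> carrier G" and y: "y \<in> carrier G" and z: "z \<in> carrier G"
    and xy: "conjg x y = z \<otimes> y" and xz: "commute x z" and yz: "commute y z"
  shows "z = \<one>"
proof -
  have pow: "conjg (x [^] n) y = z [^] n \<otimes> y" for n :: nat
  proof (induction n)
    case 0
    then show ?case using y by simp
  next
    case (Suc n)
    have xn: "commute (x [^] n) z" using group_commutes_pow[OF xz x z] .
    have "conjg (x [^] Suc n) y = conjg (x [^] n) (conjg x y)"
      using x y by (simp add: conjg_conj)
    also have "\<dots> = conjg (x [^] n) z \<otimes> conjg (x [^] n) y"
      using x y z xy by (simp add: conjg_mult)
    also have "conjg (x [^] n) z = z" using xn x z by (simp add: conjg_eq_self_iff)
    also have "z \<otimes> conjg (x [^] n) y = z [^] Suc n \<otimes> y"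
      using Suc z y by (simp flip: m_assoc nat_pow_Suc2)
    finally show ?case .
  qed
  have "real n * l z \<le> 2 * l y" for n
  proof -
    have zn: "commute y (z [^] n)" using group_commutes_pow[OF yz[symmetric] z y] by simp
    \<comment> \<open>Subadditivity holds only for commuting factors. These two commute, and each
      has the length of \<open>y\<close>.\<close>
    have "z [^] n = (z [^] n \<otimes> y) \<otimes> inv y" using y z by (simp add: m_assoc)
    moreover have "commute (z [^] n \<otimes> y) (inv y)"
      using commute_inv[of "z [^] n \<otimes> y" y] y z zn by (metis m_assoc m_closed nat_pow_closed)
    ultimately have "l (z [^] n) \<le> l (z [^] n \<otimes> y) + l (inv y)"
      using length_commute[of "z [^] n \<otimes> y" "inv y"] y z by simp
    also have "\<dots> = 2 * l y" using pow[of n] length_conjg[of "x [^] n" y] x y length_inv by simp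
    finally show ?thesis using length_int_pow[OF z, of "int n"] by (simp add: int_pow_int)
  qed
  then have "l z \<le> 0"
    by (metis (no_types) ex_less_of_nat_mult linorder_not_less)
  then show ?thesis using length_zero_imp_one z by blast
qed

text \<open>Nilpotency of class two already forces commutativity; this form is the one used in all
  later arguments about the Fitting subgroup.\<close>

lemma commute_if_commutator_commutes:
  assumes x: "x \<in> carrier G" and y: "y \<in> carrier G"
    and "commute x (conjg x y \<otimes> inv y)" "commute y (conjg x y \<otimes> inv y)"
  shows "commute x y"
proof -
  have "conjg x y \<otimes> inv y = \<one>"
    by (rule commuting_commutator_trivial[OF x y]) (use assms in \<open>simp_all add: m_assoc\<close>)
  then have "conjg x y = y" using x y by (metis conjg_closed inv_closed inv_equality inv_inv)
  then show ?thesis using x y by (simp add: conjg_eq_self_iff)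
qed

text \<open>The Fitting subgroup: nilpotent subgroups are abelian here, so it consists of the elements
  with abelian normal closure.\<close>

definition fitting :: "'a set" where
  "fitting = {f \<in> carrier G. \<forall>x\<in>carrier G. commute f (conjg x f)}"

lemma fitting_closed [simp]: "f \<in> fitting \<Longrightarrow> f \<in> carrier G"
  by (simp add: fitting_def)

lemma fittingI:
  assumes "f \<in> carrier G" "\<And>x. x \<in> carrier G \<Longrightarrow> commute f (conjg x f)"
  shows "f \<in> fitting"
  using assms unfolding fitting_def by blast

lemma fittingD: "f \<in> fitting \<Longrightarrow> x \<in> carrier G \<Longrightarrow> commute f (conjg x f)"
  unfolding fitting_def by blast

lemma fitting_commute_conjg_self:
  assumes f: "f \<in> fitting" and x: "x \<in> carrier G" and y: "y \<in> carrier G"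
  shows "commute (conjg x f) (conjg y f)"
proof -
  have "commute f (conjg (inv x \<otimes> y) f)" using fittingD[OF f] x y by blast
  from commute_conjg[OF x _ _ this] show ?thesis
    using f x y by (simp add: conjg_conj)
qed

text \<open>The commutator of \<open>?a\<close> and \<open>?b\<close> is both a product of
  conjugates of \<open>f\<close> or its inverse and a product of conjugates of \<open>f'\<close> or
  its inverse. Hence it commutes with \<open>?a\<close> and with \<open>?b\<close>.\<close>

lemma fitting_commute_conjg:
  assumes f: "f \<in> fitting" "f' \<in> fitting" and x: "x \<in> carrier G" and y: "y \<in> carrier G"
  shows "commute (conjg x f) (conjg y f')"
proof -
  let ?a = "conjg x f" and ?b = "conjg y f'"
  have ab: "?a \<in> carrier G" "?b \<in> carrier G" using f x y by auto
  have 1: "conjg ?a ?b \<otimes> inv ?b = ?a \<otimes> inv (conjg ?b ?a)"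
    using ab by (simp add: conjg_def m_assoc inv_mult_group)
  have "commute ?a (conjg ?b ?a)" 
    using f x ab fitting_commute_conjg_self[OF f(1) x, of "?b \<otimes> x"] by (simp add: conjg_conj)
  then have c1: "commute ?a (conjg ?a ?b \<otimes> inv ?b)"
    unfolding 1 using ab by (intro commute_mult commute_inv) auto
  have "commute ?b (conjg ?a ?b)" 
    using f y ab fitting_commute_conjg_self[OF f(2) y, of "?a \<otimes> y"] by (simp add: conjg_conj)
  then have c2: "commute ?b (conjg ?a ?b \<otimes> inv ?b)"
    using ab by (intro commute_mult commute_inv) auto
  show ?thesis using commute_if_commutator_commutes[OF ab c1 c2] .
qed

lemma fitting_commute:
  assumes "f \<in> fitting" "f' \<in> fitting"
  shows "commute f f'"
proof -
  have "conjg \<one> f = f" "conjg \<one> f' = f'" using assms by simp_all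
  then show ?thesis using fitting_commute_conjg[OF assms one_closed one_closed] by (simp only:)
qed

lemma conjg_fitting:
  assumes "f \<in> fitting" "y \<in> carrier G"
  shows "conjg y f \<in> fitting"
proof (rule fittingI)
  fix x assume "x \<in> carrier G"
  then show "commute (conjg y f) (conjg x (conjg y f))"
    using assms fitting_commute_conjg_self[OF assms(1), of y "x \<otimes> y"] by (simp add: conjg_conj)
qed (use assms in simp)

lemma fitting_subgroup: "subgroup fitting G"
proof (rule subgroupI)
  show "fitting \<subseteq> carrier G" by auto
  have "\<one> \<in> fitting" by (rule fittingI) auto
  then show "fitting \<noteq> {}" by blast
next
  fix f assume f: "f \<in> fitting"
  have "commute (inv f) (conjg x (inv f))" if x: "x \<in> carrier G" for x
  proof -
    have "commute f (conjg x f)" using f x by (rule fittingD)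
    then have "inv (f \<otimes> conjg x f) = inv (conjg x f \<otimes> f)" by simp
    then show ?thesis using f x by (simp add: conjg_inv inv_mult_group)
  qed
  then show "inv f \<in> fitting" using f by (intro fittingI) simp_all
next
  fix f g assume fg: "f \<in> fitting" "g \<in> fitting"
  have "commute (f \<otimes> g) (conjg x (f \<otimes> g))" if x: "x \<in> carrier G" for x
  proof -
    have *: "commute h (conjg x f)" "commute h (conjg x g)" if "h \<in> fitting" for h
      using that x fg fitting_commute conjg_fitting by metis+
    have "commute (conjg x f \<otimes> conjg x g) f" "commute (conjg x f \<otimes> conjg x g) g"
      using *[of f] *[of g] commute_mult[of f "conjg x f" "conjg x g"] commute_mult[of g "conjg x f" "conjg x g"] fg x
      by auto
    then have "commute (conjg x f \<otimes> conjg x g) (f \<otimes> g)"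
      by (intro commute_mult) (use fg x in auto)
    then show ?thesis using fg x by (simp add: conjg_mult)
  qed
  then show "f \<otimes> g \<in> fitting" using fg by (intro fittingI) simp_all
qed

lemma fitting_normal: "fitting \<lhd> G"
  using fitting_subgroup conjg_fitting by (simp add: normal_inv_iff conjg_def)

text \<open>The centraliser \<open>C\<close> is normal and its derived series ends inside the
  Fitting subgroup. If \<open>D (Suc i)\<close> lies there, then commutators of elements of
  \<open>D i\<close> are centralised by \<open>C\<close>, so elements of \<open>D i\<close> commute
  with their conjugates and \<open>D i\<close> lies there too. Climbing back to \<open>D 0\<close>
  gives all of \<open>C\<close>.\<close>

lemma centralizer_fitting:
  assumes "solvable G" and x: "x \<in> carrier G" "\<And>f. f \<in> fitting \<Longrightarrow> commute x f"
  shows "x \<in> fitting"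
proof -
  define C where "C = {x \<in> carrier G. \<forall>f\<in>fitting. commute x f}"
  have Cc: "x \<in> carrier G" "commute x f" if "x \<in> C" "f \<in> fitting" for x f
    using that by (auto simp: C_def)
  have C: "C \<lhd> G"
    unfolding normal_inv_iff
  proof (intro conjI ballI subgroupI)
    show "C \<subseteq> carrier G" by (auto simp: C_def)
    have "\<one> \<in> C" by (simp add: C_def)
    then show "C \<noteq> {}" by blast
  next
    fix a assume a: "a \<in> C"
    have "commute f (inv a)" if "f \<in> fitting" for f
      by (rule commute_inv) (use a that in \<open>auto simp: C_def\<close>)
    then show "inv a \<in> C" using a by (auto simp: C_def)
  next
    fix a b assume ab: "a \<in> C" "b \<in> C"
    have "commute f (a \<otimes> b)" if "f \<in> fitting" for f
      by (rule commute_mult) (use ab that in \<open>auto simp: C_def\<close>)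
    then show "a \<otimes> b \<in> C" using ab by (auto simp: C_def)
  next
    fix x a assume x: "x \<in> carrier G" and a: "a \<in> C"
    have ac: "a \<in> carrier G" using a by (simp add: C_def)
    have "commute (conjg x a) f" if f: "f \<in> fitting" for f
    proof -
      have "conjg (inv x) f \<in> fitting" using f x by (simp add: conjg_fitting)
      then have "commute a (conjg (inv x) f)" using a by (simp add: C_def)
      from commute_conjg[OF x ac _ this] show ?thesis using x f by (simp add: conjg_conj)
    qed
    then show "x \<otimes> a \<otimes> inv x \<in> C" using x ac by (simp add: C_def conjg_def)
  qed
  define D where "D i = (derived G ^^ i) C" for i
  have D: "D i \<lhd> G" for i
    unfolding D_def by (induction i) (use C derived_is_normal in auto)
  have DC: "D i \<subseteq> C" for i
  proof (induction i)
    case (Suc i)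
    then show ?case using derived_incl[of "D i" C] C by (simp add: D_def normal_def)
  qed (simp add: D_def)
  obtain n where "(derived G ^^ n) (carrier G) = {\<one>}"
    using assms(1) solvable_iff_trivial_derived_seq by blast
  then have "D n \<subseteq> {\<one>}" using mono_exp_of_derived[of C "carrier G" n] by (auto simp: D_def C_def)
  moreover have "\<one> \<in> fitting" using fitting_subgroup by (rule subgroup.one_closed)
  ultimately have "D n \<subseteq> fitting" by blast
  moreover have "D i \<subseteq> fitting" if Suc: "D (Suc i) \<subseteq> fitting" for i
  proof
    fix x assume xD: "x \<in> D i"
    then have xC: "x \<in> C" and x: "x \<in> carrier G" using DC by (auto simp: C_def)
    have "commute x (conjg y x)" if y: "y \<in> carrier G" for y
    proof -
      let ?b = "conjg y x"
      have b: "?b \<in> carrier G" using x y by simp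
      have bD: "?b \<in> D i" using D[of i] xD y by (simp add: normal_inv_iff conjg_def)
      then have bC: "?b \<in> C" using DC by blast
      have "D (Suc i) = derived G (D i)" by (simp add: D_def)
      then have "x \<otimes> ?b \<otimes> inv x \<otimes> inv ?b \<in> D (Suc i)"
        unfolding derived_def using xD bD by (auto intro!: generate.incl)
      then have "conjg x ?b \<otimes> inv ?b \<in> fitting" using Suc by (auto simp: conjg_def)
      then show ?thesis
        using commute_if_commutator_commutes[OF x b] xC bC by (simp add: C_def)
    qed
    then show "x \<in> fitting" using x by (intro fittingI)
  qed
  ultimately have "D 0 \<subseteq> fitting"
    by (induction n) auto
  then show ?thesis using x by (auto simp: D_def C_def)
qed

end

section \<open>The action on the Fitting subgroup\<close>

interpretation cfun: complex_vector_space "\<lambda>c (v :: nat \<Rightarrow> complex) i. c * v i"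
  by unfold_locales (auto simp: fun_eq_iff algebra_simps)

definition coord_space :: "nat \<Rightarrow> (nat \<Rightarrow> complex) set" where
  "coord_space m = {v. \<forall>i\<ge>m. v i = 0}"

definition coord_basis :: "nat \<Rightarrow> (nat \<Rightarrow> complex) set" where
  "coord_basis m = (\<lambda>j i. if i = j then 1 else 0) ` {..<m}"

lemma subspace_coord_space: "cfun.subspace (coord_space m)"
  by (simp add: cfun.subspace_def coord_space_def)

lemma finite_coord_basis: "finite (coord_basis m)"
  by (simp add: coord_basis_def)

lemma sum_fun_apply: "(\<Sum>j\<in>A. f j) i = (\<Sum>j\<in>A. f j i)"
  by (induction A rule: infinite_finite_induct) auto

lemma coord_space_subset_span: "coord_space m \<subseteq> cfun.span (coord_basis m)"
proof
  fix v assume v: "v \<in> coord_space m"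
  have "v = (\<Sum>j<m. (\<lambda>i. v j * (if i = j then 1 else 0)))"
  proof
    fix i
    have "(\<Sum>j<m. v j * (if i = j then 1 else 0)) = (if i < m then v i else 0)"
      by (simp add: if_distrib cong: if_cong)
    then show "v i = (\<Sum>j<m. (\<lambda>i. v j * (if i = j then 1 else 0))) i"
      using v by (auto simp: sum_fun_apply coord_space_def)
  qed
  also have "\<dots> \<in> cfun.span (coord_basis m)"
    by (intro cfun.span_sum cfun.span_scale cfun.span_base) (auto simp: coord_basis_def)
  finally show "v \<in> cfun.span (coord_basis m)" .
qed

lemma mat_apply_in_coord_space: "mat_apply m M v \<in> coord_space m"
  by (simp add: mat_apply_def coord_space_def)

lemma lin_mat_apply: "cfun.lin (mat_apply m M)"
  by (rule cfun.linI)
    (auto simp: mat_apply_def fun_eq_iff algebra_simps sum.distrib sum_distrib_left)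

lemma mat_apply_mat_apply:
  "mat_apply m A (mat_apply m B v) = mat_apply m (\<lambda>i j. \<Sum>k<m. A i k * B k j) v"
proof
  fix i
  have "(\<Sum>k<m. of_int (A i k) * (\<Sum>j<m. of_int (B k j) * v j)) =
      (\<Sum>k<m. \<Sum>j<m. of_int (A i k) * of_int (B k j) * v j)"
    by (simp add: sum_distrib_left mult.assoc)
  also have "\<dots> = (\<Sum>j<m. \<Sum>k<m. of_int (A i k) * of_int (B k j) * v j)"
    by (rule sum.swap)
  also have "\<dots> = (\<Sum>j<m. of_int (\<Sum>k<m. A i k * B k j) * v j)"
    by (simp add: sum_distrib_right)
  finally show "mat_apply m A (mat_apply m B v) i = mat_apply m (\<lambda>i j. \<Sum>k<m. A i k * B k j) v i"
    by (simp add: mat_apply_def)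
qed

lemma mat_apply_cong:
  assumes "\<And>i j. i < m \<Longrightarrow> j < m \<Longrightarrow> A i j = B i j"
  shows "mat_apply m A = mat_apply m B"
  using assms by (auto simp: mat_apply_def fun_eq_iff intro!: sum.cong)

lemma mat_apply_one:
  assumes "v \<in> coord_space m"
  shows "mat_apply m (\<lambda>i j. if i = j then 1 else 0) v = v"
  using assms
  by (auto simp: mat_apply_def fun_eq_iff coord_space_def if_distrib[of of_int] if_distrib[of "\<lambda>x. x * _"] cong: if_cong)

lemma congruent_one_mult:
  assumes A: "congruent_one m q A" and B: "congruent_one m q B"
    and C: "\<And>i j. i < m \<Longrightarrow> j < m \<Longrightarrow> C i j = (\<Sum>k<m. A i k * B k j)"
  shows "congruent_one m q C"
  unfolding congruent_one_def
proof (intro allI impI)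
  fix i j assume ij: "i < m" "j < m"
  let ?d = "\<lambda>i j. if i = j then 1 else 0 :: int"
  have "q dvd (\<Sum>k<m. A i k * B k j - ?d i k * ?d k j)"
  proof (rule dvd_sum)
    fix k assume "k \<in> {..<m}"
    then have "q dvd (A i k - ?d i k)" "q dvd (B k j - ?d k j)"
      using A B ij by (auto simp: congruent_one_def)
    then have "q dvd (A i k - ?d i k) * B k j + ?d i k * (B k j - ?d k j)"
      by (intro dvd_add dvd_mult dvd_mult2)
    then show "q dvd A i k * B k j - ?d i k * ?d k j" by (simp add: algebra_simps)
  qed
  moreover have "(\<Sum>k<m. ?d i k * ?d k j) = ?d i j"
    using ij by (simp add: if_distrib[of "\<lambda>x. x * _"] cong: if_cong)
  ultimately show "q dvd C i j - ?d i j" using C[OF ij] by (simp add: sum_subtractf)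
qed

locale fitting_lattice = positive_length_group +
  fixes \<psi> :: "'a \<Rightarrow> nat \<Rightarrow> int" and m :: nat
  assumes psi_iso: "\<psi> \<in> iso (G\<lparr>carrier := fitting\<rparr>) (Zn m)"
    and solvable: "solvable G"
begin

lemma psi_mult: "f \<in> fitting \<Longrightarrow> g \<in> fitting \<Longrightarrow> \<psi> (f \<otimes> g) = \<psi> f + \<psi> g"
  using psi_iso unfolding iso_def hom_def by (auto simp: Zn_def fun_eq_iff)

lemma psi_supp: "f \<in> fitting \<Longrightarrow> i \<ge> m \<Longrightarrow> \<psi> f i = 0"
  using psi_iso unfolding iso_def hom_def by (auto simp: Zn_def)

lemma psi_bij: "bij_betw \<psi> fitting (carrier (Zn m))"
  using psi_iso unfolding iso_def by auto

lemma psi_inj: "f \<in> fitting \<Longrightarrow> g \<in> fitting \<Longrightarrow> \<psi> f = \<psi> g \<Longrightarrow> f = g"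
  using psi_bij unfolding bij_betw_def inj_on_def by blast

lemma fitting_closures [simp]:
  "\<one> \<in> fitting"
  "f \<in> fitting \<Longrightarrow> g \<in> fitting \<Longrightarrow> f \<otimes> g \<in> fitting"
  "f \<in> fitting \<Longrightarrow> inv f \<in> fitting"
  "f \<in> fitting \<Longrightarrow> x \<in> carrier G \<Longrightarrow> conjg x f \<in> fitting"
  using fitting_subgroup conjg_fitting
  by (auto intro: subgroup.one_closed subgroup.m_closed subgroup.m_inv_closed)

lemma fitting_int_pow [simp]: "f \<in> fitting \<Longrightarrow> f [^] (n :: int) \<in> fitting"
  using subgroup_int_pow_closed[OF fitting_subgroup] .

lemma psi_one: "\<psi> \<one> = 0"
  using psi_mult[of \<one> \<one>] by simp

lemma psi_inv: "f \<in> fitting \<Longrightarrow> \<psi> (inv f) = - \<psi> f"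
  using psi_mult[of f "inv f"] by (simp add: psi_one eq_neg_iff_add_eq_0 add.commute)

lemma additive_int_pow:
  fixes h :: "'a \<Rightarrow> int"
  assumes h: "\<And>f g. f \<in> fitting \<Longrightarrow> g \<in> fitting \<Longrightarrow> h (f \<otimes> g) = h f + h g" and f: "f \<in> fitting"
  shows "h (f [^] (n :: int)) = n * h f"
proof -
  have h1: "h \<one> = 0" using h[of \<one> \<one>] by simp
  have nat: "h (f [^] k) = int k * h f" for k :: nat
  proof (induction k)
    case (Suc k)
    have "f [^] k \<in> fitting" using fitting_int_pow[OF f, of "int k"] by (simp add: int_pow_int)
    then show ?case using Suc h f by (simp add: algebra_simps)
  qed (simp add: h1)
  show ?thesis
  proof (cases n rule: int_cases2)
    case (nonneg k)
    then show ?thesis using nat by (simp add: int_pow_int)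
  next
    case (nonpos k)
    have "f [^] n = inv (f [^] k)" using f nonpos by (simp add: int_pow_neg int_pow_int)
    moreover have fk: "f [^] k \<in> fitting" using fitting_int_pow[OF f, of "int k"] by (simp add: int_pow_int)
    moreover have "h (f [^] k) + h (inv (f [^] k)) = 0"
      using h[of "f [^] k" "inv (f [^] k)"] fk h1 by simp
    ultimately show ?thesis using nat[of k] nonpos by simp
  qed
qed

text \<open>The same expression as in \<open>conj_matrix\<close>, so that the entries of that matrix
  are literally the values of \<open>action\<close>.\<close>

definition basis_vec :: "nat \<Rightarrow> 'a" where
  "basis_vec j = inv_into fitting \<psi> (unit_vec_Z j)"

lemma basis_vec:
  assumes "j < m"
  shows "basis_vec j \<in> fitting" "\<psi> (basis_vec j) = unit_vec_Z j"
proof -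
  have "unit_vec_Z j \<in> \<psi> ` fitting"
    using psi_bij assms by (auto simp: bij_betw_def Zn_def unit_vec_Z_def)
  then show "basis_vec j \<in> fitting" "\<psi> (basis_vec j) = unit_vec_Z j"
    unfolding basis_vec_def by (auto intro: inv_into_into f_inv_into_f)
qed

text \<open>Induction on the number of leading coordinates that may be nonzero: a power of
  \<open>basis_vec k\<close> clears coordinate \<open>k\<close>.\<close>

lemma additive_expansion:
  fixes h :: "'a \<Rightarrow> int"
  assumes h: "\<And>f g. f \<in> fitting \<Longrightarrow> g \<in> fitting \<Longrightarrow> h (f \<otimes> g) = h f + h g" and f: "f \<in> fitting"
  shows "h f = (\<Sum>j<m. h (basis_vec j) * \<psi> f j)"
proof -
  have "h f = (\<Sum>j<k. h (basis_vec j) * \<psi> f j)" 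
    if "k \<le> m" "f \<in> fitting" "\<forall>i\<ge>k. \<psi> f i = 0" for k f
    using that
  proof (induction k arbitrary: f)
    case 0
    then have "\<psi> f = \<psi> \<one>" by (auto simp: psi_one fun_eq_iff)
    then have "f = \<one>" using psi_inj 0 by auto
    then show ?case using h[of \<one> \<one>] by simp
  next
    case (Suc k)
    then have k: "k < m" and f: "f \<in> fitting" by auto
    note e = basis_vec[OF k]
    let ?n = "- \<psi> f k"
    let ?g = "f \<otimes> basis_vec k [^] ?n"
    have psi_pow: "\<psi> (basis_vec k [^] ?n) i = ?n * unit_vec_Z k i" for i
      using additive_int_pow[of "\<lambda>f. \<psi> f i" "basis_vec k" ?n] psi_mult e by simp
    have psig: "\<psi> ?g i = (if i = k then 0 else \<psi> f i)" for i
      using psi_mult[of f "basis_vec k [^] ?n"] f e psi_pow[of i] by (simp add: unit_vec_Z_def)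
    have "\<forall>i\<ge>k. \<psi> ?g i = 0" using psig Suc.prems(3) by (simp add: Suc_le_eq)
    then have "h ?g = (\<Sum>j<k. h (basis_vec j) * \<psi> ?g j)"
      using Suc.IH[of ?g] k f e by simp
    also have "\<dots> = (\<Sum>j<k. h (basis_vec j) * \<psi> f j)"
      by (rule sum.cong) (simp_all add: psig)
    also have "h ?g = h f + ?n * h (basis_vec k)"
      using h f e additive_int_pow[OF h e(1), of ?n] by simp
    finally show ?case by (simp add: algebra_simps)
  qed
  then show ?thesis using f psi_supp by blast
qed

definition action :: "'a \<Rightarrow> nat \<Rightarrow> nat \<Rightarrow> int" where
  "action x i j = \<psi> (conjg x (basis_vec j)) i"

lemma psi_conjg:
  assumes x: "x \<in> carrier G" and f: "f \<in> fitting"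
  shows "\<psi> (conjg x f) i = (\<Sum>j<m. action x i j * \<psi> f j)"
  unfolding action_def
  by (rule additive_expansion) (use x f in \<open>simp_all add: conjg_mult psi_mult\<close>)

lemma action_mult:
  assumes "x \<in> carrier G" "y \<in> carrier G" "j < m"
  shows "action (x \<otimes> y) i j = (\<Sum>k<m. action x i k * action y k j)"
proof -
  have "conjg (x \<otimes> y) (basis_vec j) = conjg x (conjg y (basis_vec j))"
    using assms basis_vec by (simp add: conjg_conj)
  then show ?thesis
    using psi_conjg[of x "conjg y (basis_vec j)" i] assms basis_vec by (simp add: action_def)
qed

lemma action_fitting:
  assumes "f \<in> fitting" "j < m"
  shows "action f i j = (if i = j then 1 else 0)"
proof -
  have "conjg f (basis_vec j) = basis_vec j"
    using assms basis_vec fitting_commute by (simp add: conjg_eq_self_iff)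
  then show ?thesis using basis_vec[OF assms(2)] by (simp add: action_def unit_vec_Z_def)
qed

lemma in_fitting_if_action_one:
  assumes x: "x \<in> carrier G" and a: "\<And>i j. i < m \<Longrightarrow> j < m \<Longrightarrow> action x i j = (if i = j then 1 else 0)"
  shows "x \<in> fitting"
proof (rule centralizer_fitting[OF solvable x])
  fix f assume f: "f \<in> fitting"
  have "\<psi> (conjg x f) i = \<psi> f i" for i
  proof (cases "i < m")
    case True
    have "\<psi> (conjg x f) i = (\<Sum>j<m. (if i = j then 1 else 0) * \<psi> f j)"
      using True a by (simp add: psi_conjg[OF x f])
    also have "\<dots> = \<psi> f i" using True by (simp add: if_distrib[of "\<lambda>x. x * _"] cong: if_cong)
    finally show ?thesis .
  qed (use f x psi_supp in auto)
  then have "\<psi> (conjg x f) = \<psi> f" by (rule ext)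
  then have "conjg x f = f" using f x by (intro psi_inj) simp_all
  then show "commute x f" using x f by (simp add: conjg_eq_self_iff)
qed

definition T :: "'a \<Rightarrow> (nat \<Rightarrow> complex) \<Rightarrow> nat \<Rightarrow> complex" where
  "T x = mat_apply m (action x)"

lemma T_mult:
  assumes "x \<in> carrier G" "y \<in> carrier G"
  shows "T (x \<otimes> y) v = T x (T y v)"
  unfolding T_def mat_apply_mat_apply
  by (rule fun_cong[OF mat_apply_cong]) (use assms action_mult in auto)

lemma T_fitting: "f \<in> fitting \<Longrightarrow> v \<in> coord_space m \<Longrightarrow> T f v = v"
  unfolding T_def using mat_apply_cong[of m "action f" "\<lambda>i j. if i = j then 1 else 0"]
  by (simp add: action_fitting mat_apply_one)

lemma T_in: "T x v \<in> coord_space m"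
  unfolding T_def by (rule mat_apply_in_coord_space)

lemma lin_T: "cfun.lin (T x)"
  unfolding T_def by (rule lin_mat_apply)

lemma T_nat_pow:
  assumes x: "x \<in> carrier G" and v: "v \<in> coord_space m" and "T x v = (\<lambda>i. c * v i)"
  shows "T (x [^] (n::nat)) v = (\<lambda>i. c ^ n * v i)"
proof (induction n)
  case 0
  then show ?case using v by (simp add: T_fitting)
next
  case (Suc n)
  have "T (x [^] Suc n) v = T (x [^] n) (T x v)" using x by (simp add: T_mult)
  also have "\<dots> = (\<lambda>i. c * T (x [^] n) v i)"
    unfolding assms(3) using cfun.lin_scale[OF lin_T, of "x [^] n" c v] .
  finally show ?case using Suc by (simp add: fun_eq_iff)
qed

lemma T_eq_iff:
  assumes "x \<in> carrier G" "y \<in> carrier G" and eq: "\<And>v. v \<in> coord_space m \<Longrightarrow> T x v = T y v"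
  shows "inv x \<otimes> y \<in> fitting"
proof (rule in_fitting_if_action_one)
  fix i j assume ij: "i < m" "j < m"
  define v :: "nat \<Rightarrow> complex" where "v k = (if k = j then 1 else 0)" for k
  have v: "v \<in> coord_space m" using ij by (simp add: v_def coord_space_def)
  have Tv: "T z v i = of_int (action z i j)" for z
    using ij by (simp add: T_def mat_apply_def v_def if_distrib cong: if_cong)
  have "T (inv x \<otimes> y) v = T (inv x \<otimes> x) v"
    using assms v by (simp only: T_mult eq inv_closed)
  also have "\<dots> = v" using assms v by (simp add: T_fitting)
  finally have Tv': "T (inv x \<otimes> y) v i = v i" by (rule fun_cong)
  have "of_int (action (inv x \<otimes> y) i j) = v i" by (rule trans[OF Tv[symmetric] Tv'])
  then show "action (inv x \<otimes> y) i j = (if i = j then 1 else 0)"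
    by (simp add: v_def of_int_eq_1_iff split: if_splits)
qed (use assms in auto)

section \<open>Lattice vectors and commutators with elements of the Fitting subgroup\<close>

definition cvec :: "'a \<Rightarrow> nat \<Rightarrow> complex" where
  "cvec f i = of_int (\<psi> f i)"

lemma cvec_in: "f \<in> fitting \<Longrightarrow> cvec f \<in> coord_space m"
  by (simp add: cvec_def coord_space_def psi_supp)

lemma T_cvec:
  assumes "x \<in> carrier G" "f \<in> fitting"
  shows "T x (cvec f) = cvec (conjg x f)"
proof
  fix i
  show "T x (cvec f) i = cvec (conjg x f) i"
  proof (cases "i < m")
    case True
    then show ?thesis unfolding T_def mat_apply_def cvec_def psi_conjg[OF assms] by simp
  next
    case False
    then show ?thesis using assms by (simp add: T_def mat_apply_def cvec_def psi_supp)
  qed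
qed

text \<open>On the Fitting subgroup this is the operator 1 - x in multiplicative notation, and
  \<open>cvec\<close> carries it to \<open>\<lambda>v. v - T x v\<close>.\<close>

definition comm :: "'a \<Rightarrow> 'a \<Rightarrow> 'a" where
  "comm x f = f \<otimes> inv (conjg x f)"

lemma comm_in: "x \<in> carrier G \<Longrightarrow> f \<in> fitting \<Longrightarrow> comm x f \<in> fitting"
  by (simp add: comm_def)

lemma comm_eq_one_iff:
  "x \<in> carrier G \<Longrightarrow> f \<in> carrier G \<Longrightarrow> comm x f = \<one> \<longleftrightarrow> commute x f"
  unfolding comm_def by (metis conjg_closed conjg_eq_self_iff inv_closed inv_equality inv_inv r_inv)

text \<open>The roles are exchanged: \<open>f\<close> moves \<open>x\<close> by
  \<open>comm x f\<close>, which commutes with \<open>f\<close> because the Fitting subgroup is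
  abelian and with \<open>x\<close> by assumption. Thus \<open>comm x\<close> and its square have
  the same kernel.\<close>

lemma comm_comm_one:
  assumes x: "x \<in> carrier G" and f: "f \<in> fitting" and "comm x (comm x f) = \<one>"
  shows "comm x f = \<one>"
proof (rule commuting_commutator_trivial[of f x])
  note cf = comm_in[OF x f]
  show "conjg f x = comm x f \<otimes> x" using x f by (simp add: comm_def conjg_def m_assoc inv_mult_group)
  show "commute f (comm x f)" using f cf fitting_commute by blast
  show "commute x (comm x f)" using assms(3) comm_eq_one_iff[OF x, of "comm x f"] cf by simp
qed (use x f comm_in in auto)

lemma comm_funpow_one:
  assumes x: "x \<in> carrier G" and "f \<in> fitting" "(comm x ^^ k) f = \<one>"
  shows "commute x f"
proof -
  have in_F: "(comm x ^^ k) f \<in> fitting" for k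
    by (induction k) (use assms comm_in in auto)
  have "comm x f = \<one>" using assms(3)
  proof (induction k)
    case 0
    then show ?case using x comm_eq_one_iff[OF x] by simp
  next
    case (Suc k)
    show ?case
    proof (cases k)
      case 0
      then show ?thesis using Suc.prems by simp
    next
      case (Suc j)
      then show ?thesis
        using Suc.prems Suc.IH comm_comm_one[OF x in_F[of j]] by simp
    qed
  qed
  then show ?thesis using comm_eq_one_iff x assms by auto
qed

lemma cvec_comm:
  assumes "x \<in> carrier G" "f \<in> fitting"
  shows "cvec (comm x f) = cvec f - T x (cvec f)"
  using assms by (simp add: T_cvec comm_def) (simp add: fun_eq_iff cvec_def psi_mult psi_inv)

text \<open>Nilpotency of \<open>1 - T x\<close> at the complex vector \<open>cvec f\<close> is
  nilpotency of \<open>comm x\<close> at \<open>f\<close>, and there a single step suffices. A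
  proper subspace \<open>S\<close> is needed for the eigenspace of a generic element.\<close>

lemma unipotent_on_subspace:
  assumes x: "x \<in> carrier G" and S: "cfun.subspace S" "S \<subseteq> coord_space m" "T x ` S \<subseteq> S"
    and ev: "\<And>u c. u \<in> S \<Longrightarrow> u \<noteq> 0 \<Longrightarrow> T x u = (\<lambda>i. c * u i) \<Longrightarrow> c = 1"
    and f: "f \<in> fitting" "cvec f \<in> S"
  shows "commute x f"
proof -
  have "\<exists>k. ((\<lambda>v. v - T x v) ^^ k) (cvec f) = 0"
    by (rule cfun.unipotent_on_vector[OF S(1) subset_trans[OF S(2) coord_space_subset_span]
          finite_coord_basis lin_T S(3) f(2)]) (rule ev)
  then obtain k where "((\<lambda>v. v - T x v) ^^ k) (cvec f) = 0" by (elim exE)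
  moreover have "((\<lambda>v. v - T x v) ^^ k) (cvec f) = cvec ((comm x ^^ k) f) \<and> (comm x ^^ k) f \<in> fitting" for k
    by (induction k) (use f x comm_in cvec_comm in auto)
  ultimately have "cvec ((comm x ^^ k) f) = 0" "(comm x ^^ k) f \<in> fitting" by metis+
  then have "(comm x ^^ k) f = \<one>" by (intro psi_inj) (auto simp: cvec_def psi_one fun_eq_iff)
  then show ?thesis by (rule comm_funpow_one[OF x f(1)])
qed

lemma unipotent_in_fitting:
  assumes x: "x \<in> carrier G"
    and ev: "\<And>u c. u \<in> coord_space m \<Longrightarrow> u \<noteq> 0 \<Longrightarrow> T x u = (\<lambda>i. c * u i) \<Longrightarrow> c = 1"
  shows "x \<in> fitting"
proof (rule centralizer_fitting[OF solvable x])
  fix f assume "f \<in> fitting"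
  then show "commute x f"
    by (intro unipotent_on_subspace[OF x subspace_coord_space order_refl _ ev])
      (use T_in cvec_in in auto)
qed

lemma unipotent_conj_matrix_in_fitting:
  assumes x: "x \<in> carrier G" and "unipotent (conj_matrix G fitting \<psi> m x)"
  shows "x \<in> fitting"
proof (rule unipotent_in_fitting[OF x])
  fix u c assume u: "u \<in> coord_space m" "u \<noteq> 0" "T x u = (\<lambda>i. c * u i)"
  let ?A = "map_mat complex_of_int (conj_matrix G fitting \<psi> m x)"
  have A: "conj_matrix G fitting \<psi> m x = mat m m (\<lambda>(i, j). action x i j)"
    unfolding conj_matrix_def action_def basis_vec_def conjg_def ..
  have "vec m u \<noteq> 0\<^sub>v m" using u(1,2) by (auto simp: vec_eq_iff coord_space_def fun_eq_iff) (metis not_less)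
  moreover have "?A *\<^sub>v vec m u = c \<cdot>\<^sub>v vec m u"
  proof (rule eq_vecI)
    fix i assume "i < dim_vec (c \<cdot>\<^sub>v vec m u)"
    then have i: "i < m" by simp
    then have "(?A *\<^sub>v vec m u) $ i = T x u i"
      by (simp add: A scalar_prod_def atLeast0LessThan T_def mat_apply_def)
    then show "(?A *\<^sub>v vec m u) $ i = (c \<cdot>\<^sub>v vec m u) $ i" using i u(3) by simp
  qed (simp add: A)
  ultimately have "eigenvalue ?A c"
    unfolding eigenvalue_def eigenvector_def by (intro exI[of _ "vec m u"]) (simp add: A)
  then show "c = 1" using assms(2) by (simp add: unipotent_def)
qed

end

section \<open>The congruence subgroup\<close>

lemma congruent_one_right:
  fixes A B :: "nat \<Rightarrow> nat \<Rightarrow> int"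
  assumes B: "congruent_one m q B" and ij: "i < m" "j < m"
  shows "q dvd (\<Sum>k<m. A i k * B k j) - A i j"
proof -
  let ?d = "\<lambda>i j. if i = j then 1 else 0 :: int"
  have "q dvd (\<Sum>k<m. A i k * (B k j - ?d k j))"
    by (intro dvd_sum dvd_mult) (use B ij in \<open>auto simp: congruent_one_def\<close>)
  also have "(\<Sum>k<m. A i k * (B k j - ?d k j)) = (\<Sum>k<m. A i k * B k j) - (\<Sum>k<m. A i k * ?d k j)"
    by (simp add: sum_subtractf right_diff_distrib)
  also have "(\<Sum>k<m. A i k * ?d k j) = A i j"
    using ij by (simp add: if_distrib[of "\<lambda>x. _ * x"] cong: if_cong)
  finally show ?thesis .
qed

lemma (in group) finite_rcosets_if_finite_invariant:
  assumes H: "subgroup H G" and fin: "finite (f ` carrier G)"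
    and f: "\<And>x y. x \<in> carrier G \<Longrightarrow> y \<in> carrier G \<Longrightarrow> f x = f y \<Longrightarrow> x \<otimes> inv y \<in> H"
  shows "finite (rcosets H)"
proof -
  define r where "r c = (SOME x. x \<in> carrier G \<and> f x = c)" for c
  have r: "r (f x) \<in> carrier G" "f (r (f x)) = f x" if "x \<in> carrier G" for x
    using someI[of "\<lambda>y. y \<in> carrier G \<and> f y = f x" x] that unfolding r_def by auto
  have "H #> x = H #> r (f x)" if x: "x \<in> carrier G" for x
  proof -
    have h: "x \<otimes> inv (r (f x)) \<in> H" using f[of x "r (f x)"] r[OF x] x by simp
    have "x \<in> H #> r (f x)"
      unfolding r_coset_def using h x r[OF x] by (auto simp: m_assoc intro!: bexI[of _ "x \<otimes> inv (r (f x))"])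
    then show ?thesis using repr_independence[OF _ r(1)[OF x] H] by simp
  qed
  then have "rcosets H \<subseteq> (\<lambda>c. H #> r c) ` f ` carrier G"
    unfolding RCOSETS_def by auto
  then show ?thesis using fin finite_surj by blast
qed

context fitting_lattice
begin

definition congruence_subgroup :: "'a set" where
  "congruence_subgroup = {x \<in> carrier G. congruent_one m 4 (action x)}"

abbreviation "\<Gamma> \<equiv> congruence_subgroup"

lemma Gamma_closed [simp]: "x \<in> \<Gamma> \<Longrightarrow> x \<in> carrier G"
  unfolding congruence_subgroup_def by blast

lemma Gamma_congruent: "x \<in> \<Gamma> \<Longrightarrow> congruent_one m 4 (action x)"
  unfolding congruence_subgroup_def by blast

lemma GammaI: "x \<in> carrier G \<Longrightarrow> congruent_one m 4 (action x) \<Longrightarrow> x \<in> \<Gamma>"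
  unfolding congruence_subgroup_def by blast

lemma Gamma_dvd:
  "x \<in> \<Gamma> \<Longrightarrow> i < m \<Longrightarrow> j < m \<Longrightarrow> 4 dvd action x i j - (if i = j then 1 else 0)"
  using Gamma_congruent unfolding congruent_one_def by blast

lemma fitting_subset_Gamma: "fitting \<subseteq> \<Gamma>"
  unfolding congruence_subgroup_def congruent_one_def by (auto simp: action_fitting)

lemma fitting_Gamma [simp]: "f \<in> fitting \<Longrightarrow> f \<in> \<Gamma>"
  using fitting_subset_Gamma by blast

text \<open>In matrices, \<open>x \<otimes> inv y\<close> minus 1 is (x - y) times the inverse of y.
  Closure under inverses, normality and finite index of the congruence subgroup all rest on this
  criterion.\<close>

lemma action_mult_inv_congruent:
  assumes x: "x \<in> carrier G" and y: "y \<in> carrier G"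
    and eq: "\<And>i j. i < m \<Longrightarrow> j < m \<Longrightarrow> 4 dvd action x i j - action y i j"
  shows "x \<otimes> inv y \<in> \<Gamma>"
  unfolding congruence_subgroup_def congruent_one_def
proof (intro CollectI conjI allI impI)
  fix i j assume ij: "i < m" "j < m"
  have "(\<Sum>k<m. action y i k * action (inv y) k j) = action \<one> i j"
    using action_mult[of y "inv y" j i] y ij by simp
  then have d: "(\<Sum>k<m. action y i k * action (inv y) k j) = (if i = j then 1 else 0)"
    using action_fitting[of \<one>] ij by simp
  have "4 dvd (\<Sum>k<m. (action x i k - action y i k) * action (inv y) k j)"
    by (intro dvd_sum dvd_mult2) (use eq ij in auto)
  also have "(\<Sum>k<m. (action x i k - action y i k) * action (inv y) k j) =
      action (x \<otimes> inv y) i j - (if i = j then 1 else 0)"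
    using x y ij d by (simp add: left_diff_distrib sum_subtractf action_mult)
  finally show "4 dvd action (x \<otimes> inv y) i j - (if i = j then 1 else 0)" .
qed (use x y in auto)

lemma Gamma_subgroup: "subgroup \<Gamma> G"
proof (rule subgroupI)
  show "\<Gamma> \<subseteq> carrier G" by auto
  show "\<Gamma> \<noteq> {}" using fitting_Gamma[OF fitting_closures(1)] by blast
next
  fix x assume x: "x \<in> \<Gamma>"
  have "\<one> \<otimes> inv x \<in> \<Gamma>"
  proof (rule action_mult_inv_congruent)
    fix i j assume ij: "i < m" "j < m"
    then have "4 dvd action x i j - action \<one> i j"
      using Gamma_dvd[OF x ij] action_fitting[of \<one> j i] by simp
    then show "4 dvd action \<one> i j - action x i j" by (metis dvd_minus_iff minus_diff_eq)
  qed (use x in auto)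
  then show "inv x \<in> \<Gamma>" using x by simp
next
  fix x y assume xy: "x \<in> \<Gamma>" "y \<in> \<Gamma>"
  then have "congruent_one m 4 (action (x \<otimes> y))"
    using action_mult[of x y] by (intro congruent_one_mult[OF Gamma_congruent Gamma_congruent]) auto
  then show "x \<otimes> y \<in> \<Gamma>" using xy by (intro GammaI) simp_all
qed

lemma Gamma_closures [simp]:
  "x \<in> \<Gamma> \<Longrightarrow> y \<in> \<Gamma> \<Longrightarrow> x \<otimes> y \<in> \<Gamma>"
  "x \<in> \<Gamma> \<Longrightarrow> inv x \<in> \<Gamma>"
  using Gamma_subgroup by (auto intro: subgroup.m_closed subgroup.m_inv_closed)

lemma Gamma_nat_pow [simp]: "x \<in> \<Gamma> \<Longrightarrow> x [^] (n :: nat) \<in> \<Gamma>"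
  by (induction n) auto

lemma Gamma_normal: "\<Gamma> \<lhd> G"
  unfolding normal_inv_iff
proof (intro conjI ballI Gamma_subgroup)
  fix y x assume y: "y \<in> carrier G" and x: "x \<in> \<Gamma>"
  show "y \<otimes> x \<otimes> inv y \<in> \<Gamma>"
  proof (rule action_mult_inv_congruent)
    fix i j assume "i < m" "j < m"
    then show "4 dvd action (y \<otimes> x) i j - action y i j"
      using congruent_one_right[OF Gamma_congruent[OF x], of i j "action y"] action_mult[of y x j i] x y
      by simp
  qed (use x y in auto)
qed

lemma Gamma_finite_index: "finite (rcosets \<Gamma>)"
proof (rule finite_rcosets_if_finite_invariant[OF Gamma_subgroup])
  let ?I = "{..<m} \<times> {..<m}"
  let ?f = "\<lambda>x. restrict (\<lambda>(i, j). action x i j mod 4) ?I"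
  have "?f ` carrier G \<subseteq> ?I \<rightarrow>\<^sub>E {0..<4}" by (auto split: if_splits)
  then show "finite (?f ` carrier G)"
    by (rule finite_subset) (intro finite_PiE; simp)
  fix x y assume xy: "x \<in> carrier G" "y \<in> carrier G" "?f x = ?f y"
  show "x \<otimes> inv y \<in> \<Gamma>"
  proof (rule action_mult_inv_congruent)
    fix i j assume "i < m" "j < m"
    then have "action x i j mod 4 = action y i j mod 4"
      using fun_cong[OF xy(3), of "(i, j)"] by simp
    then show "4 dvd action x i j - action y i j" by (simp add: mod_eq_dvd_iff)
  qed (use xy in auto)
qed

lemma Gamma_root_of_unity_eigenvalue:
  assumes x: "x \<in> \<Gamma>" and u: "u \<in> coord_space m" "u \<noteq> 0" "T x u = (\<lambda>i. c * u i)"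
    and n: "n > 0" "c ^ n = 1"
  shows "c = 1"
proof -
  obtain j where j: "u j \<noteq> 0" using u(2) by (auto simp: fun_eq_iff)
  then have "j < m" using u(1) by (auto simp: coord_space_def) (metis not_less)
  show ?thesis
  proof (rule root_of_unity_eigenvalue[where P = "\<lambda>k. action (x [^] k)" and v = u and m = m, OF _ _ \<open>j < m\<close> j n])
    show "congruent_one m 4 (action (x [^] k))" for k :: nat
      by (rule Gamma_congruent) (rule Gamma_nat_pow[OF x])
    show "mat_apply m (action (x [^] k)) u = (\<lambda>i. c ^ k * u i)" for k :: nat
      using T_nat_pow[OF Gamma_closed[OF x] u(1,3), of k] by (simp add: T_def)
  qed
qed

lemma Gamma_mod_fitting_torsion_free:
  assumes x: "x \<in> \<Gamma>" and n: "n > 0" "x [^] (n::nat) \<in> fitting"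
  shows "x \<in> fitting"
proof (rule unipotent_in_fitting)
  fix u c assume u: "u \<in> coord_space m" "u \<noteq> 0" "T x u = (\<lambda>i. c * u i)"
  obtain j where j: "u j \<noteq> 0" using u(2) by (auto simp: fun_eq_iff)
  have "u = (\<lambda>i. c ^ n * u i)"
    using T_nat_pow[OF Gamma_closed[OF x] u(1,3), of n] T_fitting[OF n(2) u(1)] by simp
  then have "u j = c ^ n * u j" by (rule fun_cong)
  then have "c ^ n = 1" using j by simp
  then show "c = 1" using Gamma_root_of_unity_eigenvalue[OF x u n(1)] by blast
qed (use x in simp)

text \<open>By the next two lemmas this amounts to commuting of the operators \<open>T x\<close> and
  \<open>T y\<close>, which makes symmetry and closure under products and inverses easy.\<close>

definition commute_mod :: "'a \<Rightarrow> 'a \<Rightarrow> bool" where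
  "commute_mod x y \<longleftrightarrow> conjg x y \<otimes> inv y \<in> fitting"

lemma commute_mod_imp:
  assumes "x \<in> carrier G" "y \<in> carrier G" "commute_mod x y"
  shows "T x (T y v) = T y (T x v)"
proof -
  have "x \<otimes> y = (conjg x y \<otimes> inv y) \<otimes> (y \<otimes> x)"
    using assms by (simp add: conjg_def m_assoc)
  then have "T (x \<otimes> y) v = T (conjg x y \<otimes> inv y) (T (y \<otimes> x) v)"
    using assms by (metis T_mult conjg_closed inv_closed m_closed)
  also have "\<dots> = T (y \<otimes> x) v"
    using assms(3) by (simp add: T_fitting T_in commute_mod_def)
  finally show ?thesis using assms by (simp add: T_mult)
qed

lemma commute_modI:
  assumes x: "x \<in> carrier G" and y: "y \<in> carrier G" and eq: "\<And>v. T x (T y v) = T y (T x v)"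
  shows "commute_mod x y"
proof -
  let ?z = "conjg x y \<otimes> inv y"
  have "inv \<one> \<otimes> ?z \<in> fitting"
  proof (rule T_eq_iff)
    fix v assume v: "v \<in> coord_space m"
    have "?z = (x \<otimes> y) \<otimes> (inv x \<otimes> inv y)" using x y by (simp add: conjg_def m_assoc)
    then have "T ?z v = T x (T y (T (inv x \<otimes> inv y) v))" using x y by (simp add: T_mult)
    also have "\<dots> = T y (T x (T (inv x \<otimes> inv y) v))" using eq by simp
    also have "\<dots> = T (y \<otimes> (x \<otimes> (inv x \<otimes> inv y))) v"
      using x y T_mult[of y "x \<otimes> (inv x \<otimes> inv y)" v] T_mult[of x "inv x \<otimes> inv y" v] by simp
    also have "\<dots> = T \<one> v" using x y by simp
    finally show "T \<one> v = T ?z v" ..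
  qed (use x y in auto)
  then show ?thesis using x y by (simp add: commute_mod_def)
qed

lemma commute_mod_sym:
  "x \<in> carrier G \<Longrightarrow> y \<in> carrier G \<Longrightarrow> commute_mod x y \<Longrightarrow> commute_mod y x"
  by (rule commute_modI) (simp_all only: commute_mod_imp[symmetric])

lemma commute_mod_inv:
  assumes x: "x \<in> carrier G" and y: "y \<in> carrier G" and c: "commute_mod x y"
  shows "commute_mod x (inv y)"
proof (rule commute_modI)
  fix v
  have y1: "T (inv y) (T y w) = w" "T y (T (inv y) w) = w" if "w \<in> coord_space m" for w
    using that y by (simp_all add: T_fitting flip: T_mult)
  have "T x (T (inv y) v) = T (inv y) (T y (T x (T (inv y) v)))" by (simp add: y1 T_in)
  also have "\<dots> = T (inv y) (T x (T y (T (inv y) v)))" using commute_mod_imp[OF x y c] by simp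
  also have "\<dots> = T (inv y) (T x (T \<one> v))" using y by (simp flip: T_mult)
  also have "\<dots> = T (inv y) (T x v)" using x by (simp flip: T_mult)
  finally show "T x (T (inv y) v) = T (inv y) (T x v)" .
qed (use x y in auto)

lemma commute_mod_mult:
  assumes "x \<in> carrier G" "y \<in> carrier G" "z \<in> carrier G" "commute_mod x y" "commute_mod x z"
  shows "commute_mod x (y \<otimes> z)"
proof (rule commute_modI)
  fix v
  have "T x (T (y \<otimes> z) v) = T x (T y (T z v))" using assms by (simp only: T_mult)
  also have "\<dots> = T y (T x (T z v))" using assms by (intro commute_mod_imp)
  also have "T x (T z v) = T z (T x v)" using assms by (intro commute_mod_imp)
  also have "T y (T z (T x v)) = T (y \<otimes> z) (T x v)" using assms by (simp only: T_mult)
  finally show "T x (T (y \<otimes> z) v) = T (y \<otimes> z) (T x v)" .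
qed (use assms in auto)

lemma commute_mod_if_action_eq:
  assumes x: "x \<in> carrier G" and y: "y \<in> carrier G"
    and eq: "\<And>i j. i < m \<Longrightarrow> j < m \<Longrightarrow> action (conjg x y) i j = action y i j"
  shows "commute_mod x y"
proof (rule commute_modI)
  fix v
  have "T (conjg x y) = T y" unfolding T_def by (rule mat_apply_cong) (rule eq)
  then have "T y (T x v) = T (conjg x y \<otimes> x) v" using x y by (simp add: T_mult)
  also have "conjg x y \<otimes> x = x \<otimes> y" using x y by (simp add: conjg_def m_assoc)
  finally show "T x (T y v) = T y (T x v)" using x y by (simp add: T_mult)
qed (use x y in auto)

lemma action_eq_if_commute_mod:
  assumes x: "x \<in> carrier G" and y: "y \<in> carrier G" and "commute_mod x y" and ij: "i < m" "j < m"
  shows "action (conjg x y) i j = action y i j"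
proof -
  have "conjg x y = (conjg x y \<otimes> inv y) \<otimes> y" using x y by (simp add: m_assoc)
  then have "action (conjg x y) i j = (\<Sum>k<m. action (conjg x y \<otimes> inv y) i k * action y k j)"
    using action_mult[of "conjg x y \<otimes> inv y" y j i] x y ij by simp
  also have "\<dots> = (\<Sum>k<m. (if i = k then 1 else 0) * action y k j)"
    using assms(3) by (intro sum.cong) (simp_all add: commute_mod_def action_fitting)
  also have "\<dots> = action y i j" using ij by (simp add: if_distrib[of "\<lambda>x. x * _"] cong: if_cong)
  finally show ?thesis .
qed

text \<open>Conjugation by an element of \<open>\<Gamma>\<close> is congruent to the identity modulo 4 on integer matrices.\<close>

lemma commute_mod_if_pow_commute_mod:
  assumes x: "x \<in> \<Gamma>" and a: "a \<in> carrier G" and n: "n > 0" and c: "commute_mod (x [^] (n::nat)) a"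
  shows "commute_mod x a"
proof -
  let ?I = "{..<m} \<times> {..<m}"
  have xc: "x \<in> carrier G" using x by simp
  \<comment> \<open>Conjugation of an integer matrix \<open>t\<close> by the matrix of
    \<open>x\<close>; \<open>\<tau> y\<close> is the matrix of \<open>y\<close> as a vector indexed
    by pairs.\<close>
  define s where "s t = (\<lambda>(i, j). if i < m \<and> j < m then
      \<Sum>k<m. \<Sum>h<m. action x i k * t (k, h) * action (inv x) h j else 0)" for t :: "nat \<times> nat \<Rightarrow> int"
  define \<tau> where "\<tau> y = (\<lambda>(i, j). if i < m \<and> j < m then action y i j else 0)" for y
  have \<tau>: "\<tau> y \<in> int_lattice ?I" for y by (auto simp: \<tau>_def int_lattice_def)
  have s\<tau>: "s (\<tau> y) = \<tau> (conjg x y)" if y: "y \<in> carrier G" for y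
  proof
    fix p :: "nat \<times> nat" obtain i j where p: "p = (i, j)" by (cases p)
    show "s (\<tau> y) p = \<tau> (conjg x y) p"
    proof (cases "i < m \<and> j < m")
      case True
      then have "s (\<tau> y) p = (\<Sum>k<m. \<Sum>h<m. action x i k * action y k h * action (inv x) h j)"
        by (simp add: s_def \<tau>_def p)
      also have "\<dots> = (\<Sum>h<m. (\<Sum>k<m. action x i k * action y k h) * action (inv x) h j)"
        by (subst sum.swap) (simp add: sum_distrib_right)
      also have "\<dots> = (\<Sum>h<m. action (x \<otimes> y) i h * action (inv x) h j)"
        using xc y by (intro sum.cong) (simp_all add: action_mult)
      also have "\<dots> = action (conjg x y) i j"
        unfolding conjg_def using xc y True by (subst action_mult[of "x \<otimes> y" "inv x"]) simp_all
      finally show ?thesis using True by (simp add: \<tau>_def p)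
    qed (auto simp: s_def \<tau>_def p)
  qed
  have pow: "(s ^^ k) (\<tau> a) = \<tau> (conjg (x [^] k) a)" for k :: nat
  proof (induction k)
    case (Suc k)
    then have "(s ^^ Suc k) (\<tau> a) = \<tau> (conjg x (conjg (x [^] k) a))" using s\<tau> xc a by simp
    also have "conjg x (conjg (x [^] k) a) = conjg (x [^] Suc k) a"
      unfolding conjg_conj[OF xc nat_pow_closed[OF xc] a] using nat_pow_Suc2[OF xc, of k] by simp
    finally show ?case .
  qed (use a in simp)
  have s4: "congruent_id_mod4 ?I s"
    unfolding congruent_id_mod4_def
  proof (intro ballI conjI allI)
    fix u v and p :: "nat \<times> nat" assume u: "u \<in> int_lattice ?I" and v: "v \<in> int_lattice ?I"
    show "s u \<in> int_lattice ?I" by (auto simp: s_def int_lattice_def)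
    show "s (u + v) = s u + s v"
      by (auto simp: s_def fun_eq_iff algebra_simps sum.distrib)
    obtain i j :: nat where p: "p = (i, j)" by (cases p)
    show "4 dvd s u p - u p"
    proof (cases "i < m \<and> j < m")
      case True
      let ?d = "\<lambda>i j. if i = j then 1 else 0 :: int"
      have "4 dvd (\<Sum>k<m. \<Sum>h<m. action x i k * u (k, h) * action (inv x) h j - ?d i k * u (k, h) * ?d h j)"
      proof (intro dvd_sum)
        fix k h assume kh: "k \<in> {..<m}" "h \<in> {..<m}"
        have "4 dvd action x i k - ?d i k" "4 dvd action (inv x) h j - ?d h j"
          using Gamma_dvd[OF x] Gamma_dvd[OF Gamma_closures(2)[OF x]] kh True by auto
        \<comment> \<open>Entrywise form of x u y - u = (x - 1) u y + u (y - 1), with y the inverse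
          of x.\<close>
        then have "4 dvd (action x i k - ?d i k) * (u (k, h) * action (inv x) h j)
            + (?d i k * u (k, h)) * (action (inv x) h j - ?d h j)"
          by (intro dvd_add dvd_mult dvd_mult2)
        then show "4 dvd action x i k * u (k, h) * action (inv x) h j - ?d i k * u (k, h) * ?d h j"
          by (simp add: algebra_simps)
      qed
      moreover have "(\<Sum>k<m. \<Sum>h<m. ?d i k * u (k, h) * ?d h j) = u (i, j)"
        using True by (simp add: if_distrib[of "\<lambda>x. _ * x"] if_distrib[of "\<lambda>x. x * _"] cong: if_cong)
      ultimately show ?thesis using True by (simp add: s_def p sum_subtractf)
    qed (use u p in \<open>auto simp: s_def int_lattice_def\<close>)
  qed
  have "(s ^^ n) (\<tau> a) = \<tau> a"
    unfolding pow using action_eq_if_commute_mod[OF _ a c] xc by (auto simp: \<tau>_def fun_eq_iff)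
  then have "\<tau> (conjg x a) = \<tau> a"
    using congruent_id_mod4_fixed[OF s4 \<tau> n, of a] s\<tau>[OF a] by simp
  then have "action (conjg x a) i j = action a i j" if "i < m" "j < m" for i j
    using that by (auto simp: \<tau>_def dest!: fun_cong[of _ _ "(i, j)"])
  then show ?thesis by (intro commute_mod_if_action_eq xc a)
qed

end

lemma (in group) conjg_nat_pow_invariant:
  assumes "x \<in> carrier G" "A \<subseteq> carrier G" "\<And>a. a \<in> A \<Longrightarrow> conjg x a \<in> A" "a \<in> A"
  shows "conjg (x [^] (n::nat)) a \<in> A"
  using assms(4)
proof (induction n arbitrary: a)
  case 0
  then show ?case using assms(2) by (auto simp: subset_iff)
next
  case (Suc n)
  have "conjg (x [^] Suc n) a = conjg (x [^] n) (conjg x a)"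
    using assms(1,2) Suc.prems by (simp add: conjg_conj subset_iff)
  then show ?case using Suc.IH[OF assms(3)[OF Suc.prems]] by simp
qed

section \<open>Weights of families commuting modulo the Fitting subgroup, and the derived
  series\<close>

context fitting_lattice
begin

definition eigenspace :: "'a \<Rightarrow> complex \<Rightarrow> (nat \<Rightarrow> complex) set" where
  "eigenspace x c = {u \<in> coord_space m. T x u = (\<lambda>i. c * u i)}"

lemma eigenspaceD: "u \<in> eigenspace x c \<Longrightarrow> u \<in> coord_space m" "u \<in> eigenspace x c \<Longrightarrow> T x u = (\<lambda>i. c * u i)"
  by (simp_all add: eigenspace_def)

lemma T_scale: "T x (\<lambda>i. c * u i) = (\<lambda>i. c * T x u i)"
  using cfun.lin_scale[OF lin_T, of x c u] .

lemma subspace_eigenspace: "cfun.subspace (eigenspace x c)"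
proof (rule cfun.subspaceI)
  have "T x 0 = 0" by (rule cfun.lin_zero[OF lin_T])
  then show "0 \<in> eigenspace x c" by (simp add: eigenspace_def coord_space_def fun_eq_iff)
next
  fix u v assume uv: "u \<in> eigenspace x c" "v \<in> eigenspace x c"
  have "T x (u + v) = T x u + T x v" by (rule cfun.lin_add[OF lin_T])
  then have "T x (u + v) = (\<lambda>i. c * (u + v) i)"
    unfolding uv[THEN eigenspaceD(2)] by (simp add: fun_eq_iff distrib_left)
  then show "u + v \<in> eigenspace x c"
    using uv by (simp add: eigenspace_def coord_space_def)
next
  fix d u assume u: "u \<in> eigenspace x c"
  have "T x (\<lambda>i. d * u i) = (\<lambda>i. c * (d * u i))"
    unfolding T_scale eigenspaceD(2)[OF u] by (simp add: fun_eq_iff)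
  then show "(\<lambda>i. d * u i) \<in> eigenspace x c"
    using u by (simp add: eigenspace_def coord_space_def)
qed

lemma T_eigenspace:
  assumes "x \<in> carrier G" "y \<in> carrier G" "commute_mod y x" "u \<in> eigenspace x c"
  shows "T y u \<in> eigenspace x c"
proof -
  have "T x (T y u) = T y (T x u)" using commute_mod_imp[OF assms(2,1,3)] by simp
  also have "\<dots> = (\<lambda>i. c * T y u i)" unfolding eigenspaceD(2)[OF assms(4)] by (rule T_scale)
  finally show ?thesis using T_in by (simp add: eigenspace_def)
qed

definition wts :: "'a set \<Rightarrow> ('a \<Rightarrow> complex) set" where
  "wts A = cfun.weights (coord_space m) A T"

lemma finite_wts: "finite (wts A)"
  unfolding wts_def
  by (rule cfun.finite_weights[OF coord_space_subset_span finite_coord_basis]) (rule lin_T)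

lemma wts_iff:
  "\<chi> \<in> wts A \<longleftrightarrow> \<chi> \<in> A \<rightarrow>\<^sub>E UNIV \<and>
     (\<exists>u\<in>coord_space m. u \<noteq> 0 \<and> (\<forall>a\<in>A. T a u = (\<lambda>i. \<chi> a * u i)))"
  unfolding wts_def cfun.weights_def by simp

lemma exists_wt:
  assumes A: "A \<subseteq> carrier G" "\<And>a b. a \<in> A \<Longrightarrow> b \<in> A \<Longrightarrow> commute_mod a b"
    and U: "cfun.subspace U" "U \<subseteq> coord_space m" "u \<in> U" "u \<noteq> 0"
    and inv: "\<And>a u. a \<in> A \<Longrightarrow> u \<in> U \<Longrightarrow> T a u \<in> U"
  shows "\<exists>\<chi>\<in>wts A. \<exists>u\<in>U. u \<noteq> 0 \<and> (\<forall>a\<in>A. T a u = (\<lambda>i. \<chi> a * u i))"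
  unfolding wts_def
proof (rule cfun.exists_weight[OF U(1) _ finite_coord_basis _ U(2)])
  show "U \<subseteq> cfun.span (coord_basis m)" using U(2) coord_space_subset_span by (rule subset_trans)
  show "U \<noteq> {0}" using U(3,4) by blast
  show "T a ` U \<subseteq> U" if "a \<in> A" for a using inv that by blast
  show "T a (T b v) = T b (T a v)" if "a \<in> A" "b \<in> A" for a b v
    using A that by (intro commute_mod_imp) auto
qed (rule lin_T)

lemma unit_eigenvalue_of_fixed:
  assumes "(\<lambda>i. c * u i) = u" "u \<noteq> 0"
  shows "(c::complex) = 1"
proof -
  obtain j where "u j \<noteq> 0" using assms(2) by (auto simp: fun_eq_iff)
  then show ?thesis using fun_cong[OF assms(1), of j] by simp
qed

text \<open>An element normalising a family that is abelian modulo the Fitting subgroup permutes its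
  finitely many weights, so a power of it fixes all of them.\<close>

lemma normalizer_commute_mod:
  assumes x: "x \<in> \<Gamma>" and A: "A \<subseteq> carrier G" "\<And>a b. a \<in> A \<Longrightarrow> b \<in> A \<Longrightarrow> commute_mod a b"
    and norm: "\<And>a. a \<in> A \<Longrightarrow> conjg x a \<in> A" "\<And>a. a \<in> A \<Longrightarrow> conjg (inv x) a \<in> A"
    and a: "a \<in> A"
  shows "commute_mod x a"
proof -
  have xc: "x \<in> carrier G" using x by simp
  define y where "y = inv x"
  have y: "y \<in> \<Gamma>" and yc: "y \<in> carrier G" using x by (simp_all add: y_def)
  have yx: "y [^] i \<otimes> x [^] i = \<one>" "x [^] i \<otimes> y [^] i = \<one>" for i :: nat
    unfolding y_def using xc by (simp_all add: nat_pow_inv)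
  have Ac: "b \<in> carrier G" if "b \<in> A" for b using A(1) that by blast
  have normx: "conjg (x [^] i) b \<in> A" and normy: "conjg (y [^] i) b \<in> A" if "b \<in> A" for b and i :: nat
    using conjg_nat_pow_invariant[OF xc A(1) norm(1) that] conjg_nat_pow_invariant[OF yc A(1) _ that]
      norm(2) by (simp_all add: y_def)
  \<comment> \<open>The weight carried by \<open>T (x [^] i) u\<close> when \<open>u\<close> has
    weight \<open>\<chi>\<close>: moving \<open>b\<close> past \<open>x [^] i\<close> conjugates it
    by \<open>y [^] i\<close>.\<close>
  define p where "p i \<chi> = restrict (\<lambda>b. \<chi> (conjg (y [^] i) b)) A" for i :: nat and \<chi> :: "'a \<Rightarrow> complex"
  have p: "p i \<chi> \<in> wts A" if chi: "\<chi> \<in> wts A" for i \<chi>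
  proof -
    obtain u where u: "u \<in> coord_space m" "u \<noteq> 0" "\<And>b. b \<in> A \<Longrightarrow> T b u = (\<lambda>i. \<chi> b * u i)"
      using chi unfolding wts_iff by blast
    let ?u = "T (x [^] i) u"
    have "T (y [^] i) ?u = u" using T_mult[of "y [^] i" "x [^] i" u] yx xc yc u(1) by (simp add: T_fitting)
    then have "?u \<noteq> 0" using u(2) cfun.lin_zero[OF lin_T] by metis
    moreover have "T b ?u = (\<lambda>k. p i \<chi> b * ?u k)" if b: "b \<in> A" for b
    proof -
      have "b \<otimes> x [^] i = x [^] i \<otimes> conjg (y [^] i) b"
        using Ac[OF b] xc by (simp add: conjg_def y_def nat_pow_inv m_assoc)
      then have "T b ?u = T (x [^] i) (T (conjg (y [^] i) b) u)"
        using T_mult[of b "x [^] i" u] T_mult[of "x [^] i" "conjg (y [^] i) b" u] Ac[OF b] xc yc by simp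
      also have "\<dots> = (\<lambda>k. \<chi> (conjg (y [^] i) b) * ?u k)" using u(3) normy[OF b] by (simp add: T_scale)
      finally show ?thesis using b by (simp add: p_def)
    qed
    ultimately show ?thesis unfolding wts_iff using T_in by (auto simp: p_def)
  qed
  \<comment> \<open>Restricted to the finite set \<open>wts A\<close>, the maps \<open>p i\<close>
    take only finitely many values; two equal ones at \<open>i < j\<close> give the power
    \<open>n = j - i\<close>.\<close>
  define f where "f i = restrict (p i) (wts A)" for i
  have "range f \<subseteq> wts A \<rightarrow>\<^sub>E wts A" using p by (auto simp: f_def)
  then have "finite (range f)" by (rule finite_subset) (intro finite_PiE finite_wts)
  then have "\<not> inj f" using range_inj_infinite by blast
  then obtain i0 j0 where ij0: "f i0 = f j0" "i0 \<noteq> j0" unfolding inj_def by blast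
  define i where "i = min i0 j0"
  define j where "j = max i0 j0"
  have ij: "i < j" "f i = f j" using ij0 by (auto simp: i_def j_def min_def max_def)
  define n where "n = j - i"
  have n: "n > 0" "j = n + i" using ij(1) by (auto simp: n_def)
  have fix_a: "\<chi> (conjg (y [^] n) b) = \<chi> b" if chi: "\<chi> \<in> wts A" and b: "b \<in> A" for \<chi> b
  proof -
    let ?b = "conjg (x [^] i) b"
    have bA: "?b \<in> A" using normx[OF b] .
    have "p i \<chi> ?b = p j \<chi> ?b" using fun_cong[OF ij(2), of \<chi>] chi by (simp add: f_def)
    then have "\<chi> (conjg (y [^] i) ?b) = \<chi> (conjg (y [^] j) ?b)" using bA by (simp add: p_def)
    moreover have "conjg (y [^] i) ?b = b" using yx xc yc Ac[OF b] by (simp add: conjg_conj)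
    moreover have "y [^] j \<otimes> x [^] i = y [^] n"
      using yx(1)[of i] xc yc by (simp add: n(2) m_assoc flip: nat_pow_mult)
    then have "conjg (y [^] j) ?b = conjg (y [^] n) b" using xc yc Ac[OF b] by (simp add: conjg_conj)
    ultimately show ?thesis by simp
  qed
  let ?a = "conjg (y [^] n) a"
  let ?b = "?a \<otimes> inv a"
  have ac: "a \<in> carrier G" "?a \<in> carrier G" "?b \<in> carrier G" using Ac[OF a] yc by simp_all
  have comm_b: "commute_mod a' ?b" if "a' \<in> A" for a'
    using that Ac ac A(2) a normy[OF a] by (intro commute_mod_mult commute_mod_inv) auto
  have "?b \<in> fitting"
  proof (rule unipotent_in_fitting[OF ac(3)])
    \<comment> \<open>The eigenspace of \<open>?b\<close> for \<open>c\<close> is invariant under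
      \<open>A\<close>, so it contains a joint eigenvector \<open>w\<close>; the weight of
      \<open>w\<close> does not distinguish \<open>?a\<close> from \<open>a\<close>.\<close>
    fix u c assume u: "u \<in> coord_space m" "u \<noteq> 0" "T ?b u = (\<lambda>i. c * u i)"
    have "\<exists>\<chi>\<in>wts A. \<exists>u\<in>eigenspace ?b c. u \<noteq> 0 \<and> (\<forall>a\<in>A. T a u = (\<lambda>i. \<chi> a * u i))"
    proof (rule exists_wt[OF A subspace_eigenspace])
      show "eigenspace ?b c \<subseteq> coord_space m" using eigenspaceD(1) by blast
      show "u \<in> eigenspace ?b c" using u by (simp add: eigenspace_def)
      show "T a' v \<in> eigenspace ?b c" if "a' \<in> A" "v \<in> eigenspace ?b c" for a' v
        using T_eigenspace[OF ac(3) Ac[OF that(1)] comm_b[OF that(1)] that(2)] .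
    qed (use u(2) in simp_all)
    then obtain \<chi> w where w: "\<chi> \<in> wts A" "w \<in> eigenspace ?b c" "w \<noteq> 0" "\<And>a. a \<in> A \<Longrightarrow> T a w = (\<lambda>i. \<chi> a * w i)"
      by blast
    note wc = eigenspaceD[OF w(2)]
    \<comment> \<open>\<open>?b\<close> may lie outside \<open>A\<close>, where
      \<open>\<chi>\<close> carries no information; the detour \<open>?b \<otimes> a = ?a\<close>
      uses only values on \<open>A\<close>.\<close>
    have "T ?b (T a w) = T ?a w"
      using T_mult[OF ac(3,1), of w] ac by (simp add: m_assoc)
    also have "\<dots> = T a w" using w(4) normy[OF a] a fix_a[OF w(1) a] by simp
    finally have fixTa: "T ?b (T a w) = T a w" .
    have "T ?b (T a w) = (\<lambda>i. c * T a w i)"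
      unfolding w(4)[OF a] T_scale wc(2) by (simp add: fun_eq_iff)
    then have "(\<lambda>i. c * T a w i) = T a w" using fixTa by simp
    moreover have "T a w \<noteq> 0"
    proof
      assume "T a w = 0"
      moreover have "T (inv a) (T a w) = w" using T_mult[of "inv a" a w] ac wc(1) by (simp add: T_fitting)
      ultimately show False using w(3) cfun.lin_zero[OF lin_T, of "inv a"] by simp
    qed
    ultimately show "c = 1" by (rule unit_eigenvalue_of_fixed)
  qed
  then have "commute_mod (y [^] n) a" by (simp add: commute_mod_def)
  then have "commute_mod y a" using commute_mod_if_pow_commute_mod[OF y ac(1) n(1)] by blast
  then have "commute_mod a (inv y)" using commute_mod_inv commute_mod_sym ac(1) yc by blast
  then show ?thesis using commute_mod_sym[OF ac(1) xc] xc by (simp add: y_def)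
qed

text \<open>The derived series of \<open>\<Gamma>\<close> reaches the Fitting subgroup after one step: if its last term outside
  is \<open>D (Suc i)\<close>, that term is abelian modulo \<open>fitting\<close>, hence central in \<open>\<Gamma>\<close> modulo \<open>fitting\<close>; then the
  cosets \<open>D (Suc i) y\<close> with \<open>y \<in> D i\<close> are commutative modulo \<open>fitting\<close> as well and normalised by \<open>D i\<close>.\<close>

lemma Gamma_commute_mod:
  assumes x: "x \<in> \<Gamma>" and y: "y \<in> \<Gamma>"
  shows "commute_mod x y"
proof -
  define D where "D i = (derived G ^^ i) \<Gamma>" for i
  have Dn: "D i \<lhd> G" for i
    unfolding D_def by (induction i) (use Gamma_normal derived_is_normal in auto)
  have DSuc: "D (Suc i) = derived G (D i)" for i by (simp add: D_def)
  have Dc: "D i \<subseteq> carrier G" for i using Dn[of i] by (simp add: normal_def subgroup.subset)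
  have Dsub: "D (Suc i) \<subseteq> D i" for i
    unfolding DSuc using derived_incl[of "D i" "D i"] Dn by (simp add: normal_def)
  have DG: "D i \<subseteq> \<Gamma>" for i
    by (induction i) (use Dsub in \<open>auto simp: D_def\<close>)
  have Dconj: "conjg z d \<in> D i" if "z \<in> carrier G" "d \<in> D i" for z d i
    using Dn[of i] that by (simp add: normal_inv_iff conjg_def)
  have comm_in: "conjg a b \<otimes> inv b \<in> D (Suc i)" if "a \<in> D i" "b \<in> D i" for a b i
    unfolding DSuc derived_def conjg_def by (rule generate.incl) (use that in auto)
  have derived_le: "D (Suc i) \<subseteq> fitting" if "\<And>a b. a \<in> D i \<Longrightarrow> b \<in> D i \<Longrightarrow> commute_mod a b" for i
    unfolding DSuc derived_def
    by (rule generate_subgroup_incl[OF _ fitting_subgroup]) (use that in \<open>auto simp: commute_mod_def conjg_def\<close>)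
  obtain n where "(derived G ^^ n) (carrier G) = {\<one>}"
    using solvable solvable_iff_trivial_derived_seq by blast
  moreover have "\<Gamma> \<subseteq> carrier G" by auto
  ultimately have "D n \<subseteq> {\<one>}" unfolding D_def using mono_exp_of_derived by metis
  then have "D (Suc n) \<subseteq> fitting" using Dsub[of n] fitting_closures(1) by blast
  moreover have "D (Suc i) \<subseteq> fitting" if step: "D (Suc (Suc i)) \<subseteq> fitting" for i
  proof (rule derived_le)
    fix z y assume z: "z \<in> D i" and y: "y \<in> D i"
    have zG: "z \<in> \<Gamma>" and yG: "y \<in> \<Gamma>" using z y DG by auto
    have zc: "z \<in> carrier G" and yc: "y \<in> carrier G" using zG yG by simp_all
    let ?A = "D (Suc i)"
    have Acar: "a \<in> carrier G" if "a \<in> ?A" for a using Dc that by blast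
    have AA: "commute_mod a b" if "a \<in> ?A" "b \<in> ?A" for a b
      unfolding commute_mod_def using comm_in[OF that] step by blast
    have central: "commute_mod w a" if "w \<in> \<Gamma>" "a \<in> ?A" for w a
      by (rule normalizer_commute_mod[OF that(1) Dc AA _ _ that(2)])
        (use that(1) Dconj in simp_all)
    \<comment> \<open>\<open>y\<close> alone is not normalised by \<open>D i\<close>, and
      \<open>D i\<close> is not yet known to commute modulo \<open>fitting\<close>. The coset of
      \<open>y\<close> lies in between: conjugating \<open>y\<close> by \<open>w\<close> changes it
      by a commutator, an element of \<open>?A\<close>. This is why
      \<open>normalizer_commute_mod\<close> is stated for subsets.\<close>
    let ?A' = "(\<lambda>c. c \<otimes> y) ` ?A"
    have one: "\<one> \<in> ?A" using Dn[of "Suc i"] by (simp add: normal_def subgroup.one_closed)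
    have closed: "a \<otimes> b \<in> ?A" if "a \<in> ?A" "b \<in> ?A" for a b
      using Dn[of "Suc i"] that by (simp add: normal_def subgroup.m_closed)
    have conj_closed: "conjg w a \<in> ?A'" if w: "w \<in> D i" and aA: "a \<in> ?A'" for w a
    proof -
      obtain c where c: "c \<in> ?A" "a = c \<otimes> y" using aA by blast
      have wc: "w \<in> carrier G" using w Dc by blast
      have "conjg w a = (conjg w c \<otimes> (conjg w y \<otimes> inv y)) \<otimes> y"
        using c wc yc Acar by (simp add: conjg_mult m_assoc)
      moreover have "conjg w c \<otimes> (conjg w y \<otimes> inv y) \<in> ?A"
        using closed Dconj[OF wc c(1)] comm_in[OF w y] by blast
      ultimately show ?thesis by blast
    qed
    have "commute_mod z (\<one> \<otimes> y)"
    proof (rule normalizer_commute_mod[OF zG, of ?A'])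
      show "?A' \<subseteq> carrier G" using Acar yc by auto
      show "commute_mod a b" if "a \<in> ?A'" "b \<in> ?A'" for a b
      proof -
        obtain c d where cd: "c \<in> ?A" "d \<in> ?A" "a = c \<otimes> y" "b = d \<otimes> y" using \<open>a \<in> ?A'\<close> \<open>b \<in> ?A'\<close> by blast
        have cdc: "c \<in> carrier G" "d \<in> carrier G" using cd Acar by auto
        have cG: "c \<in> \<Gamma>" "d \<in> \<Gamma>" using cd DG by blast+
        have yy: "commute_mod y y" using yc by (simp add: commute_mod_def conjg_def m_assoc)
        have "commute_mod (c \<otimes> y) d" using central[of "c \<otimes> y" d] cG yG cd by simp
        moreover have "commute_mod y (c \<otimes> y)"
          using commute_mod_mult[OF yc cdc(1) yc central[OF yG cd(1)] yy] .
        then have "commute_mod (c \<otimes> y) y" using commute_mod_sym yc cdc by simp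
        ultimately show ?thesis using commute_mod_mult[of "c \<otimes> y" d y] cd cdc yc by simp
      qed
      show "conjg z a \<in> ?A'" if "a \<in> ?A'" for a by (rule conj_closed[OF z that])
      have "inv z \<in> D i" using z Dn[of i] by (simp add: normal_def subgroup.m_inv_closed)
      then show "conjg (inv z) a \<in> ?A'" if "a \<in> ?A'" for a using conj_closed that by blast
      show "\<one> \<otimes> y \<in> ?A'" using one by blast
    qed
    then show "commute_mod z y" using yc by simp
  qed
  ultimately have D1: "D (Suc 0) \<subseteq> fitting"
    by (induction n) auto
  show ?thesis
    unfolding commute_mod_def using comm_in[of x 0 y] D1 x y by (auto simp: D_def)
qed

end

section \<open>Finite generation of the quotient by the Fitting subgroup\<close>

text \<open>An added zero row makes the system of \<open>m\<close> equations in \<open>m + 1\<close>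
  unknowns square with determinant 0, and the kernel vector is then integral.\<close>

lemma exists_integer_relation:
  fixes w :: "nat \<Rightarrow> nat \<Rightarrow> int"
  shows "\<exists>c. (\<exists>k\<le>m. c k \<noteq> 0) \<and> (\<forall>i<m. (\<Sum>k\<le>m. c k * w k i) = 0)"
proof -
  define A where "A = mat (Suc m) (Suc m) (\<lambda>(i, k). if i < m then w k i else 0)"
  have A: "A \<in> carrier_mat (Suc m) (Suc m)" by (simp add: A_def)
  have "det A = 0"
  proof -
    have "A = mat\<^sub>r (Suc m) (Suc m) (\<lambda>i. if i = m then 0\<^sub>v (Suc m) else row A i)"
      by (rule eq_matI) (auto simp: A_def)
    moreover have "det (mat\<^sub>r (Suc m) (Suc m) (\<lambda>i. if i = m then 0\<^sub>v (Suc m) else row A i)) = 0"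
      by (rule det_row_0) (auto simp: A_def)
    ultimately show ?thesis by simp
  qed
  then obtain v where v: "v \<in> carrier_vec (Suc m)" "v \<noteq> 0\<^sub>v (Suc m)" "A *\<^sub>v v = 0\<^sub>v (Suc m)"
    using det_0_iff_vec_prod_zero[OF A] by blast
  have "\<exists>k\<le>m. v $ k \<noteq> 0"
  proof (rule ccontr)
    assume "\<not> ?thesis"
    then have "v = 0\<^sub>v (Suc m)" using v(1) by (intro eq_vecI) auto
    then show False using v(2) by simp
  qed
  moreover have "(\<Sum>k\<le>m. v $ k * w k i) = 0" if i: "i < m" for i
  proof -
    have "(\<Sum>k\<le>m. v $ k * w k i) = (A *\<^sub>v v) $ i"
      using i v(1) by (simp add: A_def scalar_prod_def atLeast0LessThan lessThan_Suc_atMost mult.commute)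
    then show ?thesis using v(3) i by simp
  qed
  ultimately show ?thesis by blast
qed

section \<open>Weights of the congruence subgroup and generic elements\<close>

context fitting_lattice
begin

lemma wtsE:
  assumes "\<chi> \<in> wts A"
  obtains u j where "u \<in> coord_space m" "u \<noteq> 0" "u j \<noteq> 0" "\<And>a. a \<in> A \<Longrightarrow> T a u = (\<lambda>i. \<chi> a * u i)"
proof -
  obtain u where u: "u \<in> coord_space m" "u \<noteq> 0" "\<And>a. a \<in> A \<Longrightarrow> T a u = (\<lambda>i. \<chi> a * u i)"
    using assms unfolding wts_iff by blast
  moreover obtain j where "u j \<noteq> 0" using u(2) by (auto simp: fun_eq_iff)
  ultimately show ?thesis using that by blast
qed

lemma wts_mult:
  assumes chi: "\<chi> \<in> wts \<Gamma>" and xy: "x \<in> \<Gamma>" "y \<in> \<Gamma>"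
  shows "\<chi> (x \<otimes> y) = \<chi> x * \<chi> y"
proof -
  obtain u j where u: "u j \<noteq> 0" "\<And>a. a \<in> \<Gamma> \<Longrightarrow> T a u = (\<lambda>i. \<chi> a * u i)"
    using wtsE[OF chi] by metis
  have "T (x \<otimes> y) u = T x (T y u)" using xy by (simp add: T_mult)
  also have "\<dots> = (\<lambda>i. \<chi> y * (\<chi> x * u i))" unfolding u(2)[OF xy(2)] T_scale u(2)[OF xy(1)] ..
  finally have "(\<lambda>i. \<chi> (x \<otimes> y) * u i) = (\<lambda>i. \<chi> y * (\<chi> x * u i))"
    using u(2)[OF Gamma_closures(1)[OF xy]] by simp
  from fun_cong[OF this, of j] show ?thesis using u(1) by simp
qed

lemma wts_nat_pow:
  assumes chi: "\<chi> \<in> wts \<Gamma>" and x: "x \<in> \<Gamma>"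
  shows "\<chi> (x [^] (n::nat)) = \<chi> x ^ n"
proof -
  obtain u j where u: "u \<in> coord_space m" "u j \<noteq> 0" "\<And>a. a \<in> \<Gamma> \<Longrightarrow> T a u = (\<lambda>i. \<chi> a * u i)"
    using wtsE[OF chi] by metis
  have "(\<lambda>i. \<chi> (x [^] n) * u i) = (\<lambda>i. \<chi> x ^ n * u i)"
    using T_nat_pow[OF Gamma_closed[OF x] u(1) u(3)[OF x], of n] u(3)[OF Gamma_nat_pow[OF x]] by simp
  from fun_cong[OF this, of j] show ?thesis using u(2) by simp
qed

lemma wts_root_of_unity:
  assumes chi: "\<chi> \<in> wts \<Gamma>" and x: "x \<in> \<Gamma>" and n: "n > 0" "\<chi> x ^ n = 1"
  shows "\<chi> x = 1"
proof -
  obtain u where u: "u \<in> coord_space m" "u \<noteq> 0" "\<And>a. a \<in> \<Gamma> \<Longrightarrow> T a u = (\<lambda>i. \<chi> a * u i)"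
    using wtsE[OF chi] by metis
  show ?thesis using Gamma_root_of_unity_eigenvalue[OF x u(1,2) u(3)[OF x] n] .
qed

text \<open>If some weight trivial at \<open>g\<close> were nontrivial at \<open>x\<close>, then for suitable \<open>n\<close> fewer weights
  would be trivial at \<open>x \<otimes> g\<^sup>n\<close>.\<close>

lemma exists_generic_element:
  "\<exists>g\<in>\<Gamma>. \<forall>\<chi>\<in>wts \<Gamma>. \<chi> g = 1 \<longrightarrow> (\<forall>x\<in>\<Gamma>. \<chi> x = 1)"
proof -
  define X where "X = wts \<Gamma>"
  have finX: "finite X" unfolding X_def by (rule finite_wts)
  define N where "N g = card {\<chi> \<in> X. \<chi> g = 1}" for g
  have "\<one> \<in> \<Gamma>" by simp
  then obtain g where g: "g \<in> \<Gamma>" and min: "\<And>x. x \<in> \<Gamma> \<Longrightarrow> N g \<le> N x"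
    using ex_has_least_nat[of "\<lambda>x. x \<in> \<Gamma>" \<one> N] by blast
  have "\<chi>0 x = 1" if chi0: "\<chi>0 \<in> X" "\<chi>0 g = 1" and x: "x \<in> \<Gamma>" for \<chi>0 x
  proof (rule ccontr)
    assume nt: "\<chi>0 x \<noteq> 1"
    have nz: "\<chi> y \<noteq> 0" if "\<chi> \<in> X" "y \<in> \<Gamma>" for \<chi> y
    proof -
      have "\<chi> (inv y) * \<chi> y = \<chi> \<one>" using wts_mult[of \<chi> "inv y" y] that by (simp add: X_def)
      moreover have "\<chi> \<one> = 1" using wts_nat_pow[of \<chi> y 0] that by (simp add: X_def)
      ultimately show ?thesis by auto
    qed
    \<comment> \<open>Two solutions \<open>n\<close> would make \<open>\<chi> g\<close> a root of
      unity, hence 1. So each weight nontrivial at \<open>g\<close> excludes at most one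
      \<open>n\<close>, and some \<open>n\<close> avoids them all.\<close>
    have bad: "finite {n. \<chi> x * \<chi> g ^ n = 1}" if chi: "\<chi> \<in> X" "\<chi> g \<noteq> 1" for \<chi>
    proof -
      have "a = b" if ab: "\<chi> x * \<chi> g ^ a = 1" "\<chi> x * \<chi> g ^ b = 1" "a \<le> b" for a b
      proof (rule ccontr)
        assume "a \<noteq> b"
        then have pos: "b - a > 0" using ab(3) by simp
        have "\<chi> g ^ b = \<chi> g ^ a * \<chi> g ^ (b - a)" using ab(3) by (simp flip: power_add)
        moreover have "\<chi> g ^ a = \<chi> g ^ b" using ab(1,2) nz[OF chi(1) x] by (metis mult_left_cancel)
        ultimately have "\<chi> g ^ (b - a) = 1" using nz[OF chi(1) g] by simp
        then show False using wts_root_of_unity[OF _ g pos] chi by (simp add: X_def)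
      qed
      then have "a = b" if "\<chi> x * \<chi> g ^ a = 1" "\<chi> x * \<chi> g ^ b = 1" for a b
        using that by (metis nat_le_linear)
      then have "{n. \<chi> x * \<chi> g ^ n = 1} \<subseteq> {THE n. \<chi> x * \<chi> g ^ n = 1}"
        by (auto intro!: the_equality[symmetric])
      then show ?thesis using finite_subset by blast
    qed
    have "finite (\<Union>\<chi>\<in>{\<chi>\<in>X. \<chi> g \<noteq> 1}. {n. \<chi> x * \<chi> g ^ n = 1})"
      using finX bad by simp
    then obtain n where n: "n \<notin> (\<Union>\<chi>\<in>{\<chi>\<in>X. \<chi> g \<noteq> 1}. {n. \<chi> x * \<chi> g ^ n = 1})"
      using ex_new_if_finite infinite_UNIV_nat by blast
    let ?y = "x \<otimes> g [^] n"
    have y: "\<chi> ?y = \<chi> x * \<chi> g ^ n" if "\<chi> \<in> X" for \<chi>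
      using that x g wts_mult[of \<chi> x "g [^] n"] wts_nat_pow[of \<chi> g n] by (simp add: X_def)
    have "{\<chi> \<in> X. \<chi> ?y = 1} \<subset> {\<chi> \<in> X. \<chi> g = 1}"
    proof
      show "{\<chi> \<in> X. \<chi> ?y = 1} \<subseteq> {\<chi> \<in> X. \<chi> g = 1}" using n y by auto
      have "\<chi>0 \<notin> {\<chi> \<in> X. \<chi> ?y = 1}" using y[OF chi0(1)] chi0(2) nt by simp
      then show "{\<chi> \<in> X. \<chi> ?y = 1} \<noteq> {\<chi> \<in> X. \<chi> g = 1}" using chi0 by blast
    qed
    then have "N ?y < N g" unfolding N_def by (intro psubset_card_mono) (use finX in auto)
    then show False using min[of ?y] x g by simp
  qed
  then show ?thesis using g unfolding X_def by blast
qed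

text \<open>\<open>cvec f\<close> lies in the eigenspace of \<open>g\<close> for 1, which
  \<open>x\<close> preserves. Any eigenvalue of \<open>x\<close> there is attained by some weight
  trivial at \<open>g\<close>; genericity makes that weight trivial at \<open>x\<close> too, so
  \<open>x\<close> is unipotent on this eigenspace.\<close>

lemma generic_centralizer_central:
  assumes g: "g \<in> \<Gamma>" "\<forall>\<chi>\<in>wts \<Gamma>. \<chi> g = 1 \<longrightarrow> (\<forall>x\<in>\<Gamma>. \<chi> x = 1)"
    and f: "f \<in> fitting" "commute g f" and x: "x \<in> \<Gamma>"
  shows "commute x f"
proof (rule unipotent_on_subspace[OF _ subspace_eigenspace[of g 1] _ _ _ f(1)])
  have gc: "g \<in> carrier G" and xc: "x \<in> carrier G" using g x by simp_all
  show "x \<in> carrier G" by fact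
  show "eigenspace g 1 \<subseteq> coord_space m" using eigenspaceD(1) by blast
  show "T x ` eigenspace g 1 \<subseteq> eigenspace g 1"
    using T_eigenspace[OF gc xc Gamma_commute_mod[OF x g(1)]] by blast
  have "conjg g f = f" using gc f by (simp add: conjg_eq_self_iff)
  then show "cvec f \<in> eigenspace g 1"
    unfolding eigenspace_def using T_cvec[OF gc f(1)] cvec_in[OF f(1)] by simp
  fix u c assume u: "u \<in> eigenspace g 1" "u \<noteq> 0" "T x u = (\<lambda>i. c * u i)"
  let ?U = "eigenspace g 1 \<inter> eigenspace x c"
  have "\<exists>\<chi>\<in>wts \<Gamma>. \<exists>u\<in>?U. u \<noteq> 0 \<and> (\<forall>a\<in>\<Gamma>. T a u = (\<lambda>i. \<chi> a * u i))"
  proof (rule exists_wt)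
    show "cfun.subspace ?U" by (intro cfun.subspace_inter subspace_eigenspace)
    show "?U \<subseteq> coord_space m" using eigenspaceD(1) by blast
    show "u \<in> ?U" using u eigenspaceD(1)[OF u(1)] by (simp add: eigenspace_def)
    show "T a v \<in> ?U" if "a \<in> \<Gamma>" "v \<in> ?U" for a v
      using that T_eigenspace[OF gc _ Gamma_commute_mod[OF that(1) g(1)]]
        T_eigenspace[OF xc _ Gamma_commute_mod[OF that(1) x]] by simp
  qed (use u(2) Gamma_commute_mod in auto)
  then obtain \<chi> w where w: "\<chi> \<in> wts \<Gamma>" "w \<in> ?U" "w \<noteq> 0" "\<And>a. a \<in> \<Gamma> \<Longrightarrow> T a w = (\<lambda>i. \<chi> a * w i)"
    by blast
  have "(\<lambda>i. \<chi> g * w i) = w" using w(4)[OF g(1)] eigenspaceD(2)[of w g 1] w(2) by simp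
  then have "\<chi> g = 1" using w(3) by (rule unit_eigenvalue_of_fixed)
  then have "\<chi> x = 1" using g(2) w(1) x by blast
  then have "T x w = w" using w(4)[OF x] by simp
  then have "(\<lambda>i. c * w i) = w" using eigenspaceD(2)[of w x c] w(2) by simp
  then show "c = 1" using w(3) by (rule unit_eigenvalue_of_fixed)
qed

section \<open>The image and the kernel of the commutator map of one element\<close>

lemma psi_comm:
  assumes "g \<in> carrier G" "f \<in> fitting"
  shows "\<psi> (comm g f) i = \<psi> f i - (\<Sum>j<m. action g i j * \<psi> f j)"
  using assms by (simp add: comm_def psi_mult psi_inv psi_conjg)

lemma comm_mult:
  assumes "g \<in> carrier G" "f \<in> fitting" "f' \<in> fitting"
  shows "comm g (f \<otimes> f') = comm g f \<otimes> comm g f'"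
  by (rule psi_inj)
    (use assms in \<open>simp_all add: comm_in psi_mult fun_eq_iff psi_comm sum.distrib algebra_simps\<close>)

lemma exists_fitting:
  assumes "\<And>i. i \<ge> m \<Longrightarrow> v i = 0"
  shows "\<exists>f\<in>fitting. \<psi> f = v"
proof -
  have "v \<in> carrier (Zn m)" using assms by (simp add: Zn_def)
  then have "v \<in> \<psi> ` fitting" using psi_bij by (simp add: bij_betw_def)
  then show ?thesis by blast
qed

lemma psi_int_pow: "f \<in> fitting \<Longrightarrow> \<psi> (f [^] (n::int)) i = n * \<psi> f i"
  by (rule additive_int_pow) (simp_all add: psi_mult)

text \<open>Additively, the image plus the kernel of 1 - g on the Fitting subgroup.
  \<open>uniform_comm_ker_power\<close> shows that the quotient by it has finite exponent.\<close>

definition comm_ker :: "'a \<Rightarrow> 'a set" where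
  "comm_ker g = {x. \<exists>f k. f \<in> fitting \<and> k \<in> fitting \<and> commute g k \<and> x = comm g f \<otimes> k}"

lemma comm_kerI:
  "f \<in> fitting \<Longrightarrow> k \<in> fitting \<Longrightarrow> commute g k \<Longrightarrow> comm g f \<otimes> k \<in> comm_ker g"
  unfolding comm_ker_def by blast

text \<open>Take an integer relation between the iterates of \<open>comm g\<close> on \<open>f\<close>, whose lowest term has
  exponent \<open>j\<close>. Since the kernels of \<open>comm g\<close> and of its powers agree, \<open>(comm g)\<^sup>j\<close> can be cancelled up to
  an element commuting with \<open>g\<close>.\<close>

lemma comm_ker_power:
  assumes g: "g \<in> carrier G" and f: "f \<in> fitting"
  shows "\<exists>d::int. d \<noteq> 0 \<and> f [^] d \<in> comm_ker g"
proof -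
  define D where "D v = (\<lambda>i. v i - (if i < m then \<Sum>j<m. action g i j * v j else 0))" for v :: "nat \<Rightarrow> int"
  have psiD: "\<psi> (comm g h) = D (\<psi> h)" if "h \<in> fitting" for h
  proof
    fix i
    show "\<psi> (comm g h) i = D (\<psi> h) i"
      using psi_comm[OF g that, of i] psi_supp[OF comm_in[OF g that], of i] psi_supp[OF that, of i]
      by (auto simp: D_def)
  qed
  have cpow: "(comm g ^^ k) h \<in> fitting \<and> \<psi> ((comm g ^^ k) h) = (D ^^ k) (\<psi> h)" if "h \<in> fitting" for h k
    by (induction k) (use that psiD comm_in[OF g] in auto)
  have Dsum: "D (\<lambda>i. \<Sum>k\<in>A. c k * w k i) = (\<lambda>i. \<Sum>k\<in>A. c k * D (w k) i)" if "finite A" for A :: "nat set" and c w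
  proof
    fix i
    have "(\<Sum>j<m. action g i j * (\<Sum>k\<in>A. c k * w k j)) = (\<Sum>j<m. \<Sum>k\<in>A. c k * (action g i j * w k j))"
      by (simp add: sum_distrib_left algebra_simps)
    also have "\<dots> = (\<Sum>k\<in>A. \<Sum>j<m. c k * (action g i j * w k j))" by (rule sum.swap)
    also have "\<dots> = (\<Sum>k\<in>A. c k * (\<Sum>j<m. action g i j * w k j))" by (simp add: sum_distrib_left)
    finally show "D (\<lambda>i. \<Sum>k\<in>A. c k * w k i) i = (\<Sum>k\<in>A. c k * D (w k) i)"
      by (auto simp: D_def sum_subtractf right_diff_distrib)
  qed
  have Dpow_sum: "(D ^^ n) (\<lambda>i. \<Sum>k\<in>A. c k * w k i) = (\<lambda>i. \<Sum>k\<in>A. c k * (D ^^ n) (w k) i)"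
    if "finite A" for A :: "nat set" and c w n
    by (induction n) (simp_all add: Dsum[OF that])
  let ?w = "\<lambda>k. (D ^^ k) (\<psi> f)"
  have wsupp: "?w k i = 0" if "i \<ge> m" for k i using cpow[OF f, of k] psi_supp that by metis
  obtain c where c: "\<exists>k\<le>m. c k \<noteq> 0" "\<forall>i<m. (\<Sum>k\<le>m. c k * ?w k i) = 0"
    using exists_integer_relation[of m ?w] by blast
  define j where "j = (LEAST k. c k \<noteq> 0)"
  have j: "c j \<noteq> 0" "j \<le> m" and less_j: "\<And>k. k < j \<Longrightarrow> c k = 0"
    using c(1) LeastI_ex[of "\<lambda>k. c k \<noteq> 0"] Least_le[of "\<lambda>k. c k \<noteq> 0"] not_less_Least[of _ "\<lambda>k. c k \<noteq> 0"]
    unfolding j_def by (blast, meson order_trans, blast)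
  \<comment> \<open>\<open>q\<close> is the relation with all exponents lowered by \<open>j\<close>,
    and \<open>q'\<close> the part above its lowest term with exponents lowered by
    \<open>Suc j\<close>. Hence \<open>(D ^^ j) q = 0\<close> and
    \<open>q = c j * \<psi> f + D q'\<close>; moving \<open>D q'\<close> to the other side accounts
    for \<open>inv p'\<close> below.\<close>
  define q where "q = (\<lambda>i. \<Sum>k\<in>{j..m}. c k * ?w (k - j) i)"
  define q' where "q' = (\<lambda>i. \<Sum>k\<in>{Suc j..m}. c k * ?w (k - Suc j) i)"
  obtain p where p: "p \<in> fitting" "\<psi> p = q"
    using exists_fitting[of q] wsupp by (auto simp: q_def)
  obtain p' where p': "p' \<in> fitting" "\<psi> p' = q'"
    using exists_fitting[of q'] wsupp by (auto simp: q'_def)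
  have "(D ^^ j) q = (\<lambda>i. \<Sum>k\<in>{j..m}. c k * ?w k i)"
    unfolding q_def
    by (subst Dpow_sum) (auto intro!: sum.cong simp flip: funpow_add comp_apply[of "D ^^ _" "D ^^ _"])
  also have "\<dots> = 0"
  proof
    fix i
    have "(\<Sum>k\<in>{j..m}. c k * ?w k i) = (\<Sum>k\<le>m. c k * ?w k i)"
      by (rule sum.mono_neutral_left) (auto simp: less_j)
    then show "(\<Sum>k\<in>{j..m}. c k * ?w k i) = 0 i"
      using c(2) wsupp by (cases "i < m") simp_all
  qed
  finally have "\<psi> ((comm g ^^ j) p) = \<psi> \<one>" using cpow[OF p(1), of j] p(2) by (simp add: psi_one)
  then have "(comm g ^^ j) p = \<one>" using cpow[OF p(1), of j] by (intro psi_inj) simp_all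
  then have gp: "commute g p" by (rule comm_funpow_one[OF g p(1)])
  have "D q' = (\<lambda>i. \<Sum>k\<in>{Suc j..m}. c k * ?w (k - j) i)"
    unfolding q'_def
    by (subst Dsum) (auto intro!: sum.cong simp: Suc_diff_Suc simp flip: comp_apply[of D] funpow.simps(2))
  then have q_eq: "q i = c j * \<psi> f i + D q' i" for i
    unfolding q_def using j(2) by (simp add: sum.atLeast_Suc_atMost)
  have "f [^] c j = comm g (inv p') \<otimes> p"
  proof (rule psi_inj)
    have "\<psi> (comm g (inv p')) i = - \<psi> (comm g p') i" for i
      using p'(1) g by (simp add: psi_comm psi_inv sum_negf)
    then show "\<psi> (f [^] c j) = \<psi> (comm g (inv p') \<otimes> p)"
      using p p' f g q_eq by (simp add: psi_mult psi_int_pow comm_in psiD fun_eq_iff)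
  qed (use f p p' g comm_in in simp_all)
  then have "f [^] c j \<in> comm_ker g"
    using comm_kerI[of "inv p'" p g] p(1) p'(1) gp by simp
  then show ?thesis using j(1) by blast
qed

lemma comm_ker_subset: "g \<in> carrier G \<Longrightarrow> comm_ker g \<subseteq> fitting"
  by (auto simp: comm_ker_def comm_in)

lemma comm_ker_subgroup:
  assumes g: "g \<in> carrier G"
  shows "subgroup (comm_ker g) G"
proof (rule subgroupI)
  show "comm_ker g \<subseteq> carrier G" using comm_ker_subset[OF g] by auto
  have "comm g \<one> = \<one>" using g by (simp add: comm_def)
  then have "\<one> \<in> comm_ker g" using comm_kerI[of \<one> \<one> g] g by simp
  then show "comm_ker g \<noteq> {}" by blast
next
  fix x assume "x \<in> comm_ker g"
  then obtain f k where fk: "f \<in> fitting" "k \<in> fitting" "commute g k" "x = comm g f \<otimes> k"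
    unfolding comm_ker_def by blast
  have "comm g f \<otimes> comm g (inv f) = \<one>"
    using comm_mult[of g f "inv f"] fk g by (simp add: comm_def)
  then have "comm g (inv f) = inv (comm g f)"
    using fk g by (metis comm_in fitting_closed fitting_closures(3) inv_equality inv_inv inv_closed)
  then have "inv x = comm g (inv f) \<otimes> inv k"
    using fk comm_in[OF g fk(1)] fitting_commute[of "inv k" "inv (comm g f)"] by (simp add: inv_mult_group)
  moreover have "commute g (inv k)" using commute_inv fk g by simp
  ultimately show "inv x \<in> comm_ker g"
    using comm_kerI[of "inv f" "inv k" g] fk by simp
next
  fix x y assume "x \<in> comm_ker g" "y \<in> comm_ker g"
  then obtain f k f' k' where fk: "f \<in> fitting" "k \<in> fitting" "commute g k" "x = comm g f \<otimes> k"
    "f' \<in> fitting" "k' \<in> fitting" "commute g k'" "y = comm g f' \<otimes> k'"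
    unfolding comm_ker_def by blast
  have "x \<otimes> y = comm g f \<otimes> (k \<otimes> comm g f') \<otimes> k'"
    using fk comm_in[OF g] by (simp add: m_assoc)
  also have "k \<otimes> comm g f' = comm g f' \<otimes> k" using fitting_commute fk comm_in[OF g] by simp
  also have "comm g f \<otimes> (comm g f' \<otimes> k) \<otimes> k' = comm g (f \<otimes> f') \<otimes> (k \<otimes> k')"
    using fk comm_in[OF g] by (simp add: m_assoc comm_mult[OF g])
  finally have "x \<otimes> y = comm g (f \<otimes> f') \<otimes> (k \<otimes> k')" .
  moreover have "commute g (k \<otimes> k')" using commute_mult fk g by simp
  ultimately show "x \<otimes> y \<in> comm_ker g"
    using comm_kerI[of "f \<otimes> f'" "k \<otimes> k'" g] fk by simp
qed

end

lemma (in group) abelian_subgroups_fgD: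
  assumes "abelian_subgroups_fg G" "subgroup A G" "\<And>x y. x \<in> A \<Longrightarrow> y \<in> A \<Longrightarrow> commute x y"
  shows "\<exists>S. finite S \<and> S \<subseteq> A \<and> generate G S = A"
proof -
  have "subgroup A G \<and> (\<forall>x\<in>A. \<forall>y\<in>A. x \<otimes> y = y \<otimes> x)" using assms(2,3) by blast
  with assms(1) show ?thesis unfolding abelian_subgroups_fg_def by (elim allE impE)
qed

lemma (in positive_length_group) fitting_finitely_generated:
  assumes "abelian_subgroups_fg G"
  shows "\<exists>S. finite S \<and> S \<subseteq> fitting \<and> generate G S = fitting"
  by (rule abelian_subgroups_fgD[OF assms fitting_subgroup]) (rule fitting_commute)

section \<open>Lifting generators through the centraliser of a generic element\<close>

context fitting_lattice
begin

text \<open>\<open>z \<otimes> g\<close> and \<open>g \<otimes> z\<close> differ by an element of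
  the Fitting subgroup, which acts trivially on that abelian subgroup.\<close>

lemma conjg_fitting_commute:
  assumes "z \<in> carrier G" "g \<in> carrier G" "commute_mod z g" "f \<in> fitting"
  shows "conjg z (conjg g f) = conjg g (conjg z f)"
proof -
  let ?w = "conjg z g \<otimes> inv g"
  let ?h = "conjg g (conjg z f)"
  have w: "?w \<in> fitting" using assms(3) by (simp add: commute_mod_def)
  have "z \<otimes> g = ?w \<otimes> (g \<otimes> z)" using assms(1,2) by (simp add: conjg_def m_assoc)
  then have "conjg z (conjg g f) = conjg ?w ?h"
    using assms w by (simp add: conjg_conj)
  also have "\<dots> = ?h"
    using fitting_commute[OF w, of ?h] assms w conjg_eq_self_iff[of ?w ?h] by simp
  finally show ?thesis .
qed

lemma conjg_comm:
  assumes "z \<in> carrier G" "g \<in> carrier G" "commute_mod z g" "f \<in> fitting"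
  shows "conjg z (comm g f) = comm g (conjg z f)"
  unfolding comm_def using assms conjg_fitting_commute[OF assms] by (simp add: conjg_mult conjg_inv)

lemma comm_comm_inv:
  assumes "g \<in> carrier G" "f \<in> fitting"
  shows "comm g f \<otimes> comm g (inv f) = \<one>"
  using comm_mult[of g f "inv f"] assms by (simp add: comm_def)

lemma uniform_comm_ker_power:
  assumes g: "g \<in> carrier G" and S: "finite S" "S \<subseteq> fitting" "generate G S = fitting"
  shows "\<exists>d::int. d > 0 \<and> (\<forall>f\<in>fitting. f [^] d \<in> comm_ker g)"
proof -
  note J = comm_ker_subgroup[OF g]
  obtain e where e: "\<And>s. s \<in> S \<Longrightarrow> e s \<noteq> 0 \<and> s [^] (e s :: int) \<in> comm_ker g"
    using comm_ker_power[OF g] S(2) by (metis subsetD)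
  \<comment> \<open>The exponents \<open>e s\<close> may be negative; squaring their product makes
    it positive and keeps it divisible by each of them.\<close>
  define d where "d = (\<Prod>s\<in>S. e s) * (\<Prod>s\<in>S. e s)"
  have "(\<Prod>s\<in>S. e s) \<noteq> 0" using e S(1) by simp
  then have "d > 0" unfolding d_def by (metis not_real_square_gt_zero zero_less_mult_iff linorder_neqE)
  have "subgroup {f \<in> fitting. f [^] d \<in> comm_ker g} G"
  proof (rule subgroupI)
    show "{f \<in> fitting. f [^] d \<in> comm_ker g} \<noteq> {}"
      using subgroup.one_closed[OF J] by (auto intro!: exI[of _ \<one>])
  next
    fix f assume "f \<in> {f \<in> fitting. f [^] d \<in> comm_ker g}"
    then show "inv f \<in> {f \<in> fitting. f [^] d \<in> comm_ker g}"
      using subgroup.m_inv_closed[OF J] by (simp add: int_pow_inv)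
  next
    fix f h assume "f \<in> {f \<in> fitting. f [^] d \<in> comm_ker g}" "h \<in> {f \<in> fitting. f [^] d \<in> comm_ker g}"
    then show "f \<otimes> h \<in> {f \<in> fitting. f [^] d \<in> comm_ker g}"
      using subgroup.m_closed[OF J] fitting_commute[of f h] by (simp add: int_pow_mult_distrib)
  qed auto
  moreover have "S \<subseteq> {f \<in> fitting. f [^] d \<in> comm_ker g}"
  proof
    fix s assume s: "s \<in> S"
    then have "e s dvd d" unfolding d_def using S(1) by (intro dvd_mult dvd_prodI)
    then obtain q where q: "d = e s * q" by blast
    have "s [^] d = (s [^] e s) [^] q" using s S(2) q by (auto simp: int_pow_pow)
    then show "s \<in> {f \<in> fitting. f [^] d \<in> comm_ker g}"
      using e[OF s] s S(2) subgroup_int_pow_closed[OF J] by auto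
  qed
  ultimately have "generate G S \<subseteq> {f \<in> fitting. f [^] d \<in> comm_ker g}"
    by (intro generate_subgroup_incl)
  then show ?thesis using S(3) \<open>d > 0\<close> by blast
qed

text \<open>For generic \<open>g\<close> the centraliser of \<open>g\<close> in \<open>\<Gamma>\<close> is abelian, hence finitely generated, and
  together with the Fitting subgroup it has finite index: an element \<open>x\<close> can be corrected by an
  element of the Fitting subgroup to commute with \<open>g\<close> once \<open>[x, g]\<close> lies in \<open>comm_ker g\<close>.\<close>

lemma Gamma_finitely_generated:
  assumes fg: "abelian_subgroups_fg G"
  shows "\<exists>S. finite S \<and> S \<subseteq> \<Gamma> \<and> generate G S = \<Gamma>"
proof -
  obtain g where g: "g \<in> \<Gamma>" "\<forall>\<chi>\<in>wts \<Gamma>. \<chi> g = 1 \<longrightarrow> (\<forall>x\<in>\<Gamma>. \<chi> x = 1)"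
    using exists_generic_element by blast
  have gc: "g \<in> carrier G" using g(1) by simp
  have central: "commute x k" if "k \<in> fitting" "commute g k" "x \<in> \<Gamma>" for x k
    using generic_centralizer_central[OF g that] .
  note J = comm_ker_subgroup[OF gc]
  define C where "C = {x \<in> \<Gamma>. commute g x}"
  have C: "subgroup C G"
  proof (rule subgroupI)
    show "C \<noteq> {}" using gc by (auto simp: C_def intro!: exI[of _ \<one>])
    show "inv x \<in> C" if "x \<in> C" for x using that commute_inv[of g x] gc by (simp add: C_def)
    show "x \<otimes> y \<in> C" if "x \<in> C" "y \<in> C" for x y
      using that commute_mult[of g x y] gc by (simp add: C_def)
  qed (auto simp: C_def)
  have C_abelian: "commute x y" if "x \<in> C" "y \<in> C" for x y
  proof -
    have x: "x \<in> \<Gamma>" "commute g x" and y: "y \<in> \<Gamma>" "commute g y" using that by (simp_all add: C_def)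
    let ?z = "conjg x y \<otimes> inv y"
    have z: "?z \<in> fitting" using Gamma_commute_mod[OF x(1) y(1)] by (simp add: commute_mod_def)
    have "?z \<in> C"
      unfolding conjg_def using that C by (simp add: subgroup.m_closed subgroup.m_inv_closed)
    then have gz: "commute g ?z" by (simp add: C_def)
    show ?thesis
      by (rule commute_if_commutator_commutes) (use x y central[OF z gz] in auto)
  qed
  have "\<exists>S. finite S \<and> S \<subseteq> C \<and> generate G S = C"
    by (rule abelian_subgroups_fgD[OF fg C]) (rule C_abelian)
  then obtain SC where SC: "finite SC" "SC \<subseteq> C" "generate G SC = C" by (elim exE conjE)
  obtain SF where SF: "finite SF" "SF \<subseteq> fitting" "generate G SF = fitting"
    using fitting_finitely_generated[OF fg] by (elim exE conjE)
  obtain d :: int where d: "d > 0" "\<And>f. f \<in> fitting \<Longrightarrow> f [^] d \<in> comm_ker g"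
    using uniform_comm_ker_power[OF gc SF] by blast
  define c where "c x = conjg x g \<otimes> inv g" for x
  have c: "c x \<in> fitting" if "x \<in> \<Gamma>" for x
    using Gamma_commute_mod[OF that g(1)] by (simp add: commute_mod_def c_def)
  \<comment> \<open>Finitely many classes of commutators with \<open>g\<close>. If
    \<open>\<phi> x = \<phi> y\<close>, then \<open>c y \<otimes> inv (c x)\<close> is a
    \<open>d\<close>-th power in the Fitting subgroup, hence lies in
    \<open>comm_ker g\<close>.\<close>
  define \<phi> where "\<phi> x = restrict (\<lambda>i. \<psi> (c x) i mod d) {..<m}" for x
  have "\<phi> ` \<Gamma> \<subseteq> {..<m} \<rightarrow>\<^sub>E {0..<d}" using d(1) by (auto simp: \<phi>_def split: if_splits)
  then have fin: "finite (\<phi> ` \<Gamma>)" by (rule finite_subset) (intro finite_PiE; simp)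
  define r where "r t = (SOME x. x \<in> \<Gamma> \<and> \<phi> x = t)" for t
  have r: "r (\<phi> x) \<in> \<Gamma>" "\<phi> (r (\<phi> x)) = \<phi> x" if "x \<in> \<Gamma>" for x
    using someI[of "\<lambda>y. y \<in> \<Gamma> \<and> \<phi> y = \<phi> x" x] that unfolding r_def by auto
  let ?S = "r ` \<phi> ` \<Gamma> \<union> SF \<union> SC"
  have S\<Gamma>: "?S \<subseteq> \<Gamma>" using r SF(2) SC(2) by (auto simp: C_def)
  have "\<Gamma> \<subseteq> carrier G" by auto
  with S\<Gamma> have Sc: "?S \<subseteq> carrier G" by (rule subset_trans)
  note gen = generate_is_subgroup[OF Sc]
  have "y \<in> generate G ?S" if y: "y \<in> \<Gamma>" for y
  proof -
    define x where "x = r (\<phi> y)"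
    have x: "x \<in> \<Gamma>" and \<phi>: "\<phi> x = \<phi> y" using r[OF y] by (simp_all add: x_def)
    have xc: "x \<in> carrier G" and yc: "y \<in> carrier G" using x y by simp_all
    have dvd: "d dvd \<psi> (c y) i - \<psi> (c x) i" for i
    proof (cases "i < m")
      case True
      then show ?thesis using fun_cong[OF \<phi>[symmetric], of i] by (simp add: \<phi>_def mod_eq_dvd_iff)
    next
      case False
      then show ?thesis using psi_supp c x y by simp
    qed
    define v where "v i = (\<psi> (c y) i - \<psi> (c x) i) div d" for i
    have v: "\<psi> (c y) i - \<psi> (c x) i = d * v i" for i
      unfolding v_def using dvd[of i] by simp
    have "v i = 0" if "i \<ge> m" for i using v[of i] psi_supp[OF c] x y that d(1) by simp
    then obtain h where h: "h \<in> fitting" "\<psi> h = v" using exists_fitting by blast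
    have "h [^] d = c y \<otimes> inv (c x)"
      by (rule psi_inj) (use h c x y v in \<open>simp_all add: fun_eq_iff psi_int_pow psi_mult psi_inv\<close>)
    then have "c y \<otimes> inv (c x) \<in> comm_ker g" using d(2)[OF h(1)] by simp
    then obtain f0 k where fk: "f0 \<in> fitting" "k \<in> fitting" "commute g k" "c y \<otimes> inv (c x) = comm g f0 \<otimes> k"
      unfolding comm_ker_def by blast
    let ?u = "inv x \<otimes> y"
    \<comment> \<open>Comparing \<open>c y\<close> with \<open>c x\<close> describes the commutator
      of \<open>?u\<close> with \<open>g\<close> after conjugation by \<open>inv x\<close>. This
      fixes the central \<open>k\<close> and turns \<open>comm g f0\<close> into
      \<open>comm g f\<close>.\<close>
    define f where "f = conjg (inv x) f0"
    have f: "f \<in> fitting" using fk x by (simp add: f_def)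
    have cc: "c x \<in> carrier G" "c y \<in> carrier G" using c x y by simp_all
    have "conjg y g = (c y \<otimes> inv (c x)) \<otimes> conjg x g"
      using xc yc gc cc by (simp add: c_def m_assoc inv_mult_group)
    then have "conjg ?u g = conjg (inv x) ((comm g f0 \<otimes> k) \<otimes> conjg x g)"
      using xc yc gc fk(4) by (simp flip: conjg_conj)
    also have "\<dots> = conjg (inv x) (comm g f0) \<otimes> conjg (inv x) k \<otimes> g"
      using xc gc fk comm_in[OF gc fk(1)] by (simp add: conjg_mult conjg_conj)
    also have "conjg (inv x) (comm g f0) = comm g f"
      unfolding f_def using conjg_comm[of "inv x" g f0] Gamma_commute_mod[of "inv x" g] x g(1) fk(1) by simp
    also have "conjg (inv x) k = k"
      using central[OF fk(2,3), of "inv x"] x fk(2) by (simp add: conjg_eq_self_iff)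
    finally have ug: "conjg ?u g = comm g f \<otimes> k \<otimes> g" .
    note cf = comm_in[OF gc f] and cf' = comm_in[OF gc fitting_closures(3)[OF f]]
    \<comment> \<open>The correction by \<open>inv f\<close> cancels \<open>comm g f\<close> and
      leaves only \<open>k\<close> as the commutator of \<open>?v\<close> with \<open>g\<close>. As
      \<open>k\<close> commutes with both, it is 1, so \<open>?v\<close> lies in \<open>C\<close>
      and \<open>y = x \<otimes> (f \<otimes> ?v)\<close>.\<close>
    let ?v = "inv f \<otimes> ?u"
    have v\<Gamma>: "?v \<in> \<Gamma>" using f x y by simp
    have "conjg ?v g = conjg (inv f) (comm g f \<otimes> k) \<otimes> conjg (inv f) g"
      using ug f xc yc gc fk(2) cf by (simp add: conjg_mult flip: conjg_conj)
    also have "conjg (inv f) (comm g f \<otimes> k) = comm g f \<otimes> k"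
      using fitting_commute[of "inv f" "comm g f \<otimes> k"] f fk(2) cf by (simp add: conjg_eq_self_iff)
    also have "conjg (inv f) g = comm g (inv f) \<otimes> g"
      using f gc by (simp add: conjg_def comm_def m_assoc inv_mult_group)
    also have "comm g f \<otimes> k \<otimes> (comm g (inv f) \<otimes> g) = (comm g f \<otimes> comm g (inv f)) \<otimes> k \<otimes> g"
      using fitting_commute[OF fk(2) cf'] cf cf' fk(2) gc by (simp add: m_assoc) (simp flip: m_assoc)
    also have "\<dots> = k \<otimes> g" using comm_comm_inv[OF gc f] fk(2) gc by simp
    finally have vg: "conjg ?v g = k \<otimes> g" .
    have "k = \<one>"
      by (rule commuting_commutator_trivial[OF _ gc _ vg central[OF fk(2,3) v\<Gamma>] fk(3)]) (use v\<Gamma> fk(2) in auto)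
    then have "commute ?v g" using vg v\<Gamma> gc conjg_eq_self_iff[of ?v g] by simp
    then have "?v \<in> C" using v\<Gamma> by (simp add: C_def)
    then have "?v \<in> generate G ?S" using SC(3) mono_generate[of SC ?S] by blast
    moreover have "f \<in> generate G ?S" using f SF(3) mono_generate[of SF ?S] by blast
    moreover have "x \<in> generate G ?S" using y by (intro generate.incl) (auto simp: x_def)
    ultimately have "x \<otimes> (f \<otimes> ?v) \<in> generate G ?S"
      using generate.eng by metis
    then show ?thesis using f xc yc by simp
  qed
  moreover have "generate G ?S \<subseteq> \<Gamma>" by (rule generate_subgroup_incl[OF S\<Gamma> Gamma_subgroup])
  ultimately have "generate G ?S = \<Gamma>" by blast
  moreover have "finite ?S" using fin SF(1) SC(1) by simp
  ultimately show ?thesis using S\<Gamma> by (intro exI[of _ ?S] conjI)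
qed

section \<open>The two alternatives for the congruence subgroup\<close>

lemma Gamma_quotient_iso:
  assumes "abelian_subgroups_fg G"
  shows "\<exists>k. G\<lparr>carrier := \<Gamma>\<rparr> Mod fitting \<cong> Zn k"
proof -
  let ?H = "G\<lparr>carrier := \<Gamma>\<rparr>"
  interpret H: group ?H using Gamma_subgroup by (rule subgroup_imp_group)
  interpret N: normal fitting ?H
    using normal_restrict_supergroup[OF Gamma_subgroup fitting_normal fitting_subset_Gamma] .
  let ?q = "\<lambda>a. fitting #>\<^bsub>?H\<^esub> a"
  have hom: "?q \<in> hom ?H (?H Mod fitting)" by (rule N.r_coset_hom_Mod)
  interpret Q: group "?H Mod fitting" by (rule N.factorgroup_is_group)
  interpret q: group_hom ?H "?H Mod fitting" ?q
    by unfold_locales (rule hom)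
  have carr: "carrier (?H Mod fitting) = ?q ` \<Gamma>" by (simp add: carrier_FactGroup)
  have q_one: "?q a = fitting \<longleftrightarrow> a \<in> fitting" if "a \<in> \<Gamma>" for a
    using that H.coset_join1[of fitting a] H.coset_join2[of a fitting] N.subgroup_axioms fitting_subset_Gamma
    by auto
  have comm_group: "comm_group (?H Mod fitting)"
  proof (rule Q.group_comm_groupI)
    fix X Y assume "X \<in> carrier (?H Mod fitting)" "Y \<in> carrier (?H Mod fitting)"
    then obtain x y where xy: "x \<in> \<Gamma>" "y \<in> \<Gamma>" "X = ?q x" "Y = ?q y" unfolding carr by blast
    have "x \<otimes> y = (conjg x y \<otimes> inv y) \<otimes> (y \<otimes> x)" using xy by (simp add: conjg_def m_assoc)
    then have "x \<otimes> y \<in> fitting #> (y \<otimes> x)"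
      using Gamma_commute_mod[OF xy(1,2)] by (auto simp: r_coset_def commute_mod_def)
    then have "fitting #> (x \<otimes> y) = fitting #> (y \<otimes> x)"
      using repr_independence[OF _ _ fitting_subgroup, of "x \<otimes> y" "y \<otimes> x"] xy by simp
    then show "X \<otimes>\<^bsub>?H Mod fitting\<^esub> Y = Y \<otimes>\<^bsub>?H Mod fitting\<^esub> X"
      using q.hom_mult[of x y] q.hom_mult[of y x] xy by simp
  qed
  obtain S where S: "finite S" "S \<subseteq> \<Gamma>" "generate G S = \<Gamma>"
    using Gamma_finitely_generated[OF assms] by blast
  have "generate (?H Mod fitting) (?q ` S) = ?q ` generate ?H S"
    by (rule q.generate_img) (use S in simp)
  also have "generate ?H S = \<Gamma>" using generate_consistent[OF S(2) Gamma_subgroup] S(3) by simp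
  finally have gen: "generate (?H Mod fitting) (?q ` S) = carrier (?H Mod fitting)" using carr by simp
  have torsion_free: "X = \<one>\<^bsub>?H Mod fitting\<^esub>"
    if X: "X \<in> carrier (?H Mod fitting)" "n > 0" "X [^]\<^bsub>?H Mod fitting\<^esub> n = \<one>\<^bsub>?H Mod fitting\<^esub>" for X and n :: nat
  proof -
    obtain x where x: "x \<in> \<Gamma>" "X = ?q x" using X(1) carr by blast
    have "?q (x [^]\<^bsub>?H\<^esub> n) = fitting" using X(3) x N.FactGroup_pow[of x n] by simp
    then have "x [^] n \<in> fitting" using q_one[of "x [^] n"] x by (simp add: nat_pow_consistent[symmetric])
    then have "x \<in> fitting" using Gamma_mod_fitting_torsion_free x X(2) by blast
    then show ?thesis using q_one x by simp
  qed
  show ?thesis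
    by (rule comm_group.fg_torsion_free_iso_Zn[OF comm_group _ _ gen torsion_free]) (use S carr in auto)
qed

text \<open>Iterated commutators of \<open>f\<close> with \<open>h\<close> descend the lower central
  series and become 1; by \<open>comm_funpow_one\<close> the first one is already 1. So every
  \<open>h\<close> centralises the Fitting subgroup.\<close>

lemma nilpotent_Gamma_eq_fitting:
  assumes "nilpotent_group (G\<lparr>carrier := \<Gamma>\<rparr>)"
  shows "\<Gamma> = fitting"
proof
  let ?H = "G\<lparr>carrier := \<Gamma>\<rparr>"
  obtain n where n: "(lcs_step ?H ^^ n) \<Gamma> = {\<one>}"
    using assms by (auto simp: nilpotent_group_def)
  show "\<Gamma> \<subseteq> fitting"
  proof
    fix h assume h: "h \<in> \<Gamma>"
    have hc: "h \<in> carrier G" using h by simp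
    show "h \<in> fitting"
    proof (rule centralizer_fitting[OF solvable hc])
      fix f assume f: "f \<in> fitting"
      have "(comm h ^^ k) f \<in> (lcs_step ?H ^^ k) \<Gamma> \<and> (comm h ^^ k) f \<in> fitting" for k
      proof (induction k)
        case 0
        then show ?case using f by simp
      next
        case (Suc k)
        let ?f = "(comm h ^^ k) f"
        have ff: "?f \<in> fitting" "?f \<in> \<Gamma>" using Suc by auto
        have "comm h ?f = ?f \<otimes>\<^bsub>?H\<^esub> h \<otimes>\<^bsub>?H\<^esub> inv\<^bsub>?H\<^esub> ?f \<otimes>\<^bsub>?H\<^esub> inv\<^bsub>?H\<^esub> h"
          using ff h by (simp add: m_inv_consistent[OF Gamma_subgroup] comm_def conjg_def m_assoc inv_mult_group)
        then have "comm h ?f \<in> lcs_step ?H ((lcs_step ?H ^^ k) \<Gamma>)"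
          unfolding lcs_step_def[of ?H "(lcs_step ?H ^^ k) \<Gamma>"]
          by (intro generate.incl CollectI exI conjI) (use Suc h in auto)
        then show ?case using comm_in[OF hc ff(1)] by simp
      qed
      from this[of n] have "(comm h ^^ n) f = \<one>" using n by simp
      then show "commute h f" by (rule comm_funpow_one[OF hc f])
    qed
  qed
qed (rule fitting_subset_Gamma)

lemma Gamma_dichotomy:
  assumes "abelian_subgroups_fg G"
  shows "(\<exists>n. G\<lparr>carrier := \<Gamma>\<rparr> \<cong> Zn n) \<or> special_extension G \<Gamma>"
proof (cases "nilpotent_group (G\<lparr>carrier := \<Gamma>\<rparr>)")
  case True
  then have "G\<lparr>carrier := \<Gamma>\<rparr> \<cong> Zn m"
    using psi_iso nilpotent_Gamma_eq_fitting by (metis is_isoI)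
  then show ?thesis by blast
next
  case False
  obtain k where k: "G\<lparr>carrier := \<Gamma>\<rparr> Mod fitting \<cong> Zn k" using Gamma_quotient_iso[OF assms] by blast
  have normal: "fitting \<lhd> G\<lparr>carrier := \<Gamma>\<rparr>"
    using normal_restrict_supergroup[OF Gamma_subgroup fitting_normal fitting_subset_Gamma] .
  have effective: "\<forall>h\<in>\<Gamma>. (\<forall>x\<in>fitting. h \<otimes> x \<otimes> inv h = x) \<longrightarrow> h \<in> fitting"
  proof (intro ballI impI)
    fix h assume h: "h \<in> \<Gamma>" "\<forall>x\<in>fitting. h \<otimes> x \<otimes> inv h = x"
    show "h \<in> fitting"
    proof (rule centralizer_fitting[OF solvable Gamma_closed[OF h(1)]])
      fix f assume f: "f \<in> fitting"
      then have "conjg h f = f" using h(2) by (simp add: conjg_def)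
      then show "commute h f" using h(1) f by (simp add: conjg_eq_self_iff)
    qed
  qed
  have "\<forall>h\<in>\<Gamma> - fitting. \<not> unipotent (conj_matrix G fitting \<psi> m h)"
  proof (intro ballI notI)
    fix h assume h: "h \<in> \<Gamma> - fitting" and "unipotent (conj_matrix G fitting \<psi> m h)"
    then have "h \<in> fitting" by (intro unipotent_conj_matrix_in_fitting) (rule Gamma_closed, rule DiffD1)
    with h show False by (rule DiffD2)
  qed
  then have "\<exists>N m k psi. N \<lhd> G\<lparr>carrier := \<Gamma>\<rparr> \<and> psi \<in> iso (G\<lparr>carrier := N\<rparr>) (Zn m) \<and>
      G\<lparr>carrier := \<Gamma>\<rparr> Mod N \<cong> Zn k \<and> (\<forall>h\<in>\<Gamma>. (\<forall>x\<in>N. h \<otimes> x \<otimes> inv h = x) \<longrightarrow> h \<in> N) \<and>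
      (\<forall>h\<in>\<Gamma> - N. \<not> unipotent (conj_matrix G N psi m h))"
    using normal psi_iso k effective
    by (intro exI[of _ fitting] exI[of _ m] exI[of _ k] exI[of _ \<psi>] conjI)
  then show ?thesis
    unfolding special_extension_def using False by (intro disjI2 conjI)
qed

end

theorem (in positive_length_group) solvable_dichotomy:
  assumes solv: "solvable G" and fg: "abelian_subgroups_fg G"
  shows "\<exists>B. finite_index_subgroup B G \<and>
    ((\<exists>n. G\<lparr>carrier := B\<rparr> \<cong> Zn n) \<or> special_extension G B)"
proof -
  let ?F = "G\<lparr>carrier := fitting\<rparr>"
  interpret F: group ?F using fitting_subgroup by (rule subgroup_imp_group)
  have "comm_group ?F"
    by (rule F.group_comm_groupI) (simp add: fitting_commute)
  moreover obtain S where S: "finite S" "S \<subseteq> fitting" "generate G S = fitting"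
    using fitting_finitely_generated[OF fg] by (elim exE conjE)
  moreover have "generate ?F S = carrier ?F"
    using generate_consistent[OF S(2) fitting_subgroup] S(3) by simp
  moreover have "x = \<one>\<^bsub>?F\<^esub>" if "x \<in> carrier ?F" "n > 0" "x [^]\<^bsub>?F\<^esub> n = \<one>\<^bsub>?F\<^esub>" for x and n :: nat
    using that torsion_free[of x] by (auto simp: infinite_order_def nat_pow_consistent[symmetric])
  ultimately obtain m where "?F \<cong> Zn m"
    using comm_group.fg_torsion_free_iso_Zn[of ?F S] by auto
  then obtain \<psi> where "\<psi> \<in> iso ?F (Zn m)" unfolding is_iso_def by blast
  then interpret fitting_lattice G l \<psi> m
    using solv by unfold_locales
  show ?thesis
    using Gamma_subgroup Gamma_finite_index Gamma_dichotomy[OF fg]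
    unfolding finite_index_subgroup_def by blast
qed

section \<open>Passage to subgroups of finite index\<close>

text \<open>Every coset of \<open>B\<close> is a coset of \<open>B\<close> inside \<open>H\<close>,
  translated by the representative of a coset of \<open>H\<close>.\<close>

lemma (in group) finite_index_trans:
  assumes H: "finite_index_subgroup H G" and B: "finite_index_subgroup B (G\<lparr>carrier := H\<rparr>)"
  shows "finite_index_subgroup B G"
proof -
  let ?H = "G\<lparr>carrier := H\<rparr>"
  have HG: "subgroup H G" and BH: "subgroup B ?H"
    and fin: "finite (rcosets H)" "finite (rcosets\<^bsub>?H\<^esub> B)"
    using H B by (simp_all add: finite_index_subgroup_def)
  have BG: "subgroup B G" using incl_subgroup[OF HG BH] .
  have Bc: "B \<subseteq> carrier G" using BG by (rule subgroup.subset)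
  define r where "r X = (SOME x. x \<in> carrier G \<and> H #> x = X)" for X
  have r: "r (H #> x) \<in> carrier G" "H #> r (H #> x) = H #> x" if "x \<in> carrier G" for x
    using someI[of "\<lambda>y. y \<in> carrier G \<and> H #> y = H #> x" x] that unfolding r_def by auto
  have "rcosets B \<subseteq> (\<lambda>(X, Y). Y #> r X) ` ((rcosets H) \<times> (rcosets\<^bsub>?H\<^esub> B))"
  proof
    fix Z assume "Z \<in> rcosets B"
    then obtain x where x: "x \<in> carrier G" "Z = B #> x" unfolding RCOSETS_def by blast
    let ?r = "r (H #> x)"
    have "x \<in> H #> ?r" using rcos_self[OF x(1) HG] r[OF x(1)] by simp
    then obtain h where h: "h \<in> H" "x = h \<otimes> ?r" unfolding r_coset_def by blast
    have "Z = (B #> h) #> ?r"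
      using x h r[OF x(1)] Bc subgroup.mem_carrier[OF HG h(1)] by (simp add: coset_mult_assoc)
    moreover have "B #> h \<in> rcosets\<^bsub>?H\<^esub> B" using h(1) by (auto simp: RCOSETS_def)
    moreover have "H #> x \<in> rcosets H" using x(1) by (auto simp: RCOSETS_def)
    ultimately show "Z \<in> (\<lambda>(X, Y). Y #> r X) ` ((rcosets H) \<times> (rcosets\<^bsub>?H\<^esub> B))"
      by (intro image_eqI[of _ _ "(H #> x, B #> h)"]) simp_all
  qed
  then have "finite (rcosets B)"
    by (rule finite_subset) (intro finite_imageI finite_cartesian_product fin)
  then show ?thesis using BG by (simp add: finite_index_subgroup_def)
qed

text \<open>The definition depends on the ambient carrier only through the inverse, which agrees on
  elements of \<open>B\<close>.\<close>

lemma (in group) special_extension_subgroup: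
  assumes H: "subgroup H G" and B: "B \<subseteq> H" and ext: "special_extension (G\<lparr>carrier := H\<rparr>) B"
  shows "special_extension G B"
proof -
  let ?H = "G\<lparr>carrier := H\<rparr>"
  have inv_eq: "inv\<^bsub>?H\<^esub> h = inv h" if "h \<in> B" for h
    using m_inv_consistent[OF H] that B by blast
  obtain N m k psi where N:
    "\<not> nilpotent_group (G\<lparr>carrier := B\<rparr>)" "N \<lhd> G\<lparr>carrier := B\<rparr>"
    "psi \<in> iso (G\<lparr>carrier := N\<rparr>) (Zn m)" "G\<lparr>carrier := B\<rparr> Mod N \<cong> Zn k"
    "\<And>h. h \<in> B \<Longrightarrow> \<forall>x\<in>N. h \<otimes> x \<otimes> inv\<^bsub>?H\<^esub> h = x \<Longrightarrow> h \<in> N"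
    "\<And>h. h \<in> B - N \<Longrightarrow> \<not> unipotent (conj_matrix ?H N psi m h)"
    using ext unfolding special_extension_def by auto
  have "conj_matrix ?H N psi m h = conj_matrix G N psi m h" if "h \<in> B" for h
    using inv_eq[OF that] by (simp add: conj_matrix_def)
  then have "\<forall>h\<in>B - N. \<not> unipotent (conj_matrix G N psi m h)" using N(6) by force
  moreover have "\<forall>h\<in>B. (\<forall>x\<in>N. h \<otimes> x \<otimes> inv h = x) \<longrightarrow> h \<in> N"
    using N(5) inv_eq by force
  ultimately show ?thesis unfolding special_extension_def using N(1-4) by blast
qed

lemma (in group) derived_exp_consistent:
  assumes "subgroup H G"
  shows "(derived (G\<lparr>carrier := H\<rparr>) ^^ n) H = (derived G ^^ n) H \<and> (derived G ^^ n) H \<subseteq> H"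
proof (induction n)
  case (Suc n)
  then show ?case
    using derived_consistent[OF _ assms, of "(derived G ^^ n) H"] derived_incl[OF _ assms] by simp
qed simp

lemma (in group) solvable_subgroup:
  assumes "solvable G" "subgroup H G"
  shows "solvable (G\<lparr>carrier := H\<rparr>)"
proof -
  interpret H: group "G\<lparr>carrier := H\<rparr>" using assms(2) by (rule subgroup_imp_group)
  obtain n where n: "(derived G ^^ n) (carrier G) = {\<one>}"
    using assms(1) solvable_iff_trivial_derived_seq by blast
  have "(derived G ^^ n) H \<subseteq> {\<one>}"
    using mono_exp_of_derived[OF subgroup.subset[OF assms(2)], of n] n by simp
  moreover have "\<one> \<in> (derived G ^^ n) H"
    using exp_of_derived_is_subgroup[OF assms(2)] by (rule subgroup.one_closed)
  ultimately have "(derived (G\<lparr>carrier := H\<rparr>) ^^ n) H = {\<one>}"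
    using derived_exp_consistent[OF assms(2)] by auto
  then show ?thesis using H.solvable_iff_trivial_derived_seq by auto
qed

lemma (in group) infinite_order_consistent:
  "infinite_order (G\<lparr>carrier := H\<rparr>) x \<longleftrightarrow> infinite_order G x"
  by (simp add: infinite_order_def nat_pow_consistent[symmetric])

lemma (in group) positive_length_group_subgroup:
  assumes "length_function G l" "purely_positive G l" "subgroup H G" "torsion_free_set G H"
  shows "positive_length_group (G\<lparr>carrier := H\<rparr>) l"
proof -
  let ?H = "G\<lparr>carrier := H\<rparr>"
  have HG: "x \<in> carrier G" if "x \<in> H" for x using assms(3) that by (rule subgroup.mem_carrier)
  have inv_eq: "inv\<^bsub>?H\<^esub> h = inv h" if "h \<in> H" for h
    using m_inv_consistent[OF assms(3) that] .
  have "length_function ?H l"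
    using assms(1) HG inv_eq int_pow_consistent[OF assms(3), symmetric] unfolding length_function_def by auto
  moreover have "purely_positive ?H l"
    using assms(2) HG unfolding purely_positive_def infinite_order_consistent by auto
  moreover have "infinite_order ?H x" if "x \<in> carrier ?H" "x \<noteq> \<one>\<^bsub>?H\<^esub>" for x
    using assms(4) that unfolding torsion_free_set_def infinite_order_consistent by auto
  ultimately show ?thesis
    by (intro positive_length_group.intro positive_length_group_axioms.intro subgroup_imp_group[OF assms(3)])
qed

lemma (in group) abelian_subgroups_fg_subgroup:
  assumes "abelian_subgroups_fg G" "subgroup H G"
  shows "abelian_subgroups_fg (G\<lparr>carrier := H\<rparr>)"
  unfolding abelian_subgroups_fg_def
proof (intro allI impI)
  let ?H = "G\<lparr>carrier := H\<rparr>"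
  fix A assume A: "subgroup A ?H \<and> (\<forall>x\<in>A. \<forall>y\<in>A. x \<otimes>\<^bsub>?H\<^esub> y = y \<otimes>\<^bsub>?H\<^esub> x)"
  have AH: "A \<subseteq> H" using subgroup.subset[of A ?H] A by simp
  have "\<exists>S. finite S \<and> S \<subseteq> A \<and> generate G S = A"
    by (rule abelian_subgroups_fgD[OF assms(1)]) (use A incl_subgroup[OF assms(2)] in auto)
  then obtain S where S: "finite S" "S \<subseteq> A" "generate G S = A" by (elim exE conjE)
  have "generate ?H S = A" using generate_consistent[OF _ assms(2), of S] S AH by auto
  then show "\<exists>S. finite S \<and> S \<subseteq> A \<and> generate ?H S = A" using S by blast
qed

theorem theorem18:
  fixes G :: "('a, 'b) monoid_scheme" and l :: "'a \<Rightarrow> real"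
  assumes "group G"
    and "solvable G"
    and "length_function G l"
    and "purely_positive G l"
    and "virtually_torsion_free G"
    and "abelian_subgroups_fg G"
  shows "\<exists>H. finite_index_subgroup H G \<and>
           ((\<exists>n. G\<lparr>carrier := H\<rparr> \<cong> Zn n) \<or> special_extension G H)"
proof -
  interpret group G by fact
  obtain H where H: "finite_index_subgroup H G" "torsion_free_set G H"
    using assms(5) unfolding virtually_torsion_free_def by blast
  then have HG: "subgroup H G" by (simp add: finite_index_subgroup_def)
  let ?H = "G\<lparr>carrier := H\<rparr>"
  interpret H: positive_length_group ?H l
    using positive_length_group_subgroup[OF assms(3,4) HG H(2)] .
  obtain B where B: "finite_index_subgroup B ?H"
    "(\<exists>n. ?H\<lparr>carrier := B\<rparr> \<cong> Zn n) \<or> special_extension ?H B"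
    using H.solvable_dichotomy[OF solvable_subgroup[OF assms(2) HG]
        abelian_subgroups_fg_subgroup[OF assms(6) HG]] by blast
  have "B \<subseteq> H" using B(1) subgroup.subset[of B ?H] by (simp add: finite_index_subgroup_def)
  then have "(\<exists>n. G\<lparr>carrier := B\<rparr> \<cong> Zn n) \<or> special_extension G B"
    using B(2) special_extension_subgroup[OF HG] by auto
  then show ?thesis using finite_index_trans[OF H(1) B(1)] by blast
qed

end
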